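(* With respect to the lexicographic order, $\mathcal{H}_0\cup\mathcal{M}_m$ is a Khovanskii basis for $S_m^{P_m}$. Furthermore, $S_m^{P_m}$ is a complete intersection.
   Context: Let $q$ be a power of an odd prime $p$, let $m\ge 1$ and $n=2m$. Let $S_m=\mathbb{F}_q[y_m,\ldots,y_1,x_1,\ldots,x_m]$ be the polynomial ring in $n$ variables with its standard grading. The group $\mathrm{GL}_n(\mathbb{F}_q)$ acts on the right on $S_m$ by $\mathbb{F}_q$-algebra automorphisms: identify a linear form with its row vector of coefficients with respect to the ordered basis $[y_m,\ldots,y_1,x_1,\ldots,x_m]$, and let $g$ act by right multiplication. Put $\xi_1=\sum_{k=1}^m y_kx_k$ and, for $i\ge2$, $\xi_i=\sum_{k=1}^m\bigl(y_k^{q^{i-1}}x_k+y_kx_k^{q^{i-1}}\bigr)$ (elements of $S_m$; the dependence on $m$ is suppressed). Let $G_m=\mathrm{O}^+_{2m}(\mathbb{F}_q)=\{g\in\mathrm{GL}_n(\mathbb{F}_q)\mid \xi_1\cdot g=\xi_1\}$, and let $P_m$ be the group of upper triangular unipotent matrices in $G_m$ (a Sylow $p$-subgroup). For a linear form $v$, let $N(v)$ be the product of the distinct elements of the $P_m$-orbit of $v$, and put $\mathcal{H}_0=\{N(y_1),\ldots,N(y_m),N(x_1),\ldots,N(x_m)\}$. The set $\mathcal{M}_m\subset S_m^{P_m}$ (which is a basis of $S_m^{P_m}$ as a free module over $\mathbb{F}_q[\mathcal{H}_0]$, and is written $\mathcal{B}_H\mathcal{C}$ in the source) is defined recursively. $\mathcal{M}_1=\{1\}$.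 For $m\ge2$, let $\mathcal{B}_H$ be the set of monomial factors $\prod_{i=1}^{n-2}\xi_i^{a_i}$, $0\le a_i\le q-1$, of $\prod_{i=1}^{n-2}\xi_i^{q-1}$ in $S_m$; let $\varphi:S_{m-1}\to S_m$ be the $\mathbb{F}_q$-algebra map with $\varphi(v)=v^q-vx_m^{q-1}$ for every linear form $v\in S_{m-1}\subset S_m$; let $\mathcal{C}=\varphi(\mathcal{M}_{m-1})$; and put $\mathcal{M}_m=\mathcal{B}_H\mathcal{C}=\{\beta c\mid\beta\in\mathcal{B}_H,\ c\in\mathcal{C}\}$. The lexicographic order on $S_m$ is taken with $y_m>y_{m-1}>\cdots>y_1>x_1>\cdots>x_m$. For a subalgebra $A\subset S_m$, $\mathrm{LT}(A)$ denotes the algebra generated by the lead terms of the elements of $A$; a Khovanskii basis (SAGBI basis) for $A$ is a subset $\mathcal{B}\subset A$ such that the lead terms of the elements of $\mathcal{B}$ generate the algebra $\mathrm{LT}(A)$. *)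

theory Defs
  imports
    "HOL-Computational_Algebra.Primes"
    "HOL-Library.Cardinality"
    "HOL-Library.Poly_Mapping"
    "Jordan_Normal_Form.Matrix"
begin

section \<open>Polynomials\<close>

text \<open>A monomial is a finitely supported exponent map, so that multiplication of monomials is
  addition, and a polynomial is a finitely supported map from monomials to coefficients.\<close>

type_synonym ('v, 'k) mpoly = "('v \<Rightarrow>\<^sub>0 nat) \<Rightarrow>\<^sub>0 'k"

definition Const :: "'k \<Rightarrow> ('v, 'k::zero) mpoly"
  where "Const c = Poly_Mapping.single 0 c"

definition Var :: "'v \<Rightarrow> ('v, 'k::zero_neq_one) mpoly"
  where "Var v = Poly_Mapping.single (Poly_Mapping.single v 1) 1"

definition poly_ring :: "'v set \<Rightarrow> ('v, 'k::zero) mpoly set"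
  where "poly_ring V = {f. \<forall>t \<in> Poly_Mapping.keys f. Poly_Mapping.keys t \<subseteq> V}"

definition poly_subst ::
  "('v \<Rightarrow> ('w, 'k) mpoly) \<Rightarrow> ('v, 'k) mpoly \<Rightarrow> ('w, 'k::comm_ring_1) mpoly"
  where "poly_subst \<sigma> f =
    (\<Sum>t \<in> Poly_Mapping.keys f.
       Const (Poly_Mapping.lookup f t) *
       (\<Prod>v \<in> Poly_Mapping.keys t. \<sigma> v ^ Poly_Mapping.lookup t v))"

definition mon_weight :: "('v \<Rightarrow> nat) \<Rightarrow> ('v \<Rightarrow>\<^sub>0 nat) \<Rightarrow> nat"
  where "mon_weight w t = (\<Sum>v \<in> Poly_Mapping.keys t. w v * Poly_Mapping.lookup t v)"

definition homogeneous :: "('v \<Rightarrow> nat) \<Rightarrow> nat \<Rightarrow> ('v, 'k::zero) mpoly \<Rightarrow> bool"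
  where "homogeneous w d f \<longleftrightarrow> (\<forall>t \<in> Poly_Mapping.keys f. mon_weight w t = d)"

definition subalgebra :: "('v, 'k::comm_ring_1) mpoly set \<Rightarrow> bool"
  where "subalgebra A \<longleftrightarrow>
    range Const \<subseteq> A \<and> (\<forall>f \<in> A. \<forall>g \<in> A. f + g \<in> A \<and> f * g \<in> A)"

definition alg_gen :: "('v, 'k::comm_ring_1) mpoly set \<Rightarrow> ('v, 'k) mpoly set"
  where "alg_gen B = subalgebra hull B"


section \<open>Lead terms and Khovanskii bases\<close>

text \<open>The library order on \<open>'v \<Rightarrow>\<^sub>0 nat\<close> is the lexicographic one in which the least index at
  which two exponent maps differ decides, the larger exponent being larger. Thus the smaller an
  index is in \<open>'v\<close>, the larger is the corresponding variable. Note \<open>lead_term 0 = 0\<close>.\<close>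

definition lead_term :: "('v::linorder, 'k::zero) mpoly \<Rightarrow> ('v, 'k) mpoly"
  where "lead_term f =
    (let t = Max (Poly_Mapping.keys f) in Poly_Mapping.single t (Poly_Mapping.lookup f t))"

definition lead_term_algebra :: "('v::linorder, 'k::comm_ring_1) mpoly set \<Rightarrow> ('v, 'k) mpoly set"
  where "lead_term_algebra A = alg_gen (lead_term ` A)"

definition khovanskii_basis ::
  "('v::linorder, 'k::comm_ring_1) mpoly set \<Rightarrow> ('v, 'k) mpoly set \<Rightarrow> bool"
  where "khovanskii_basis B A \<longleftrightarrow>
    B \<subseteq> A \<and> alg_gen (lead_term ` B) = lead_term_algebra A"


section \<open>Complete intersections\<close>

definition ideal_in :: "'a::comm_ring_1 set \<Rightarrow> 'a list \<Rightarrow> 'a set"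
  where "ideal_in R fs = {\<Sum>i < length fs. a i * fs ! i | a. \<forall>i < length fs. a i \<in> R}"

definition regular_sequence :: "'a::comm_ring_1 set \<Rightarrow> 'a list \<Rightarrow> bool"
  where "regular_sequence R fs \<longleftrightarrow>
    set fs \<subseteq> R \<and>
    (\<forall>i < length fs. \<forall>a \<in> R.
       a * fs ! i \<in> ideal_in R (take i fs) \<longrightarrow> a \<in> ideal_in R (take i fs)) \<and>
    ideal_in R fs \<noteq> R"

text \<open>A graded subalgebra \<open>A\<close> of a (standard graded) polynomial ring is a complete intersection if
  it is generated by finitely many homogeneous elements \<open>h 0, \<dots>, h (N - 1)\<close> of positive degrees
  \<open>d 0, \<dots>, d (N - 1)\<close> whose ideal of relations, in the polynomial ring in \<open>N\<close> variables graded
  by \<open>d\<close>, is generated by a regular sequence of homogeneous elements.\<close>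

definition complete_intersection :: "('v, 'k::comm_ring_1) mpoly set \<Rightarrow> bool"
  where "complete_intersection A \<longleftrightarrow>
    (\<exists>(N::nat) h d (fs :: (nat, 'k) mpoly list).
       (\<forall>i < N. 0 < d i \<and> homogeneous (\<lambda>_. 1) (d i) (h i)) \<and>
       alg_gen (h ` {..<N}) = A \<and>
       regular_sequence (poly_ring {..<N}) fs \<and>
       (\<forall>f \<in> set fs. \<exists>e. homogeneous d e f) \<and>
       {F \<in> poly_ring {..<N}. poly_subst h F = 0} = ideal_in (poly_ring {..<N}) fs)"


section \<open>The orthogonal group and its invariants\<close>

text \<open>Variables are indexed by integers: \<open>x\<^sub>k\<close> is \<open>Var k\<close> and \<open>y\<^sub>k\<close> is \<open>Var (- k)\<close>. The order
  \<open>- m < \<dots> < - 1 < 1 < \<dots> < m\<close> of the indices is the order of the basis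
  \<open>y\<^sub>m, \<dots>, y\<^sub>1, x\<^sub>1, \<dots>, x\<^sub>m\<close>, and with it the order on monomials above is the lexicographic
  order with \<open>y\<^sub>m > \<dots> > y\<^sub>1 > x\<^sub>1 > \<dots> > x\<^sub>m\<close>. The inclusion of \<open>S\<^sub>m\<^sub>-\<^sub>1\<close> in \<open>S\<^sub>m\<close> is literal.\<close>

definition xv :: "nat \<Rightarrow> (int, 'k::zero_neq_one) mpoly"
  where "xv k = Var (int k)"

definition yv :: "nat \<Rightarrow> (int, 'k::zero_neq_one) mpoly"
  where "yv k = Var (- int k)"

definition S :: "nat \<Rightarrow> (int, 'k::zero) mpoly set"
  where "S m = poly_ring ({- int m..int m} - {0})"

text \<open>\<open>basis_index m j\<close> is the index of the variable at position \<open>j < 2 * m\<close> (counting from 0) of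
  the ordered basis, and \<open>basis_pos m\<close> is the inverse map.\<close>

definition basis_index :: "nat \<Rightarrow> nat \<Rightarrow> int"
  where "basis_index m j = (if j < m then int j - int m else int j - int m + 1)"

definition basis_pos :: "nat \<Rightarrow> int \<Rightarrow> nat"
  where "basis_pos m v = nat (if v < 0 then v + int m else v + int m - 1)"

text \<open>\<open>act m g f\<close> is \<open>f \<cdot> g\<close>: the basis element at position \<open>i\<close> has as coefficients the \<open>i\<close>-th unit
  row vector, so it is sent to the linear form with the coefficients of the \<open>i\<close>-th row of \<open>g\<close>.\<close>

definition act :: "nat \<Rightarrow> 'k mat \<Rightarrow> (int, 'k) mpoly \<Rightarrow> (int, 'k::comm_ring_1) mpoly"
  where "act m g =
    poly_subst (\<lambda>v. \<Sum>j < 2 * m. Const (g $$ (basis_pos m v, j)) * Var (basis_index m j))"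

definition \<xi> :: "nat \<Rightarrow> nat \<Rightarrow> (int, 'k::{field,finite}) mpoly"
  where "\<xi> m i =
    (if i = 1 then \<Sum>k = 1..m. yv k * xv k
     else \<Sum>k = 1..m. yv k ^ (CARD('k) ^ (i - 1)) * xv k + yv k * xv k ^ (CARD('k) ^ (i - 1)))"

definition GL :: "nat \<Rightarrow> 'k::field mat set"
  where "GL n = {g \<in> carrier_mat n n. invertible_mat g}"

definition G :: "nat \<Rightarrow> 'k::{field,finite} mat set"
  where "G m = {g \<in> GL (2 * m). act m g (\<xi> m 1) = \<xi> m 1}"

definition P :: "nat \<Rightarrow> 'k::{field,finite} mat set"
  where "P m = {g \<in> G m. upper_triangular g \<and> (\<forall>i < 2 * m. g $$ (i, i) = 1)}"

definition invariants :: "nat \<Rightarrow> (int, 'k::{field,finite}) mpoly set"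
  where "invariants m = {f \<in> S m. \<forall>g \<in> P m. act m g f = f}"

definition orbit_prod :: "nat \<Rightarrow> (int, 'k) mpoly \<Rightarrow> (int, 'k::{field,finite}) mpoly"
  where "orbit_prod m v = \<Prod>((\<lambda>g. act m g v) ` P m)"

definition H0 :: "nat \<Rightarrow> (int, 'k::{field,finite}) mpoly set"
  where "H0 m = (\<lambda>k. orbit_prod m (yv k)) ` {1..m} \<union> (\<lambda>k. orbit_prod m (xv k)) ` {1..m}"

definition BH :: "nat \<Rightarrow> (int, 'k::{field,finite}) mpoly set"
  where "BH m = {\<Prod>i = 1..2 * m - 2. \<xi> m i ^ a i | a. \<forall>i \<in> {1..2 * m - 2}. a i \<le> CARD('k) - 1}"

text \<open>Since \<open>c ^ CARD('k) = c\<close> for all scalars \<open>c\<close>, the map \<open>v \<mapsto> v\<^sup>q - v x\<^sub>m\<^sup>q\<^sup>-\<^sup>1\<close> is linear in \<open>v\<close>, so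
  it suffices to prescribe it on the variables.\<close>

definition \<phi> :: "nat \<Rightarrow> (int, 'k) mpoly \<Rightarrow> (int, 'k::{field,finite}) mpoly"
  where "\<phi> m = poly_subst (\<lambda>v. Var v ^ CARD('k) - Var v * xv m ^ (CARD('k) - 1))"

text \<open>The value at 0 is a dummy.\<close>

fun M :: "nat \<Rightarrow> (int, 'k::{field,finite}) mpoly set"
  where
    "M 0 = {1}"
  | "M (Suc 0) = {1}"
  | "M (Suc (Suc m)) =
      {\<beta> * c | \<beta> c. \<beta> \<in> BH (Suc (Suc m)) \<and> c \<in> \<phi> (Suc (Suc m)) ` M (Suc m)}"

end

(* Write x = x_{m+1}, y = y_{m+1}. Setting x = 0 sends xi_i to the form xi_i on S_m and phi(f) to
   f ^ q. The proof rests on one fact: by the non-vanishing of the Moore determinant, the monomials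
   in xi_1, ..., xi_{2m} with exponents below q are independent over q-th powers. Let B be the span
   of the products phi(G) x^j N(y)^t xi^a with G invariant in rank m and all a_i < q. The fact says
   that B is saturated: an element of B divisible by x is x times an element of B. Conversely an
   invariant f in rank m + 1 lies in B after multiplication by a power of x: its leading coefficient
   in y is an invariant not involving y, hence a polynomial in x over the image of phi, and some
   xi^a N(y)^t has the same y-degree (base q digits) with leading coefficient a power of x. So B is
   the whole invariant ring. The products of generators obtained by iterating have pairwise distinct
   leading monomials, which gives the Khovanskii basis.

   For the complete intersection, xi_i^q - phi(xi_i) vanishes at x = 0, so it is x times an
   invariant. Modulo the orbit products, the q-th power of a generator of one level is thus a
   polynomial in those of lower levels, and a weight makes these relations triangular with leading
   terms Z_i^q in distinct variables. *)
theory Submission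
  imports Defs "HOL-Computational_Algebra.Polynomial" "Jordan_Normal_Form.Determinant"
begin


text \<open>The step from rank m to rank m + 1 works because several counts agree. The y-degree of
  \<xi>_i is q^(i-1), and that of N(y) is q^(2m) since the orbit of y has q^(2m) elements; so base q
  digits realize every y-degree with exactly \<xi>_1, ..., \<xi>_2m. At x = 0 these become forms in
  the 2m variables of rank m. Differentiation kills q-th powers, so their Jacobian is a Moore
  matrix, which is square because 2m forms meet 2m variables. Hence the same set B has enough terms
  for division by leading coefficients in y and no relation modulo x.

  Division introduces only powers of x as denominators. B is merely a span, stable under sums and
  multiplication by x; saturation then strips off the powers of x one at a time.

  One normal form, the reduced monomials, serves three ends: it spans the invariants, its leading
  monomials are distinct, and the resulting independence determines all relations. Oddness of p
  enters where the isotropy of the image of y is solved for the coefficient of x, which occurs there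
  with factor 2. The recursion starts in rank 0, where the invariants are the constants.\<close>

abbreviation "keys \<equiv> Poly_Mapping.keys"
abbreviation "lookup \<equiv> Poly_Mapping.lookup"
abbreviation "single \<equiv> Poly_Mapping.single"

section \<open>Monomial values, evaluation and substitution\<close>

lemma mpoly_sum: "f = (\<Sum>t\<in>keys f. single t (lookup f t))"
  by (rule poly_mapping_eqI) (auto simp: lookup_sum lookup_single when_def in_keys_iff)

definition mon_val :: "('v \<Rightarrow> 'b) \<Rightarrow> ('v \<Rightarrow>\<^sub>0 nat) \<Rightarrow> 'b::comm_semiring_1"
  where "mon_val \<sigma> t = (\<Prod>v\<in>keys t. \<sigma> v ^ lookup t v)"

lemma mon_val_superset: "finite A \<Longrightarrow> keys t \<subseteq> A \<Longrightarrow> mon_val \<sigma> t = (\<Prod>v\<in>A. \<sigma> v ^ lookup t v)"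
  unfolding mon_val_def by (rule prod.mono_neutral_left) (auto simp: in_keys_iff)

lemma keys_add_nat: "keys (s + t :: 'v \<Rightarrow>\<^sub>0 nat) = keys s \<union> keys t"
  by (auto simp: in_keys_iff lookup_add)

lemma mon_val_add: "mon_val \<sigma> (s + t) = mon_val \<sigma> s * mon_val \<sigma> t"
  by (simp add: mon_val_superset[of "keys s \<union> keys t"] keys_add_nat lookup_add power_add prod.distrib)

lemma mon_val_0 [simp]: "mon_val \<sigma> 0 = 1"
  by (simp add: mon_val_def)

lemma mon_val_single [simp]: "mon_val \<sigma> (single v n) = \<sigma> v ^ n"
  by (simp add: mon_val_superset[of "{v}"])

lemma mon_val_cong: "(\<And>v. v \<in> keys t \<Longrightarrow> \<sigma> v = \<tau> v) \<Longrightarrow> mon_val \<sigma> t = mon_val \<tau> t"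
  by (simp add: mon_val_def)

text \<open>The coefficient map \<open>c\<close> is left free so that one homomorphism proof covers
  substitution, the univariate view \<open>up\<close> and evaluation at points of the field.\<close>

definition ev :: "('k::zero \<Rightarrow> 'b) \<Rightarrow> ('v \<Rightarrow> 'b) \<Rightarrow> ('v, 'k) mpoly \<Rightarrow> 'b::comm_semiring_1"
  where "ev c \<sigma> f = (\<Sum>t\<in>keys f. c (lookup f t) * mon_val \<sigma> t)"

lemma poly_subst_ev: "poly_subst \<sigma> = ev Const \<sigma>"
  by (rule ext) (simp add: poly_subst_def ev_def mon_val_def)

lemma comm_ring_hom_ev:
  fixes c :: "'k::comm_ring_1 \<Rightarrow> 'b::comm_ring_1"
  assumes "comm_ring_hom c"
  shows "comm_ring_hom (ev c \<sigma> :: ('v, 'k) mpoly \<Rightarrow> 'b)"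
proof -
  interpret c: comm_ring_hom c by fact
  have add: "ev c \<sigma> (f + g) = ev c \<sigma> f + ev c \<sigma> g" for f g :: "('v, 'k) mpoly"
    unfolding ev_def
    by (rule setsum_keys_plus_distrib) (auto simp: c.hom_add algebra_simps)
  have zero: "ev c \<sigma> 0 = 0" by (simp add: ev_def)
  have sum: "ev c \<sigma> (sum h A) = (\<Sum>x\<in>A. ev c \<sigma> (h x))" for h :: "_ \<Rightarrow> ('v, 'k) mpoly" and A :: "('v \<Rightarrow>\<^sub>0 nat) set"
    by (induction A rule: infinite_finite_induct) (auto simp: add zero)
  have single: "ev c \<sigma> (single t a) = c a * mon_val \<sigma> t" for t a
    by (simp add: ev_def)
  have mult: "ev c \<sigma> (f * g) = ev c \<sigma> f * ev c \<sigma> g" for f g :: "('v, 'k) mpoly"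
  proof -
    have "ev c \<sigma> (f * g) = ev c \<sigma> (\<Sum>s\<in>keys f. \<Sum>t\<in>keys g. single (s + t) (lookup f s * lookup g t))"
      by (rule arg_cong[of _ _ "ev c \<sigma>"], rule trans[OF arg_cong2[OF mpoly_sum[of f] mpoly_sum[of g], of "(*)"]])
        (simp add: sum_product mult_single)
    also have "\<dots> = (\<Sum>s\<in>keys f. \<Sum>t\<in>keys g. (c (lookup f s) * mon_val \<sigma> s) * (c (lookup g t) * mon_val \<sigma> t))"
      by (simp add: sum single c.hom_mult mon_val_add mult_ac)
    also have "\<dots> = ev c \<sigma> f * ev c \<sigma> g"
      by (simp add: ev_def sum_product)
    finally show ?thesis .
  qed
  have one: "ev c \<sigma> 1 = 1" by (simp add: ev_def)
  show ?thesis
    by standard (auto simp: add mult zero one)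
qed

lemma ev_single: "c 0 = 0 \<Longrightarrow> ev c \<sigma> (single t a) = c a * mon_val \<sigma> t"
  by (simp add: ev_def)

lemma ev_Const [simp]: "c 0 = 0 \<Longrightarrow> ev c \<sigma> (Const a) = c a"
  by (simp add: Const_def ev_single)

lemma ev_Var [simp]: "c 0 = 0 \<Longrightarrow> c 1 = 1 \<Longrightarrow> ev c \<sigma> (Var v) = \<sigma> v"
  by (simp add: Var_def ev_single)

lemma comm_ring_hom_Const: "comm_ring_hom (Const :: 'k::comm_ring_1 \<Rightarrow> ('v, 'k) mpoly)"
  by standard (auto simp: Const_def single_add mult_single)

interpretation Const: comm_ring_hom "Const :: 'k::comm_ring_1 \<Rightarrow> ('v, 'k) mpoly"
  by (rule comm_ring_hom_Const)

interpretation subst: comm_ring_hom "poly_subst \<sigma> :: ('v, 'k::comm_ring_1) mpoly \<Rightarrow> ('w, 'k) mpoly"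
  unfolding poly_subst_ev by (rule comm_ring_hom_ev[OF comm_ring_hom_Const])

lemma subst_Const [simp]: "poly_subst \<sigma> (Const a) = Const a"
  by (simp add: poly_subst_ev)

lemma subst_Var [simp]: "poly_subst \<sigma> (Var v) = \<sigma> v"
  by (simp add: poly_subst_ev)

lemma subst_single: "poly_subst \<sigma> (single t a) = Const a * mon_val \<sigma> t"
  by (simp add: poly_subst_ev ev_single)

lemma subst_eq_sum: "poly_subst \<sigma> f = (\<Sum>t\<in>keys f. Const (lookup f t) * mon_val \<sigma> t)"
  by (simp add: poly_subst_ev ev_def)

lemma (in comm_ring_hom) hom_mon_val: "hom (mon_val \<sigma> t) = mon_val (\<lambda>v. hom (\<sigma> v)) t"
  by (simp add: mon_val_def hom_prod hom_power)

lemma mon_val_Var: "mon_val Var t = (single t 1 :: ('v, 'k::comm_ring_1) mpoly)"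
proof -
  have "mon_val Var t = (single (\<Sum>v\<in>keys t. single v (lookup t v)) 1 :: ('v, 'k) mpoly)"
  proof -
    have "Var v ^ n = (single (single v n) 1 :: ('v, 'k) mpoly)" for v n
      by (induction n) (auto simp: Var_def mult_single simp flip: single_add)
    moreover have "(\<Prod>v\<in>A. single (h v) 1) = (single (sum h A) 1 :: ('v, 'k) mpoly)"
      for A :: "'v set" and h :: "'v \<Rightarrow> 'v \<Rightarrow>\<^sub>0 nat"
      by (induction A rule: infinite_finite_induct) (auto simp: mult_single)
    ultimately show ?thesis by (simp add: mon_val_def)
  qed
  also have "(\<Sum>v\<in>keys t. single v (lookup t v)) = t"
    by (rule poly_mapping_eqI) (auto simp: lookup_sum lookup_single when_def in_keys_iff)
  finally show ?thesis .
qed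

lemma single_eq_mon: "single t a = (Const a * mon_val Var t :: ('v, 'k::comm_ring_1) mpoly)"
  by (simp add: mon_val_Var Const_def mult_single)

lemma mpoly_sum': "f = (\<Sum>t\<in>keys f. Const (lookup f t) * mon_val Var t)"
  for f :: "('v, 'k::comm_ring_1) mpoly"
  by (rule trans[OF mpoly_sum[of f]]) (simp add: single_eq_mon)

lemma hom_eq_ev:
  fixes h :: "('v, 'k::comm_ring_1) mpoly \<Rightarrow> 'b::comm_ring_1"
  assumes "comm_ring_hom h"
  shows "h f = ev (\<lambda>a. h (Const a)) (\<lambda>v. h (Var v)) f"
proof -
  interpret comm_ring_hom h by fact
  show ?thesis
    by (rule trans[OF arg_cong[OF mpoly_sum'[of f], of h]]) (simp add: hom_sum hom_mult hom_mon_val ev_def)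
qed

text \<open>The workhorse for comparing composed ring maps: equivariance and commutation statements
  below reduce to a check on the constants and on the variables in \<open>V\<close>.\<close>

lemma hom_eq_on_poly_ring:
  fixes h1 h2 :: "('v, 'k::comm_ring_1) mpoly \<Rightarrow> 'b::comm_ring_1"
  assumes "comm_ring_hom h1" "comm_ring_hom h2" "f \<in> poly_ring V"
    and "\<And>a. h1 (Const a) = h2 (Const a)" "\<And>v. v \<in> V \<Longrightarrow> h1 (Var v) = h2 (Var v)"
  shows "h1 f = h2 f"
  unfolding hom_eq_ev[OF assms(1), of f] hom_eq_ev[OF assms(2), of f] ev_def
  using assms(3-5) by (auto intro!: sum.cong arg_cong2[of _ _ _ _ "(*)"] mon_val_cong simp: poly_ring_def)

lemma comm_ring_hom_comp:
  "comm_ring_hom f \<Longrightarrow> comm_ring_hom g \<Longrightarrow> comm_ring_hom (\<lambda>x. f (g x))"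
  for f :: "'b::comm_ring_1 \<Rightarrow> 'c::comm_ring_1" and g :: "'a::comm_ring_1 \<Rightarrow> 'b"
proof -
  assume f: "comm_ring_hom f" and g: "comm_ring_hom g"
  interpret f: comm_ring_hom f by fact
  interpret g: comm_ring_hom g by fact
  show ?thesis by standard (simp_all add: g.hom_add f.hom_add g.hom_mult f.hom_mult)
qed

lemma subst_subst: "poly_subst \<sigma> (poly_subst \<tau> f) = poly_subst (\<lambda>v. poly_subst \<sigma> (\<tau> v)) f"
  by (rule hom_eq_on_poly_ring[of "\<lambda>f. poly_subst \<sigma> (poly_subst \<tau> f)" _ f UNIV])
    (auto intro: comm_ring_hom_comp subst.comm_ring_hom_axioms simp: poly_ring_def)

lemma subst_cong: "f \<in> poly_ring V \<Longrightarrow> (\<And>v. v \<in> V \<Longrightarrow> \<sigma> v = \<tau> v) \<Longrightarrow> poly_subst \<sigma> f = poly_subst \<tau> f"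
  by (rule hom_eq_on_poly_ring[of _ _ f V]) (auto intro: subst.comm_ring_hom_axioms)

lemma comm_ring_hom_id: "comm_ring_hom (\<lambda>x. x :: 'a::comm_ring_1)"
  by standard simp_all

lemma subst_Var_id: "f \<in> poly_ring V \<Longrightarrow> (\<And>v. v \<in> V \<Longrightarrow> \<sigma> v = Var v) \<Longrightarrow> poly_subst \<sigma> f = f"
  for f :: "('v, 'k::comm_ring_1) mpoly"
  by (rule hom_eq_on_poly_ring[of "poly_subst \<sigma>" "\<lambda>f. f" f V])
    (simp_all add: subst.comm_ring_hom_axioms comm_ring_hom_id)

section \<open>Polynomials in a given set of variables\<close>

lemma poly_ring_Const [simp]: "Const a \<in> poly_ring V"
  by (auto simp: poly_ring_def Const_def)

lemma poly_ring_0 [simp]: "0 \<in> poly_ring V"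
  by (auto simp: poly_ring_def)

lemma poly_ring_1 [simp]: "1 \<in> poly_ring V"
  by (auto simp: poly_ring_def)

lemma poly_ring_Var [simp]: "v \<in> V \<Longrightarrow> Var v \<in> poly_ring V"
  by (auto simp: poly_ring_def Var_def)

lemma poly_ring_add: "f \<in> poly_ring V \<Longrightarrow> g \<in> poly_ring V \<Longrightarrow> f + g \<in> poly_ring V"
  using keys_add[of f g] by (auto simp: poly_ring_def)

lemma poly_ring_mult: "f \<in> poly_ring V \<Longrightarrow> g \<in> poly_ring V \<Longrightarrow> f * g \<in> poly_ring V"
  using keys_mult[of f g] by (fastforce simp: poly_ring_def keys_add_nat)

lemma poly_ring_uminus: "f \<in> poly_ring V \<Longrightarrow> - f \<in> poly_ring V"
  for f :: "('v, 'k::ab_group_add) mpoly"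
  by (auto simp: poly_ring_def in_keys_iff)

lemma poly_ring_diff: "f \<in> poly_ring V \<Longrightarrow> g \<in> poly_ring V \<Longrightarrow> f - g \<in> poly_ring V"
  for f :: "('v, 'k::ab_group_add) mpoly"
  using poly_ring_add[OF _ poly_ring_uminus[of g V], of f] by simp

lemma poly_ring_sum: "(\<And>i. i \<in> A \<Longrightarrow> f i \<in> poly_ring V) \<Longrightarrow> sum f A \<in> poly_ring V"
  by (induction A rule: infinite_finite_induct) (auto intro: poly_ring_add)

lemma poly_ring_prod: "(\<And>i. i \<in> A \<Longrightarrow> f i \<in> poly_ring V) \<Longrightarrow> prod f A \<in> poly_ring V"
  for f :: "'i \<Rightarrow> ('v, 'k::comm_ring_1) mpoly"
  by (induction A rule: infinite_finite_induct) (auto intro: poly_ring_mult)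

lemma poly_ring_power: "f \<in> poly_ring V \<Longrightarrow> f ^ n \<in> poly_ring V"
  for f :: "('v, 'k::comm_ring_1) mpoly"
  by (induction n) (auto intro: poly_ring_mult)

lemma poly_ring_mon_val:
  "(\<And>v. v \<in> keys t \<Longrightarrow> \<sigma> v \<in> poly_ring V) \<Longrightarrow> mon_val \<sigma> t \<in> poly_ring V"
  for \<sigma> :: "'w \<Rightarrow> ('v, 'k::comm_ring_1) mpoly"
  unfolding mon_val_def by (auto intro!: poly_ring_prod poly_ring_power)

lemma poly_ring_subst:
  "f \<in> poly_ring V \<Longrightarrow> (\<And>v. v \<in> V \<Longrightarrow> \<sigma> v \<in> poly_ring W) \<Longrightarrow> poly_subst \<sigma> f \<in> poly_ring W"
  unfolding subst_eq_sum
  by (rule poly_ring_sum, rule poly_ring_mult) (auto intro!: poly_ring_mon_val simp: poly_ring_def[of V])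

lemma poly_ring_mono: "V \<subseteq> W \<Longrightarrow> poly_ring V \<subseteq> poly_ring W"
  by (auto simp: poly_ring_def)

section \<open>Weights and leading monomials\<close>

lemma mon_weight_superset:
  "finite A \<Longrightarrow> keys t \<subseteq> A \<Longrightarrow> mon_weight w t = (\<Sum>v\<in>A. w v * lookup t v)"
  unfolding mon_weight_def by (rule sum.mono_neutral_left) (auto simp: in_keys_iff)

lemma mon_weight_add: "mon_weight w (s + t) = mon_weight w s + mon_weight w t"
  by (simp add: mon_weight_superset[of "keys s \<union> keys t"] keys_add_nat lookup_add
      algebra_simps sum.distrib)

lemma mon_weight_0 [simp]: "mon_weight w 0 = 0"
  by (simp add: mon_weight_def)

lemma mon_weight_single [simp]: "mon_weight w (single v n) = w v * n"
  by (simp add: mon_weight_superset[of "{v}"])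

lemma homogeneous_0 [simp]: "homogeneous w d 0"
  by (simp add: homogeneous_def)

lemma homogeneous_Const [simp]: "homogeneous w 0 (Const a)"
  by (auto simp: homogeneous_def Const_def)

lemma homogeneous_1 [simp]: "homogeneous w 0 1"
  by (auto simp: homogeneous_def)

lemma homogeneous_Var: "homogeneous w (w v) (Var v)"
  by (auto simp: homogeneous_def Var_def)

lemma homogeneous_add: "homogeneous w d f \<Longrightarrow> homogeneous w d g \<Longrightarrow> homogeneous w d (f + g)"
  using keys_add[of f g] by (auto simp: homogeneous_def)

lemma homogeneous_uminus: "homogeneous w d f \<Longrightarrow> homogeneous w d (- f)"
  for f :: "('v, 'k::ab_group_add) mpoly"
  by (auto simp: homogeneous_def in_keys_iff)

lemma homogeneous_diff: "homogeneous w d f \<Longrightarrow> homogeneous w d g \<Longrightarrow> homogeneous w d (f - g)"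
  for f :: "('v, 'k::ab_group_add) mpoly"
  using homogeneous_add[OF _ homogeneous_uminus[of w d g], of f] by simp

lemma homogeneous_mult: "homogeneous w d f \<Longrightarrow> homogeneous w e g \<Longrightarrow> homogeneous w (d + e) (f * g)"
  using keys_mult[of f g] by (fastforce simp: homogeneous_def mon_weight_add)

lemma homogeneous_sum: "(\<And>i. i \<in> A \<Longrightarrow> homogeneous w d (f i)) \<Longrightarrow> homogeneous w d (sum f A)"
  by (induction A rule: infinite_finite_induct) (auto intro: homogeneous_add)

lemma homogeneous_power: "homogeneous w d f \<Longrightarrow> homogeneous w (d * n) (f ^ n)"
  for f :: "('v, 'k::comm_ring_1) mpoly"
  by (induction n) (auto intro: homogeneous_mult)

lemma homogeneous_prod:
  "(\<And>i. i \<in> A \<Longrightarrow> homogeneous w (d i) (f i)) \<Longrightarrow> homogeneous w (sum d A) (prod f A)"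
  for f :: "'i \<Rightarrow> ('v, 'k::comm_ring_1) mpoly"
  by (induction A rule: infinite_finite_induct) (auto intro: homogeneous_mult)

lemma homogeneous_mon_val:
  "(\<And>v. v \<in> keys t \<Longrightarrow> homogeneous w (d v) (\<sigma> v)) \<Longrightarrow> homogeneous w (mon_weight d t) (mon_val \<sigma> t)"
  for \<sigma> :: "'w \<Rightarrow> ('v, 'k::comm_ring_1) mpoly"
  unfolding mon_val_def mon_weight_def by (auto intro!: homogeneous_prod homogeneous_power)

lemma homogeneous_subst:
  assumes "\<And>v. v \<in> V \<Longrightarrow> homogeneous w (d v) (\<sigma> v)" "f \<in> poly_ring V" "homogeneous d e f"
  shows "homogeneous w e (poly_subst \<sigma> f)"
  unfolding subst_eq_sum
proof (rule homogeneous_sum)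
  fix t assume t: "t \<in> keys f"
  have "homogeneous w (0 + mon_weight d t) (Const (lookup f t) * mon_val \<sigma> t)"
    by (rule homogeneous_mult[OF homogeneous_Const homogeneous_mon_val]) (use t assms in \<open>auto simp: poly_ring_def\<close>)
  with t assms(3) show "homogeneous w e (Const (lookup f t) * mon_val \<sigma> t)"
    by (simp add: homogeneous_def)
qed

section \<open>Homogeneous components\<close>

definition hom_part :: "('v \<Rightarrow> nat) \<Rightarrow> nat \<Rightarrow> ('v, 'k::zero) mpoly \<Rightarrow> ('v, 'k) mpoly"
  where "hom_part w d f = Poly_Mapping.mapp (\<lambda>t a. a when mon_weight w t = d) f"

lemma lookup_hom_part: "lookup (hom_part w d f) t = (lookup f t when mon_weight w t = d)"
  by (auto simp: hom_part_def lookup_mapp when_def in_keys_iff)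

lemma keys_hom_part: "keys (hom_part w d f) = {t \<in> keys f. mon_weight w t = d}"
  by (auto simp: in_keys_iff lookup_hom_part when_def split: if_splits)

text \<open>Makes an arbitrary preimage of a homogeneous polynomial homogeneous. As \<open>d\<close>
  records the degrees of the images, the other components of \<open>U\<close> map to other degrees,
  so their total image must vanish.\<close>

lemma subst_hom_part:
  fixes U :: "('w, 'k::comm_ring_1) mpoly"
  assumes \<sigma>: "\<And>v. v \<in> V \<Longrightarrow> homogeneous w (d v) (\<sigma> v)" and U: "U \<in> poly_ring V"
    and f: "poly_subst \<sigma> U = f" "homogeneous w e f"
  shows "poly_subst \<sigma> (hom_part d e U) = f"
proof -
  let ?A = "hom_part d e U"
  have A: "?A \<in> poly_ring V" "homogeneous d e ?A"
    using U by (auto simp: poly_ring_def homogeneous_def keys_hom_part)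
  have sA: "homogeneous w e (poly_subst \<sigma> ?A)"
    by (rule homogeneous_subst[OF \<sigma> A])
  have B: "t \<in> keys U \<and> mon_weight d t \<noteq> e" if "t \<in> keys (U - ?A)" for t
  proof -
    have "lookup U t - (lookup U t when mon_weight d t = e) \<noteq> 0"
      using that by (simp add: in_keys_iff lookup_minus lookup_hom_part)
    then have "mon_weight d t \<noteq> e" by (metis when_simps(1) diff_self)
    moreover from this that have "lookup U t \<noteq> 0"
      by (simp add: in_keys_iff lookup_minus lookup_hom_part)
    ultimately show ?thesis by (simp add: in_keys_iff)
  qed
  have "mon_weight w s \<noteq> e" if "s \<in> keys (poly_subst \<sigma> (U - ?A))" for s
  proof -
    have "s \<in> (\<Union>t\<in>keys (U - ?A). keys (Const (lookup (U - ?A) t) * mon_val \<sigma> t))"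
      using that by (simp only: subst_eq_sum) (erule subsetD[OF keys_sum])
    then obtain t where t: "t \<in> keys (U - ?A)" "s \<in> keys (Const (lookup (U - ?A) t) * mon_val \<sigma> t)"
      by blast
    have "homogeneous w (0 + mon_weight d t) (Const (lookup (U - ?A) t) * mon_val \<sigma> t)"
      using B[OF t(1)] U \<sigma> by (intro homogeneous_mult[OF homogeneous_Const homogeneous_mon_val]) (auto simp: poly_ring_def)
    with t B[OF t(1)] show ?thesis by (auto simp: homogeneous_def)
  qed
  moreover have "f = poly_subst \<sigma> ?A + poly_subst \<sigma> (U - ?A)"
    using f(1) by (simp add: subst.hom_minus)
  ultimately have "poly_subst \<sigma> (U - ?A) = 0"
  proof (intro poly_mapping_eqI)
    fix s
    assume B: "\<And>s. s \<in> keys (poly_subst \<sigma> (U - ?A)) \<Longrightarrow> mon_weight w s \<noteq> e"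
      and eq: "f = poly_subst \<sigma> ?A + poly_subst \<sigma> (U - ?A)"
    show "lookup (poly_subst \<sigma> (U - ?A)) s = lookup 0 s"
    proof (rule ccontr)
      assume "lookup (poly_subst \<sigma> (U - ?A)) s \<noteq> lookup 0 s"
      then have s: "lookup (poly_subst \<sigma> (U - ?A)) s \<noteq> 0" by simp
      then have "mon_weight w s \<noteq> e" by (intro B) (simp only: in_keys_iff not_False_eq_True)
      then have "s \<notin> keys f" "s \<notin> keys (poly_subst \<sigma> ?A)"
        using f(2) sA unfolding homogeneous_def by blast+
      then have "lookup f s = 0" "lookup (poly_subst \<sigma> ?A) s = 0"
        by (simp_all only: in_keys_iff not_not)
      moreover have "lookup f s = lookup (poly_subst \<sigma> ?A) s + lookup (poly_subst \<sigma> (U - ?A)) s"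
        by (simp only: eq[THEN arg_cong[of _ _ lookup]] lookup_add)
      ultimately show False using s by (simp only: add_0)
    qed
  qed
  then show ?thesis using f(1) by (simp add: subst.hom_minus)
qed

text \<open>The leading coefficient is required to be 1, which makes the notion multiplicative over
  any commutative ring.\<close>

definition LM :: "('v::linorder, 'k::zero_neq_one) mpoly \<Rightarrow> ('v \<Rightarrow>\<^sub>0 nat) \<Rightarrow> bool"
  where "LM f t \<longleftrightarrow> lookup f t = 1 \<and> (\<forall>s\<in>keys f. s \<le> t)"

lemma LM_lead_term: "LM f t \<Longrightarrow> lead_term f = single t 1"
proof -
  assume *: "LM f t"
  then have a: "lookup f t = 1" "\<forall>s\<in>keys f. s \<le> t" by (simp_all add: LM_def)
  then have "t \<in> keys f" by (simp add: in_keys_iff)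
  with a have "Max (keys f) = t" by (intro Max_eqI finite_keys) blast+
  with a show ?thesis unfolding lead_term_def Let_def by (simp only:)
qed

lemma LM_not_0: "LM f t \<Longrightarrow> f \<noteq> 0"
  by (auto simp: LM_def)

lemma LM_single: "LM (single t 1) t"
  by (auto simp: LM_def)

lemma LM_1: "LM 1 0"
  by (auto simp: LM_def)

lemma LM_Var: "LM (Var v) (single v 1)"
  unfolding Var_def by (rule LM_single)

lemma LM_add: "LM f t \<Longrightarrow> (\<And>s. s \<in> keys g \<Longrightarrow> s < t) \<Longrightarrow> LM (f + g) t"
proof -
  assume f: "LM f t" and g: "\<And>s. s \<in> keys g \<Longrightarrow> s < t"
  from g have "lookup g t = 0" by (meson in_keys_iff order_less_irrefl)
  moreover have "s \<le> t" if "s \<in> keys (f + g)" for s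
    using that keys_add[of f g] f g unfolding LM_def by (blast intro: less_imp_le)
  ultimately show ?thesis using f by (simp add: LM_def lookup_add)
qed

lemma LM_keys_minus: "LM f t \<Longrightarrow> u \<in> keys (f - single t 1) \<Longrightarrow> u < t"
  for f :: "('v::linorder, 'k::comm_ring_1) mpoly"
proof -
  assume f: "LM f t" and u: "u \<in> keys (f - single t 1)"
  then have "u \<noteq> t" by (auto simp: in_keys_iff LM_def lookup_minus)
  moreover from u \<open>u \<noteq> t\<close> have "u \<in> keys f"
    by (simp add: in_keys_iff lookup_minus lookup_single)
  ultimately show ?thesis using f unfolding LM_def by (simp add: order_less_le)
qed

text \<open>After the leading monomials are split off, every monomial of the other three products is
  below \<open>s + t\<close>, because addition of exponent maps is strictly monotone for this
  order.\<close>

lemma LM_mult: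
  fixes f g :: "('v::linorder, 'k::comm_ring_1) mpoly"
  assumes "LM f s" "LM g t"
  shows "LM (f * g) (s + t)"
proof -
  define f' g' where "f' = f - single s 1" and "g' = g - single t 1"
  have f: "f = single s 1 + f'" "u \<in> keys f' \<Longrightarrow> u < s" for u
    using LM_keys_minus[OF assms(1)] by (simp_all add: f'_def)
  have g: "g = single t 1 + g'" "u \<in> keys g' \<Longrightarrow> u < t" for u
    using LM_keys_minus[OF assms(2)] by (simp_all add: g'_def)
  have fg: "f * g = single (s + t) 1 + (single s 1 * g' + f' * single t 1 + f' * g')"
    by (subst f(1), subst g(1)) (simp only: distrib_left distrib_right mult_single mult_1_left add_ac)
  have "u < s + t" if u: "u \<in> keys (single s 1 * g' + f' * single t 1 + f' * g')" for u
  proof -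
    have keys_single1: "keys (single w (1::'k)) = {w}" for w :: "'v \<Rightarrow>\<^sub>0 nat"
      by (simp only: keys_single one_neq_zero if_False)
    from u have "u \<in> keys (single s 1 * g') \<union> keys (f' * single t 1) \<union> keys (f' * g')"
      by (rule rev_subsetD) (rule order_trans[OF keys_add], rule Un_mono[OF keys_add order_refl])
    then have "(\<exists>b\<in>keys g'. u = s + b) \<or> (\<exists>a\<in>keys f'. u = a + t) \<or> (\<exists>a\<in>keys f'. \<exists>b\<in>keys g'. u = a + b)"
      using keys_mult[of "single s (1 :: 'k)" g'] keys_mult[of f' "single t (1 :: 'k)"] keys_mult[of f' g']
      unfolding keys_single1 by blast
    then show ?thesis
      using f(2) g(2) by (elim disjE bexE) (simp_all only: add_strict_left_mono add_strict_right_mono add_strict_mono)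
  qed
  then show ?thesis unfolding fg by (rule LM_add[OF LM_single])
qed

lemma LM_prod: "(\<And>i. i \<in> A \<Longrightarrow> LM (f i) (t i)) \<Longrightarrow> LM (prod f A) (sum t A)"
  for f :: "'i \<Rightarrow> ('v::linorder, 'k::comm_ring_1) mpoly"
  by (induction A rule: infinite_finite_induct) (auto intro: LM_mult LM_1)

definition mon_pow :: "nat \<Rightarrow> ('v \<Rightarrow>\<^sub>0 nat) \<Rightarrow> ('v \<Rightarrow>\<^sub>0 nat)"
  where "mon_pow n t = Poly_Mapping.map ((*) n) t"

lemma lookup_mon_pow [simp]: "lookup (mon_pow n t) v = n * lookup t v"
  by (simp add: mon_pow_def map.rep_eq when_def)

lemma mon_pow_0 [simp]: "mon_pow 0 t = 0"
  by (rule poly_mapping_eqI) simp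

lemma mon_pow_Suc: "mon_pow (Suc n) t = t + mon_pow n t"
  by (rule poly_mapping_eqI) (simp add: lookup_add)

lemma LM_power: "LM f t \<Longrightarrow> LM (f ^ n) (mon_pow n t)"
  for f :: "('v::linorder, 'k::comm_ring_1) mpoly"
proof (induction n)
  case (Suc n)
  then show ?case by (simp add: LM_mult mon_pow_Suc)
qed (simp add: LM_1)


section \<open>Complete intersections from triangular relations\<close>

lemma lookup_Const_mult: "lookup (Const a * f) t = a * lookup f t"
  for f :: "('v, 'k::comm_ring_1) mpoly"
proof -
  have "Const a * f = (\<Sum>s\<in>keys f. single s (a * lookup f s))"
    by (rule trans[OF arg_cong[OF mpoly_sum[of f]], of "(*) (Const a)"])
      (simp add: sum_distrib_left Const_def mult_single)
  then show ?thesis by (simp add: lookup_sum lookup_single when_def in_keys_iff)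
qed

lemma Var_power: "Var v ^ n = (single (single v n) 1 :: ('v, 'k::comm_ring_1) mpoly)"
  using mon_val_Var[of "single v n"] by simp

lemma single_times_keys:
  "keys (single s 1 * f) \<subseteq> (+) s ` keys f"
  for f :: "('v, 'k::comm_ring_1) mpoly"
proof
  fix u assume "u \<in> keys (single s 1 * f)"
  from subsetD[OF keys_mult this] obtain a b where "u = a + b" "a \<in> keys (single s (1::'k))" "b \<in> keys f"
    by blast
  then show "u \<in> (+) s ` keys f" by auto
qed

section \<open>Ideals given by coefficient sums\<close>

lemma ideal_in_0: "0 \<in> R \<Longrightarrow> 0 \<in> ideal_in R fs"
  unfolding ideal_in_def by (auto intro!: exI[of _ "\<lambda>_. 0"])

lemma ideal_in_add:
  assumes "\<And>a b. a \<in> R \<Longrightarrow> b \<in> R \<Longrightarrow> a + b \<in> R" "x \<in> ideal_in R fs" "y \<in> ideal_in R fs"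
  shows "x + y \<in> ideal_in R fs"
proof -
  from assms(2) obtain a where "x = (\<Sum>i < length fs. a i * fs ! i)" "\<forall>i < length fs. a i \<in> R"
    unfolding ideal_in_def by blast
  moreover from assms(3) obtain b where "y = (\<Sum>i < length fs. b i * fs ! i)" "\<forall>i < length fs. b i \<in> R"
    unfolding ideal_in_def by blast
  ultimately show ?thesis using assms(1) unfolding ideal_in_def
    by (auto intro!: exI[of _ "\<lambda>i. a i + b i"] simp: distrib_right sum.distrib)
qed

lemma ideal_in_generator:
  assumes "0 \<in> R" "a \<in> R" "i < length fs"
  shows "a * fs ! i \<in> ideal_in R fs"
  unfolding ideal_in_def using assms
  by (auto intro!: exI[of _ "\<lambda>j. if j = i then a else 0"] simp: if_distrib[of "\<lambda>x. x * _"] cong: if_cong)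

lemma ideal_in_sum:
  assumes "0 \<in> R" "\<And>a b. a \<in> R \<Longrightarrow> b \<in> R \<Longrightarrow> a + b \<in> R" "\<And>i. i \<in> A \<Longrightarrow> g i \<in> ideal_in R fs"
  shows "sum g A \<in> ideal_in R fs"
  using assms(3)
  by (induction A rule: infinite_finite_induct) (auto intro: ideal_in_add assms(2) ideal_in_0[OF assms(1)])

text \<open>The linear map \<open>\<Theta>\<close> replaces every full \<open>q\<close>-th power of a variable \<open>Z\<close> of \<open>zs\<close> by the
  relation \<open>Z ^ q - T Z\<close>. It is unitriangular for the weight \<open>\<omega>\<close>, hence bijective, and transports
  the regular sequence of the monomials \<open>Z ^ q\<close> to the sequence of relations.\<close>

locale triangular =
  fixes N :: nat and zs :: "nat list" and q :: nat
    and T :: "nat \<Rightarrow> (nat, 'k::comm_ring_1) mpoly" and \<omega> :: "nat \<Rightarrow> nat"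
  assumes q_pos: "q > 0" and zs_distinct: "distinct zs" and zs_less: "set zs \<subseteq> {..<N}"
    and T_ring: "\<And>s. s \<in> set zs \<Longrightarrow> T s \<in> poly_ring {..<N}"
    and T_weight: "\<And>s t. s \<in> set zs \<Longrightarrow> t \<in> keys (T s) \<Longrightarrow> mon_weight \<omega> t < q * \<omega> s"
begin

abbreviation "R \<equiv> poly_ring {..<N} :: (nat, 'k) mpoly set"

definition rel :: "nat \<Rightarrow> (nat, 'k) mpoly"
  where "rel s = Var s ^ q - T s"

definition factor :: "nat \<Rightarrow> nat \<Rightarrow> (nat, 'k) mpoly"
  where "factor i n = (if i \<in> set zs then Var i ^ (n mod q) * rel i ^ (n div q) else Var i ^ n)"

definition \<Theta>m :: "(nat \<Rightarrow>\<^sub>0 nat) \<Rightarrow> (nat, 'k) mpoly"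
  where "\<Theta>m t = (\<Prod>i\<in>keys t. factor i (lookup t i))"

definition \<Theta> :: "(nat, 'k) mpoly \<Rightarrow> (nat, 'k) mpoly"
  where "\<Theta> u = (\<Sum>t\<in>keys u. Const (lookup u t) * \<Theta>m t)"

text \<open>The bound is strict so that \<open>low 0\<close> holds for the zero polynomial alone,
  which starts the induction in \<open>\<Theta>_surj\<close>.\<close>

definition low :: "nat \<Rightarrow> (nat, 'k) mpoly \<Rightarrow> bool"
  where "low n f \<longleftrightarrow> (\<forall>t\<in>keys f. mon_weight \<omega> t < n)"

text \<open>Leading for the weight alone: every other monomial has strictly smaller weight, which
  makes \<open>\<Theta>\<close> unitriangular.\<close>

definition lead :: "(nat, 'k) mpoly \<Rightarrow> (nat \<Rightarrow>\<^sub>0 nat) \<Rightarrow> bool"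
  where "lead f t \<longleftrightarrow> low (mon_weight \<omega> t) (f - single t 1)"

lemma low_add: "low n f \<Longrightarrow> low n g \<Longrightarrow> low n (f + g)"
  using keys_add[of f g] by (auto simp: low_def)

lemma low_0: "low n 0"
  by (simp add: low_def)

lemma low_mono: "low m f \<Longrightarrow> m \<le> n \<Longrightarrow> low n f"
  by (auto simp: low_def)

lemma low_uminus: "low n f \<Longrightarrow> low n (- f)"
  by (auto simp: low_def in_keys_iff)

lemma low_sum: "(\<And>i. i \<in> A \<Longrightarrow> low n (f i)) \<Longrightarrow> low n (sum f A)"
  by (induction A rule: infinite_finite_induct) (simp_all add: low_add low_0)

lemma low_mult: "low (Suc m) f \<Longrightarrow> low n g \<Longrightarrow> low (m + n) (f * g)"
  unfolding low_def
proof
  fix t assume f: "\<forall>t\<in>keys f. mon_weight \<omega> t < Suc m" and g: "\<forall>t\<in>keys g. mon_weight \<omega> t < n"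
    and t: "t \<in> keys (f * g)"
  from subsetD[OF keys_mult t] obtain a b where "t = a + b" "a \<in> keys f" "b \<in> keys g" by blast
  with f g show "mon_weight \<omega> t < m + n" by (simp add: mon_weight_add) (meson add_le_less_mono less_Suc_eq_le)
qed

lemma low_single: "low (Suc (mon_weight \<omega> t)) (single t a)"
  by (auto simp: low_def split: if_splits)

lemma low_Const: "low (Suc 0) (Const a)"
  using low_single[of 0 a] by (simp add: Const_def)

lemma low_ex: "\<exists>n. low n f"
proof -
  have "mon_weight \<omega> t < Suc (\<Sum>t\<in>keys f. mon_weight \<omega> t)" if "t \<in> keys f" for t
    using member_le_sum[of t "keys f" "mon_weight \<omega>"] that by simp
  then show ?thesis unfolding low_def by blast
qed

lemma lead_low: "lead f t \<Longrightarrow> low (Suc (mon_weight \<omega> t)) f"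
  using low_add[OF low_mono[of _ "f - single t 1"] low_single[of t 1]] by (simp add: lead_def)

lemma lead_mult:
  assumes "lead f s" "lead g t"
  shows "lead (f * g) (s + t)"
proof -
  have "f * g - single (s + t) 1 = f * (g - single t 1) + single t 1 * (f - single s 1)"
    by (simp add: algebra_simps mult_single)
  moreover have "low (mon_weight \<omega> s + mon_weight \<omega> t) (f * (g - single t 1))"
    using assms lead_low by (auto intro!: low_mult simp: lead_def)
  moreover have "low (mon_weight \<omega> t + mon_weight \<omega> s) (single t 1 * (f - single s 1))"
    using assms by (auto intro!: low_mult low_single simp: lead_def)
  ultimately show ?thesis by (simp add: lead_def mon_weight_add low_add add.commute)
qed

lemma lead_single: "lead (single t 1) t"
  by (simp add: lead_def low_0)

lemma lead_prod: "(\<And>i. i \<in> A \<Longrightarrow> lead (f i) (t i)) \<Longrightarrow> lead (prod f A) (sum t A)"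
proof (induction A rule: infinite_finite_induct)
  case (insert x F)
  then show ?case by (simp add: lead_mult)
qed (use lead_single[of 0] in auto)

lemma lead_rel_power:
  assumes "i \<in> set zs"
  shows "lead (rel i ^ n) (single i (q * n))"
proof (induction n)
  case 0
  show ?case using lead_single[of 0] by simp
next
  case (Suc n)
  have "rel i - single (single i q) 1 = - T i"
    by (simp add: rel_def Var_power)
  then have "lead (rel i) (single i q)"
    using T_weight[OF assms] by (simp add: lead_def low_uminus low_def mult.commute)
  from lead_mult[OF this Suc] show ?case by (simp add: single_add[symmetric])
qed

lemma lead_factor: "lead (factor i n) (single i n)"
proof (cases "i \<in> set zs")
  case True
  have "lead (Var i ^ (n mod q) * rel i ^ (n div q)) (single i (n mod q) + single i (q * (n div q)))"
    using lead_mult[OF lead_single lead_rel_power[OF True]] by (simp add: Var_power)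
  then show ?thesis using True by (simp add: factor_def single_add[symmetric])
next
  case False
  then show ?thesis by (simp add: factor_def Var_power lead_single)
qed

lemma lead_\<Theta>m: "lead (\<Theta>m t) t"
proof -
  have "(\<Sum>i\<in>keys t. single i (lookup t i)) = t"
    by (rule poly_mapping_eqI) (auto simp: lookup_sum lookup_single when_def in_keys_iff)
  then show ?thesis
    unfolding \<Theta>m_def using lead_prod[of "keys t" "\<lambda>i. factor i (lookup t i)" "\<lambda>i. single i (lookup t i)"]
    by (simp add: lead_factor)
qed

text \<open>Unitriangularity in matrix form: among the monomials of weight at least that of
  \<open>s\<close>, only \<open>s\<close> itself occurs in \<open>\<Theta>m s\<close>.\<close>

lemma lookup_\<Theta>m: "mon_weight \<omega> s \<le> mon_weight \<omega> t \<Longrightarrow> lookup (\<Theta>m s) t = (1 when s = t)"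
proof -
  assume le: "mon_weight \<omega> s \<le> mon_weight \<omega> t"
  have "t \<notin> keys (\<Theta>m s - single s 1)"
    using lead_\<Theta>m[of s] le by (auto simp: lead_def low_def)
  then show ?thesis by (simp add: in_keys_iff lookup_minus lookup_single)
qed

lemma rel_ring: "s \<in> set zs \<Longrightarrow> rel s \<in> R"
  using zs_less T_ring unfolding rel_def by (intro poly_ring_diff poly_ring_power) auto

lemma \<Theta>m_ring: "keys t \<subseteq> {..<N} \<Longrightarrow> \<Theta>m t \<in> R"
  unfolding \<Theta>m_def factor_def
  by (auto intro!: poly_ring_prod poly_ring_mult poly_ring_power rel_ring poly_ring_Var)

lemma \<Theta>_ring: "u \<in> R \<Longrightarrow> \<Theta> u \<in> R"
  unfolding \<Theta>_def
proof (rule poly_ring_sum, rule poly_ring_mult)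
  fix t assume "u \<in> R" "t \<in> keys u"
  then have "keys t \<subseteq> {..<N}" unfolding poly_ring_def by blast
  then show "\<Theta>m t \<in> R" by (rule \<Theta>m_ring)
qed simp

lemma \<Theta>_add: "\<Theta> (u + v) = \<Theta> u + \<Theta> v"
  unfolding \<Theta>_def by (rule setsum_keys_plus_distrib) (simp_all add: Const.hom_add distrib_right)

lemma \<Theta>_0: "\<Theta> 0 = 0"
  by (simp add: \<Theta>_def)

lemma \<Theta>_sum: "\<Theta> (sum f A) = (\<Sum>i\<in>A. \<Theta> (f i))"
  by (induction A rule: infinite_finite_induct) (simp_all add: \<Theta>_add \<Theta>_0)

lemma \<Theta>_single: "\<Theta> (single t a) = Const a * \<Theta>m t"
  by (simp add: \<Theta>_def)

lemma \<Theta>_diff: "\<Theta> (u - v) = \<Theta> u - \<Theta> v"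
  using \<Theta>_add[of "u - v" v] by simp

lemma \<Theta>m_superset: "finite A \<Longrightarrow> keys t \<subseteq> A \<Longrightarrow> \<Theta>m t = (\<Prod>i\<in>A. factor i (lookup t i))"
  unfolding \<Theta>m_def by (rule prod.mono_neutral_left) (auto simp: in_keys_iff factor_def)

text \<open>Adding \<open>q\<close> to the exponent of \<open>Var j\<close> keeps its residue and
  raises its quotient by one, which is one more factor \<open>rel j\<close>.\<close>

lemma \<Theta>m_shift:
  assumes "j \<in> set zs"
  shows "\<Theta>m (single j q + t) = rel j * \<Theta>m t"
proof -
  let ?A = "insert j (keys t)"
  have fac: "factor j (q + n) = rel j * factor j n" for n
    using assms q_pos by (simp add: factor_def mult_ac)
  have "\<Theta>m (single j q + t) = (\<Prod>i\<in>?A. factor i (lookup (single j q + t) i))"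
    using q_pos by (intro \<Theta>m_superset) (auto simp: keys_add_nat)
  also have "\<dots> = factor j (q + lookup t j) * (\<Prod>i\<in>?A - {j}. factor i (lookup (single j q + t) i))"
    by (subst prod.remove[of _ j]) (simp_all add: lookup_add)
  also have "(\<Prod>i\<in>?A - {j}. factor i (lookup (single j q + t) i)) = (\<Prod>i\<in>?A - {j}. factor i (lookup t i))"
    by (intro prod.cong refl) (simp add: lookup_add lookup_single)
  also have "factor j (q + lookup t j) * \<dots> = rel j * (\<Prod>i\<in>?A. factor i (lookup t i))"
    unfolding fac by (subst (2) prod.remove[of _ j]) (simp_all add: mult_ac)
  also have "(\<Prod>i\<in>?A. factor i (lookup t i)) = \<Theta>m t"
    by (rule \<Theta>m_superset[symmetric]) auto
  finally show ?thesis .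
qed

text \<open>\<open>\<Theta>\<close> is linear but not multiplicative; compatibility with
  multiplication by these powers is what transports ideals and regularity.\<close>

lemma \<Theta>_shift:
  assumes "j \<in> set zs"
  shows "\<Theta> (Var j ^ q * u) = rel j * \<Theta> u"
proof -
  have "\<Theta> (Var j ^ q * u) = \<Theta> (\<Sum>t\<in>keys u. single (single j q + t) (lookup u t))"
    by (rule arg_cong[of _ _ \<Theta>], rule trans[OF arg_cong[OF mpoly_sum[of u]], of "(*) (Var j ^ q)"])
      (simp add: Var_power sum_distrib_left mult_single)
  also have "\<dots> = rel j * \<Theta> u"
    unfolding \<Theta>_sum \<Theta>_single \<Theta>m_shift[OF assms] \<Theta>_def[of u] by (simp add: sum_distrib_left mult_ac)
  finally show ?thesis .
qed

text \<open>By unitriangularity the weights in \<open>U - \<Theta> U\<close> are below the bound for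
  \<open>U\<close>, so a preimage is found by induction on that bound.\<close>

lemma \<Theta>_surj: "U \<in> R \<Longrightarrow> \<exists>u\<in>R. \<Theta> u = U"
proof -
  have "\<forall>U\<in>R. low n U \<longrightarrow> (\<exists>u\<in>R. \<Theta> u = U)" for n
  proof (induction n)
    case 0
    have "U = 0" if "low 0 U" for U using that by (simp add: low_def)
    then show ?case using \<Theta>_0 by auto
  next
    case (Suc n)
    show ?case
    proof (intro ballI impI)
      fix U assume U: "U \<in> R" "low (Suc n) U"
      have "U - \<Theta> U = (\<Sum>t\<in>keys U. Const (lookup U t) * (single t 1 - \<Theta>m t))"
        by (rule trans[OF arg_cong[OF mpoly_sum[of U], of "\<lambda>x. x - \<Theta> U"]])
          (simp add: \<Theta>_def right_diff_distrib sum_subtractf single_eq_mon[of _ "lookup _ _"] mon_val_Var)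
      moreover have "low n (Const (lookup U t) * (single t 1 - \<Theta>m t))" if "t \<in> keys U" for t
      proof -
        have "low (mon_weight \<omega> t) (- (\<Theta>m t - single t 1))"
          using lead_\<Theta>m[of t] by (intro low_uminus) (simp add: lead_def)
        then have "low (0 + mon_weight \<omega> t) (Const (lookup U t) * (single t 1 - \<Theta>m t))"
          by (intro low_mult low_Const) simp
        then show ?thesis by (rule low_mono) (use U(2) that in \<open>auto simp: low_def\<close>)
      qed
      ultimately have "low n (U - \<Theta> U)" by (simp add: low_sum)
      moreover have "U - \<Theta> U \<in> R" using U \<Theta>_ring by (simp add: poly_ring_diff)
      ultimately obtain u where "u \<in> R" "\<Theta> u = U - \<Theta> U" using Suc by blast
      then have "U + u \<in> R" "\<Theta> (U + u) = U" using U by (simp_all add: \<Theta>_add poly_ring_add)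
      then show "\<exists>u\<in>R. \<Theta> u = U" by blast
    qed
  qed
  then show "U \<in> R \<Longrightarrow> \<exists>u\<in>R. \<Theta> u = U" using low_ex by blast
qed

text \<open>A monomial of maximal weight in \<open>u\<close> receives no contribution from the
  others and keeps its coefficient in \<open>\<Theta> u\<close>.\<close>

lemma \<Theta>_inj: "\<Theta> u = 0 \<Longrightarrow> u = 0"
proof (rule ccontr)
  assume eq: "\<Theta> u = 0" and "u \<noteq> 0"
  then have "keys u \<noteq> {}" by simp
  then have "Max (mon_weight \<omega> ` keys u) \<in> mon_weight \<omega> ` keys u" by (intro Max_in) auto
  then obtain t where t: "t \<in> keys u" "mon_weight \<omega> t = Max (mon_weight \<omega> ` keys u)" by force
  have "lookup (\<Theta> u) t = (\<Sum>s\<in>keys u. lookup u s * (1 when s = t))"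
    unfolding \<Theta>_def lookup_sum lookup_Const_mult
    by (intro sum.cong refl arg_cong2[of _ _ _ _ "(*)"] lookup_\<Theta>m) (simp add: t)
  also have "\<dots> = lookup u t" using t by (simp add: when_def if_distrib cong: if_cong)
  finally show False using eq t by (simp add: in_keys_iff)
qed

text \<open>The ideal of \<open>R\<close> generated by the powers \<open>Var (zs ! j) ^ q\<close>
  with \<open>j < n\<close>, described by its monomials.\<close>

definition mono_ideal :: "nat \<Rightarrow> (nat, 'k) mpoly set"
  where "mono_ideal n = {u \<in> R. \<forall>t\<in>keys u. \<exists>j<n. q \<le> lookup t (zs ! j)}"

text \<open>With the next lemma, \<open>\<Theta>\<close> maps the monomial ideal onto the ideal of
  the first \<open>n\<close> relations, so membership in the latter can be read off from
  exponents.\<close>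

lemma \<Theta>_mono_ideal:
  assumes u: "u \<in> mono_ideal n" and n: "n \<le> length zs"
  shows "\<Theta> u \<in> ideal_in R (map rel (take n zs))"
proof -
  have "\<Theta> (single t (lookup u t)) \<in> ideal_in R (map rel (take n zs))" if t: "t \<in> keys u" for t
  proof -
    from u t obtain j where j: "j < n" "q \<le> lookup t (zs ! j)" by (auto simp: mono_ideal_def)
    define t' where "t' = t - single (zs ! j) q"
    have tt: "t = single (zs ! j) q + t'"
      using j(2) by (intro poly_mapping_eqI) (auto simp: t'_def lookup_add lookup_minus lookup_single when_def)
    have "keys t \<subseteq> {..<N}" using u t by (auto simp: mono_ideal_def poly_ring_def)
    then have "keys t' \<subseteq> {..<N}" by (auto simp: tt keys_add_nat)
    then have "Const (lookup u t) * \<Theta>m t' \<in> R" by (intro poly_ring_mult \<Theta>m_ring) simp_all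
    moreover have "\<Theta> (single t (lookup u t)) = (Const (lookup u t) * \<Theta>m t') * map rel (take n zs) ! j"
      using j n unfolding \<Theta>_single tt by (subst \<Theta>m_shift) simp_all
    ultimately show ?thesis using j n by (simp only:) (rule ideal_in_generator, simp_all)
  qed
  then have "(\<Sum>t\<in>keys u. \<Theta> (single t (lookup u t))) \<in> ideal_in R (map rel (take n zs))"
    by (intro ideal_in_sum) (simp_all add: poly_ring_add)
  also have "(\<Sum>t\<in>keys u. \<Theta> (single t (lookup u t))) = \<Theta> u"
    by (simp only: \<Theta>_single \<Theta>_def[of u])
  finally show ?thesis .
qed

lemma ideal_in_\<Theta>:
  assumes a: "a \<in> ideal_in R (map rel (take n zs))" and n: "n \<le> length zs"
  shows "\<exists>u\<in>mono_ideal n. \<Theta> u = a"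
proof -
  from a n obtain b where b: "a = (\<Sum>i<n. b i * rel (zs ! i))" "\<forall>i<n. b i \<in> R"
    by (auto simp: ideal_in_def min_def)
  then have "\<forall>i<n. \<exists>u\<in>R. \<Theta> u = b i" using \<Theta>_surj by blast
  then obtain u where u: "\<And>i. i < n \<Longrightarrow> u i \<in> R" "\<And>i. i < n \<Longrightarrow> \<Theta> (u i) = b i" by metis
  define w where "w = (\<Sum>i<n. Var (zs ! i) ^ q * u i)"
  have zi: "zs ! i \<in> set zs" if "i < n" for i using that n by simp
  have "\<Theta> w = a"
    unfolding w_def \<Theta>_sum b(1) by (intro sum.cong refl) (subst \<Theta>_shift; simp add: zi u(2) mult.commute)
  moreover have "w \<in> R" unfolding w_def
    using u(1) zi zs_less by (intro poly_ring_sum poly_ring_mult poly_ring_power poly_ring_Var) auto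
  moreover have "\<exists>j<n. q \<le> lookup t (zs ! j)" if t: "t \<in> keys w" for t
  proof -
    obtain i where i: "i < n" "t \<in> keys (Var (zs ! i) ^ q * u i)"
      using subsetD[OF keys_sum t[unfolded w_def]] by auto
    from subsetD[OF single_times_keys this(2)[unfolded Var_power]]
    obtain t' where "t = single (zs ! i) q + t'" by blast
    with i show ?thesis by (intro exI[of _ i]) (simp add: lookup_add)
  qed
  ultimately show ?thesis by (auto simp: mono_ideal_def)
qed

text \<open>Pulled back along \<open>\<Theta>\<close>, the claim concerns powers of distinct
  variables: multiplying by one of them leaves the exponents of the earlier ones unchanged.\<close>

lemma regular: "regular_sequence R (map rel zs)"
  unfolding regular_sequence_def length_map
proof (intro conjI allI impI ballI)
  show "set (map rel zs) \<subseteq> R" using rel_ring by auto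
next
  fix i a assume i: "i < length zs" and a: "a \<in> R"
    and ai: "a * map rel zs ! i \<in> ideal_in R (take i (map rel zs))"
  obtain u where u: "u \<in> R" "\<Theta> u = a" using \<Theta>_surj[OF a] by blast
  obtain w where w: "w \<in> mono_ideal i" "\<Theta> w = a * rel (zs ! i)"
    using ideal_in_\<Theta>[of _ i] ai i by (auto simp: take_map)
  have "\<Theta> (Var (zs ! i) ^ q * u) = \<Theta> w" using u w i by (subst \<Theta>_shift; simp add: mult.commute)
  then have eq: "Var (zs ! i) ^ q * u = w" using \<Theta>_inj[of "Var (zs ! i) ^ q * u - w"] by (simp add: \<Theta>_diff)
  have "\<exists>j<i. q \<le> lookup t (zs ! j)" if t: "t \<in> keys u" for t
  proof -
    \<comment> \<open>Multiplication by a monomial moves terms without merging them, so every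
      monomial of \<open>u\<close> reappears, shifted, in \<open>w\<close>.\<close>
    have "lookup w (single (zs ! i) q + t) = (\<Sum>s\<in>keys u. lookup u s when s = t)"
      unfolding eq[symmetric]
      by (rule trans[OF arg_cong[OF mpoly_sum[of u], of "\<lambda>u. lookup (Var (zs ! i) ^ q * u) (single (zs ! i) q + t)"]])
        (simp add: Var_power sum_distrib_left mult_single lookup_sum lookup_single)
    also have "\<dots> = lookup u t" using t by (simp add: when_def cong: if_cong)
    finally have "single (zs ! i) q + t \<in> keys w" using t by (simp add: in_keys_iff)
    then obtain j where j: "j < i" "q \<le> lookup (single (zs ! i) q + t) (zs ! j)"
      using w(1) by (auto simp: mono_ideal_def)
    moreover have "zs ! i \<noteq> zs ! j" using i j(1) zs_distinct by (simp add: nth_eq_iff_index_eq)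
    ultimately show ?thesis by (auto simp: lookup_add lookup_single)
  qed
  then have "u \<in> mono_ideal i" using u(1) by (auto simp: mono_ideal_def)
  from \<Theta>_mono_ideal[OF this] u(2) i show "a \<in> ideal_in R (take i (map rel zs))" by (simp add: take_map)
next
  show "ideal_in R (map rel zs) \<noteq> R"
  proof
    assume "ideal_in R (map rel zs) = R"
    then have "1 \<in> ideal_in R (map rel (take (length zs) zs))" by simp
    from ideal_in_\<Theta>[OF this] obtain w where w: "w \<in> mono_ideal (length zs)" "\<Theta> w = 1" by auto
    \<comment> \<open>\<open>\<Theta>\<close> fixes 1, whose exponents are all 0, whereas the
      monomial ideal demands an exponent of at least \<open>q\<close>.\<close>
    have "\<Theta> 1 = 1" using \<Theta>_single[of 0 1] by (simp add: \<Theta>m_def)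
    then have "w = 1" using w(2) \<Theta>_inj[of "w - 1"] by (simp add: \<Theta>_diff)
    with w(1) q_pos show False by (simp add: mono_ideal_def)
  qed
qed

definition reduced :: "(nat \<Rightarrow>\<^sub>0 nat) \<Rightarrow> bool"
  where "reduced t \<longleftrightarrow> (\<forall>s\<in>set zs. lookup t s < q)"

text \<open>The \<open>\<Theta>\<close>-preimage of \<open>F\<close> splits into a reduced part, on
  which \<open>\<Theta>\<close> is the identity, and a part that \<open>\<Theta>\<close> sends into
  the ideal. So \<open>F\<close> is congruent to a reduced polynomial, which vanishes by
  independence when \<open>F\<close> is in the kernel.\<close>

lemma kernel:
  assumes rel0: "\<And>s. s \<in> set zs \<Longrightarrow> poly_subst g (rel s) = 0"
    and indep: "\<And>u. u \<in> R \<Longrightarrow> (\<And>t. t \<in> keys u \<Longrightarrow> reduced t) \<Longrightarrow> poly_subst g u = 0 \<Longrightarrow> u = 0"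
  shows "{F \<in> R. poly_subst g F = 0} = ideal_in R (map rel zs)"
proof
  show "ideal_in R (map rel zs) \<subseteq> {F \<in> R. poly_subst g F = 0}"
  proof
    fix F assume "F \<in> ideal_in R (map rel zs)"
    then obtain a where a: "F = (\<Sum>i<length zs. a i * rel (zs ! i))" "\<forall>i<length zs. a i \<in> R"
      by (auto simp: ideal_in_def)
    have "F \<in> R" unfolding a(1) using a(2) by (intro poly_ring_sum poly_ring_mult rel_ring) auto
    moreover have "poly_subst g F = 0" unfolding a(1) by (simp add: subst.hom_sum subst.hom_mult rel0)
    ultimately show "F \<in> {F \<in> R. poly_subst g F = 0}" by simp
  qed
  show "{F \<in> R. poly_subst g F = 0} \<subseteq> ideal_in R (map rel zs)"
  proof
    fix F assume F: "F \<in> {F \<in> R. poly_subst g F = 0}"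
    then obtain u where u: "u \<in> R" "\<Theta> u = F" using \<Theta>_surj by blast
    define u0 where "u0 = Poly_Mapping.mapp (\<lambda>t a. a when reduced t) u"
    have l0: "lookup u0 t = (lookup u t when reduced t)" for t
      by (auto simp: u0_def lookup_mapp when_def in_keys_iff)
    have k0: "t \<in> keys u \<and> reduced t" if "t \<in> keys u0" for t
      using that by (simp add: in_keys_iff l0)
    have k1: "t \<in> keys u \<and> \<not> reduced t" if "t \<in> keys (u - u0)" for t
      using that by (auto simp: in_keys_iff l0 lookup_minus when_def split: if_splits)
    have "u - u0 \<in> mono_ideal (length zs)"
      unfolding mono_ideal_def
    proof (intro CollectI conjI ballI)
      show "u - u0 \<in> R" using k1 u(1) unfolding poly_ring_def by blast
      fix t assume "t \<in> keys (u - u0)"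
      from k1[OF this] show "\<exists>j<length zs. q \<le> lookup t (zs ! j)"
        unfolding reduced_def by (metis in_set_conv_nth not_less)
    qed
    from \<Theta>_mono_ideal[OF this] have I: "\<Theta> (u - u0) \<in> ideal_in R (map rel zs)" by simp
    then have g1: "poly_subst g (\<Theta> (u - u0)) = 0"
      using \<open>ideal_in R (map rel zs) \<subseteq> {F \<in> R. poly_subst g F = 0}\<close> by blast
    have "\<Theta>m t = single t 1" if "reduced t" for t
    proof -
      have "factor i (lookup t i) = Var i ^ lookup t i" for i
        using that by (simp add: factor_def reduced_def)
      then have "\<Theta>m t = mon_val Var t" by (simp add: \<Theta>m_def mon_val_def)
      then show ?thesis by (simp add: mon_val_Var)
    qed
    then have "\<Theta> u0 = (\<Sum>t\<in>keys u0. Const (lookup u0 t) * single t 1)"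
      unfolding \<Theta>_def using k0 by (intro sum.cong refl) simp
    also have "\<dots> = u0"
      by (rule trans[OF _ mpoly_sum[of u0, symmetric]]) (simp add: Const_def mult_single)
    finally have \<Theta>0: "\<Theta> u0 = u0" .
    have "F = \<Theta> u0 + \<Theta> (u - u0)" using u(2) by (simp add: \<Theta>_diff)
    then have "poly_subst g u0 = 0" using F g1 \<Theta>0 by (simp add: subst.hom_add)
    moreover have "u0 \<in> R" using k0 u(1) unfolding poly_ring_def by blast
    ultimately have "u0 = 0" using k0 by (intro indep) blast+
    with I u(2) show "F \<in> ideal_in R (map rel zs)" by simp
  qed
qed

end


section \<open>Polynomials in one distinguished variable\<close>

lemma comm_ring_hom_pCons: "comm_ring_hom (\<lambda>a. [:a:] :: 'a::comm_ring_1 poly)"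
  by standard (simp_all add: one_pCons)

lemma comm_ring_hom_poly_eval: "comm_ring_hom (\<lambda>p. poly p (a :: 'a::comm_ring_1))"
  by standard simp_all

lemma comm_ring_hom_pcompose: "comm_ring_hom (\<lambda>p. pcompose p (r :: 'a::comm_ring_1 poly))"
  by standard (simp_all add: pcompose_add pcompose_mult pcompose_1)

text \<open>\<open>f\<close> as a polynomial in \<open>Var v\<close>. The coefficients remain in the
  same multivariate ring, though free of \<open>Var v\<close>, so that evaluation at
  \<open>Var v\<close> returns \<open>f\<close>.\<close>

definition up :: "'v \<Rightarrow> ('v, 'k::comm_ring_1) mpoly \<Rightarrow> ('v, 'k) mpoly poly"
  where "up v = ev (\<lambda>a. [:Const a:]) (\<lambda>w. if w = v then [:0, 1:] else [:Var w:])"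

lemma comm_ring_hom_up: "comm_ring_hom (up v :: ('v, 'k::comm_ring_1) mpoly \<Rightarrow> _)"
  unfolding up_def by (intro comm_ring_hom_ev comm_ring_hom_comp[OF comm_ring_hom_pCons comm_ring_hom_Const])

interpretation up: comm_ring_hom "up v :: ('v, 'k::comm_ring_1) mpoly \<Rightarrow> _"
  by (rule comm_ring_hom_up)

lemma up_Const [simp]: "up v (Const a) = [:Const a:]"
  by (simp add: up_def)

lemma up_Var [simp]: "up v (Var w) = (if w = v then [:0, 1:] else [:Var w:])"
  by (simp add: up_def one_pCons)

lemma poly_up: "poly (up v f) g = poly_subst (Var(v := g)) f"
  by (rule hom_eq_on_poly_ring[of "\<lambda>f. poly (up v f) g" _ f UNIV])
    (auto intro: comm_ring_hom_comp[OF comm_ring_hom_poly_eval comm_ring_hom_up] subst.comm_ring_hom_axioms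
      simp: poly_ring_def)

lemma subst_id [simp]: "poly_subst Var f = (f :: (_, _::comm_ring_1) mpoly)"
  by (rule subst_Var_id[of _ UNIV]) (auto simp: poly_ring_def)

lemma poly_up_Var [simp]: "poly (up v f) (Var v) = f"
  by (simp add: poly_up)

lemma up_free: "f \<in> poly_ring (- {v}) \<Longrightarrow> up v f = [:f:]"
  by (rule hom_eq_on_poly_ring[of _ "\<lambda>f. [:f:]" f "- {v}"])
    (simp_all add: comm_ring_hom_up comm_ring_hom_pCons)

lemma up_single: "up v (single t a) = Polynomial.monom (single (Poly_Mapping.update v 0 t) a) (lookup t v)"
proof -
  have split: "t = single v (lookup t v) + Poly_Mapping.update v 0 t"
    by (rule poly_mapping_eqI) (auto simp: lookup_add lookup_single lookup_update when_def)
  have "single (Poly_Mapping.update v 0 t) a \<in> poly_ring (- {v})"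
    by (auto simp: poly_ring_def in_keys_iff lookup_update split: if_splits)
  then have "up v (single (Poly_Mapping.update v 0 t) a) = [:single (Poly_Mapping.update v 0 t) a:]"
    by (rule up_free)
  moreover have "single t a = Var v ^ lookup t v * single (Poly_Mapping.update v 0 t) a"
    unfolding Var_power mult_single by (subst split) simp
  moreover have "[:0, 1 :: ('a, 'b) mpoly:] ^ n = Polynomial.monom 1 n" for n
    by (simp add: monom_altdef)
  ultimately show ?thesis by (simp add: up.hom_mult up.hom_power smult_monom)
qed

lemma coeff_up: "coeff (up v f) i = (\<Sum>t\<in>keys f. single (Poly_Mapping.update v 0 t) (lookup f t) when lookup t v = i)"
proof -
  have "up v f = (\<Sum>t\<in>keys f. Polynomial.monom (single (Poly_Mapping.update v 0 t) (lookup f t)) (lookup t v))"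
    by (rule trans[OF arg_cong[OF mpoly_sum[of f], of "up v"]]) (simp add: up.hom_sum up_single)
  then show ?thesis by (simp add: coeff_sum when_def)
qed

text \<open>A monomial is determined by its exponent of \<open>v\<close> together with its remaining
  part, so distinct terms never collide in a coefficient.\<close>

lemma lookup_coeff_up:
  assumes "t \<in> keys f"
  shows "lookup (coeff (up v f) (lookup t v)) (Poly_Mapping.update v 0 t) = lookup f t"
proof -
  have inj: "s = t" if "Poly_Mapping.update v 0 s = Poly_Mapping.update v 0 t" "lookup s v = lookup t v" for s
  proof (rule poly_mapping_eqI)
    fix w show "lookup s w = lookup t w"
      using that(2) arg_cong[OF that(1), of "\<lambda>u. lookup u w"] by (cases "w = v") (simp_all add: lookup_update)
  qed
  have "lookup (coeff (up v f) (lookup t v)) (Poly_Mapping.update v 0 t) = (\<Sum>s\<in>keys f. lookup f s when s = t)"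
    unfolding coeff_up lookup_sum
    by (intro sum.cong refl) (use inj in \<open>auto simp: when_def lookup_single\<close>)
  also have "\<dots> = lookup f t" using assms by (simp add: when_def cong: if_cong)
  finally show ?thesis .
qed

lemma coeff_up_ring: "f \<in> poly_ring V \<Longrightarrow> coeff (up v f) i \<in> poly_ring (V - {v})"
  unfolding coeff_up
proof (rule poly_ring_sum)
  fix t assume "f \<in> poly_ring V" "t \<in> keys f"
  then have "keys t \<subseteq> V" by (auto simp: poly_ring_def)
  then show "(single (Poly_Mapping.update v 0 t) (lookup f t) when lookup t v = i) \<in> poly_ring (V - {v})"
    by (auto simp: poly_ring_def in_keys_iff lookup_update when_def lookup_single split: if_splits)
qed

lemma up_eq_0_iff: "up v f = 0 \<longleftrightarrow> f = 0"
  by (metis poly_0 poly_up_Var up.hom_zero)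

lemma lookup_subst_zero:
  fixes g :: "('v, 'k::comm_ring_1) mpoly"
  shows "lookup (poly_subst (Var(w := 0)) g) s = (if lookup s w = 0 then lookup g s else 0)"
proof -
  let ?\<epsilon> = "poly_subst (Var(w := 0)) :: ('v, 'k) mpoly \<Rightarrow> ('v, 'k) mpoly"
  have "?\<epsilon> (single r a) = (if lookup r w = 0 then single r a else 0)" for r a
  proof (cases "lookup r w = 0")
    case True
    then have "mon_val (Var(w := 0)) r = (mon_val Var r :: ('v, 'k) mpoly)"
      by (intro mon_val_cong) (auto simp: in_keys_iff)
    then show ?thesis using True by (simp add: subst_single single_eq_mon[symmetric])
  next
    case False
    then have "mon_val (Var(w := 0)) r = (0 :: ('v, 'k) mpoly)" unfolding mon_val_def
      by (intro prod_zero bexI[of _ w]) (simp_all add: in_keys_iff power_0_left)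
    then show ?thesis using False by (simp add: subst_single)
  qed
  then have "?\<epsilon> g = (\<Sum>r\<in>keys g. if lookup r w = 0 then single r (lookup g r) else 0)"
    by (intro trans[OF arg_cong[OF mpoly_sum[of g]], of ?\<epsilon>]) (simp add: subst.hom_sum)
  then have "lookup (?\<epsilon> g) s = (\<Sum>r\<in>keys g. lookup (if lookup r w = 0 then single r (lookup g r) else 0) s)"
    by (simp only: lookup_sum)
  also have "\<dots> = (\<Sum>r\<in>keys g. if r = s then if lookup s w = 0 then lookup g r else 0 else 0)"
    by (intro sum.cong refl) (auto simp: lookup_single when_def)
  also have "\<dots> = (if lookup s w = 0 then lookup g s else 0)" by (simp add: in_keys_iff)
  finally show ?thesis .
qed

lemma prod_roots_dvd:
  fixes P :: "'a::idom poly"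
  assumes "finite W" "\<And>w. w \<in> W \<Longrightarrow> poly P w = 0"
  shows "(\<Prod>w\<in>W. [:- w, 1:]) dvd P"
  using assms
proof (induction W)
  case (insert w W)
  then obtain Q where Q: "P = (\<Prod>w\<in>W. [:- w, 1:]) * Q" by (auto elim: dvdE)
  have "poly (\<Prod>w\<in>W. [:- w, 1:]) w \<noteq> 0" using insert.hyps by (auto simp: poly_prod)
  then have "[:- w, 1:] dvd Q" using insert.prems[of w] Q by (auto simp: poly_eq_0_iff_dvd[symmetric])
  then obtain K where "Q = [:- w, 1:] * K" by (elim dvdE)
  then have "P = (\<Prod>w\<in>insert w W. [:- w, 1:]) * K" using Q
    by (subst prod.insert[OF insert.hyps]) (simp only: mult_ac)
  then show ?case by (rule dvdI)
qed simp

text \<open>A polynomial invariant under the translations by \<open>W\<close> is a polynomial in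
  \<open>\<Prod>w\<in>W. (X - w) = X ^ q - b * X\<close>, so that its exponents are multiples of \<open>q\<close> modulo \<open>b\<close>.\<close>

lemma translation_invariant_coeff:
  fixes P :: "'a::idom poly" and \<epsilon> :: "'a \<Rightarrow> 'b::comm_ring_1"
  assumes "finite W" "0 \<in> W" and W: "\<And>u w. u \<in> W \<Longrightarrow> w \<in> W \<Longrightarrow> u - w \<in> W"
    and \<Phi>: "(\<Prod>w\<in>W. [:- w, 1:]) = Polynomial.monom 1 q - Polynomial.monom b 1" and q: "q > 1"
    and \<epsilon>: "comm_ring_hom \<epsilon>" "\<epsilon> b = 0"
    and P: "\<And>w. w \<in> W \<Longrightarrow> pcompose P [:w, 1:] = P"
  shows "\<not> q dvd i \<Longrightarrow> \<epsilon> (coeff P i) = 0"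
  using P
proof (induction "Polynomial.degree P" arbitrary: P i rule: less_induct)
  case less
  interpret \<epsilon>: comm_ring_hom \<epsilon> by fact
  let ?\<Phi> = "\<Prod>w\<in>W. [:- w, 1:]"
  \<comment> \<open>Translation by \<open>w\<close> gives \<open>P\<close> the same value at
    \<open>w\<close> as at 0, so P - P(0) vanishes on all of \<open>W\<close>.\<close>
  have "poly (P - [:poly P 0:]) w = 0" if "w \<in> W" for w
  proof -
    have "poly P w = poly (pcompose P [:w, 1:]) 0" by (simp add: poly_pcompose)
    then show ?thesis using less.prems(2)[OF that] by simp
  qed
  then have "?\<Phi> dvd P - [:poly P 0:]" by (intro prod_roots_dvd \<open>finite W\<close>)
  then obtain Q where Q: "P - [:poly P 0:] = ?\<Phi> * Q" by (elim dvdE)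
  then have PQ: "P = [:poly P 0:] + ?\<Phi> * Q" by (simp add: algebra_simps)
  have \<Phi>0: "?\<Phi> \<noteq> 0" using \<open>finite W\<close> by (auto simp: prod_zero_iff)
  have deg\<Phi>: "Polynomial.degree ?\<Phi> = q"
  proof -
    have "Polynomial.degree (Polynomial.monom 1 q + - Polynomial.monom b 1) = Polynomial.degree (Polynomial.monom (1 :: 'a) q)"
      using q by (intro degree_add_eq_left) (simp add: degree_monom_eq degree_monom_le le_less_trans[OF degree_monom_le])
    then show ?thesis unfolding \<Phi> by (simp add: degree_monom_eq)
  qed
  \<comment> \<open>This reads P = P(0) + (X^q - b X) Q by coefficients. As
    \<open>\<epsilon>\<close> kills \<open>b\<close>, the coefficient at \<open>i\<close> reduces to
    that of \<open>Q\<close> at \<open>i - q\<close>.\<close>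
  have c: "coeff P i = (if i = 0 then poly P 0 else 0) + (if q \<le> i then coeff Q (i - q) else 0) - (if 1 \<le> i then b * coeff Q (i - 1) else 0)" for i
    by (subst PQ) (simp add: \<Phi> left_diff_distrib coeff_monom_mult coeff_pCons split: nat.splits)
  have i0: "i \<noteq> 0" using less.prems(1) by (intro notI) simp
  have e: "\<epsilon> (coeff P i) = (if q \<le> i then \<epsilon> (coeff Q (i - q)) else 0)"
    using i0 \<epsilon>(2) by (simp add: c \<epsilon>.hom_minus \<epsilon>.hom_mult)
  show ?case
  proof (cases "Q = 0")
    case False
    have "Polynomial.degree (P - [:poly P 0:]) = q + Polynomial.degree Q"
      unfolding Q using \<Phi>0 False by (simp add: degree_mult_eq deg\<Phi>)
    moreover have "Polynomial.degree (P - [:poly P 0:]) \<le> Polynomial.degree P"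
      by (rule degree_diff_le) simp_all
    ultimately have dQ: "Polynomial.degree Q < Polynomial.degree P" using q by linarith
    have inv: "pcompose Q [:w, 1:] = Q" if "w \<in> W" for w
    proof -
      \<comment> \<open>\<open>W\<close> is an additive group, so translation permutes the factors
        of the product. Hence \<open>Q\<close> is again invariant, and the induction applies to
        it.\<close>
      have "pcompose ?\<Phi> [:w, 1:] = (\<Prod>u\<in>W. [:- (u - w), 1:])"
        by (simp add: pcompose_prod pcompose_pCons)
      also have "\<dots> = ?\<Phi>"
      proof (rule prod.reindex_bij_witness[of _ "\<lambda>u. u + w" "\<lambda>u. u - w"])
        fix u assume "u \<in> W"
        then show "u - w \<in> W" using W that by blast
        show "u + w \<in> W" using W[OF \<open>u \<in> W\<close> W[OF \<open>0 \<in> W\<close> that]] by simp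
      qed simp_all
      finally have "pcompose P [:w, 1:] = [:poly P 0:] + ?\<Phi> * pcompose Q [:w, 1:]"
        by (subst PQ) (simp add: pcompose_add pcompose_mult)
      then have "?\<Phi> * pcompose Q [:w, 1:] = ?\<Phi> * Q"
        using less.prems(2)[OF that] Q by (metis add_diff_cancel_left')
      then show ?thesis using \<Phi>0 by simp
    qed
    have "\<not> q dvd i - q" if "q \<le> i" using less.prems(1) that dvd_diffD[of q i q] by auto
    then show ?thesis using less.hyps[OF dQ] inv e by auto
  qed (simp add: e)
qed

section \<open>Finite fields of prime characteristic\<close>

locale finite_field_char =
  fixes p e q :: nat and ty :: "'k::{field,finite} itself"
  assumes p: "prime p" "odd p" and card: "q = p ^ e" and card_field [simp]: "CARD('k) = q"
begin

lemma q_gt_1: "q > 1"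
proof -
  have "card {0, 1 :: 'k} \<le> card (UNIV :: 'k set)" by (intro card_mono) auto
  then show ?thesis by simp
qed

text \<open>Shifting by 1 permutes the field, so summing over it gives \<open>of_nat q = 0\<close>,
  and \<open>q\<close> is a power of \<open>p\<close>.\<close>

lemma of_nat_p: "of_nat p = (0 :: 'k)"
proof -
  have "(\<Sum>x\<in>UNIV. x + 1 :: 'k) = (\<Sum>x\<in>UNIV. x)"
    by (rule sum.reindex_bij_witness[of _ "\<lambda>x. x - 1" "\<lambda>x. x + 1"]) auto
  then have "of_nat q = (0 :: 'k)" by (simp add: sum.distrib)
  then show ?thesis by (simp add: card)
qed

lemma of_nat_p_mpoly: "of_nat p = (0 :: ('v, 'k) mpoly)"
proof -
  have "of_nat p = (Const (of_nat p) :: ('v, 'k) mpoly)" by (simp only: Const.hom_of_nat)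
  then show ?thesis by (simp add: of_nat_p)
qed

lemma char_eq: "of_nat p = (0 :: 'a::comm_ring_1) \<Longrightarrow> CHAR('a) = p"
proof -
  assume "of_nat p = (0 :: 'a)"
  then have "CHAR('a) dvd p" by (simp add: of_nat_eq_0_iff_char_dvd)
  moreover have "CHAR('a) \<noteq> 1"
    using of_nat_eq_0_iff_char_dvd[of 1, where ?'a = 'a] by auto
  ultimately show ?thesis using p(1) by (auto simp: prime_nat_iff)
qed

lemma frob_add: "of_nat p = (0 :: 'a::comm_ring_1) \<Longrightarrow> (x + y :: 'a) ^ (p ^ n) = x ^ (p ^ n) + y ^ (p ^ n)"
  by (rule freshmans_dream') (simp_all add: char_eq p(1))

lemma frob_sum: "of_nat p = (0 :: 'a::comm_ring_1) \<Longrightarrow> (sum f A :: 'a) ^ (p ^ n) = (\<Sum>i\<in>A. f i ^ (p ^ n))"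
  by (rule freshmans_dream_sum') (simp_all add: char_eq p(1))

lemma frob_diff: "of_nat p = (0 :: 'a::comm_ring_1) \<Longrightarrow> (x - y :: 'a) ^ (p ^ n) = x ^ (p ^ n) - y ^ (p ^ n)"
  using frob_add[of "x - y" y n] by (simp add: algebra_simps)

lemma frob_inj: "of_nat p = (0 :: 'a::idom) \<Longrightarrow> (x :: 'a) ^ (p ^ n) = y ^ (p ^ n) \<Longrightarrow> x = y"
proof -
  assume "of_nat p = (0 :: 'a)" "x ^ (p ^ n) = y ^ (p ^ n)"
  then have "(x - y) ^ (p ^ n) = 0" by (simp add: frob_diff)
  then show ?thesis by simp
qed

lemma q_power: "q ^ j = p ^ (e * j)"
  by (simp add: card power_mult)

lemmas frob = frob_add[OF of_nat_p_mpoly] frob_sum[OF of_nat_p_mpoly] frob_diff[OF of_nat_p_mpoly]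

lemma frob_q_add: "(f + g :: ('v, 'k) mpoly) ^ (q ^ j) = f ^ (q ^ j) + g ^ (q ^ j)"
  and frob_q_sum: "(sum h A :: ('v, 'k) mpoly) ^ (q ^ j) = (\<Sum>i\<in>A. h i ^ (q ^ j))"
  unfolding q_power by (rule frob)+

lemma power_q [simp]: "c ^ q = (c :: 'k)"
proof (cases "c = 0")
  case False
  have "c * (\<Prod>y\<in>UNIV-{0}. c * y) = c * c ^ (q - 1) * \<Prod>(UNIV-{0})"
    by (simp add: prod.distrib mult_ac)
  also have "c * c ^ (q - 1) = c ^ q"
    using q_gt_1 by (simp add: power_eq_if)
  also have "(\<Prod>y\<in>UNIV-{0}. c * y) = (\<Prod>y\<in>UNIV-{0}. y)"
    by (rule prod.reindex_bij_witness[of _ "\<lambda>y. y / c" "\<lambda>y. c * y"]) (use False in auto)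
  finally show ?thesis by simp
qed (use q_gt_1 in auto)

lemma power_q_power [simp]: "c ^ (q ^ j) = (c :: 'k)"
  by (induction j) (simp_all add: power_mult)

lemma Const_power_q: "Const c ^ (q ^ j) = (Const c :: ('v, 'k) mpoly)"
  by (simp flip: Const.hom_power)

lemma Const_inj_mult:
  fixes x :: "('v, 'k) mpoly"
  shows "x \<noteq> 0 \<Longrightarrow> inj (\<lambda>c. Const c * x)"
proof (rule injI)
  fix a b assume "x \<noteq> 0" and eq: "Const a * x = Const b * x"
  from \<open>x \<noteq> 0\<close> obtain t where "lookup x t \<noteq> 0" by (metis keys_eq_empty in_keys_iff ex_in_conv)
  with arg_cong[OF eq, of "\<lambda>f. lookup f t"] show "a = b" by (simp add: lookup_Const_mult)
qed

text \<open>Both sides are monic of degree \<open>q\<close> and vanish at the \<open>q\<close>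
  multiples of \<open>x\<close>; a nonzero difference would have more roots than its degree
  allows.\<close>

lemma prod_translates_poly:
  fixes x :: "('v::linorder, 'k) mpoly"
  assumes "x \<noteq> 0"
  shows "(\<Prod>w\<in>range (\<lambda>c. Const c * x). [:- w, 1:]) = Polynomial.monom 1 q - Polynomial.monom (x ^ (q - 1)) 1"
    (is "?\<Phi> = ?\<Psi>")
proof (rule ccontr)
  let ?W = "range (\<lambda>c :: 'k. Const c * x)"
  assume ne: "?\<Phi> \<noteq> ?\<Psi>"
  have cW: "card ?W = q" using Const_inj_mult[OF assms] by (simp add: card_image)
  have "degree_le": "Polynomial.degree (?\<Phi> - ?\<Psi>) < q"
  proof -
    have d1: "Polynomial.degree ?\<Phi> = q"
      using cW by (auto simp: degree_prod_eq_sum_degree)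
    have "lead_coeff ?\<Phi> = 1" by (simp only: lead_coeff_prod) simp
    have d2: "Polynomial.degree ?\<Psi> \<le> q"
      using q_gt_1 by (intro degree_diff_le) (simp_all add: degree_monom_le le_trans[OF degree_monom_le])
    have "coeff ?\<Psi> q = 1" using q_gt_1 by simp
    then have "coeff (?\<Phi> - ?\<Psi>) q = 0" using \<open>lead_coeff ?\<Phi> = 1\<close> unfolding d1 by (simp only: coeff_diff diff_self)
    moreover have "Polynomial.degree (?\<Phi> - ?\<Psi>) \<le> q" by (rule degree_diff_le) (simp only: d1 order_refl, rule d2)
    ultimately show ?thesis using ne by (metis eq_iff_diff_eq_0 leading_coeff_0_iff order_less_le)
  qed
  have "poly (?\<Phi> - ?\<Psi>) w = 0" if "w \<in> ?W" for w
  proof -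
    from that obtain c where w: "w = Const c * x" by blast
    have "poly ?\<Phi> w = 0" using that by (auto simp: poly_prod prod_zero_iff)
    moreover have "w ^ q = w * x ^ (q - 1)"
    proof -
      have "w ^ q = Const c ^ q * (x ^ (q - 1) * x)"
        using q_gt_1 by (simp only: w power_mult_distrib power_minus_mult)
      also have "(Const c :: ('v, 'k) mpoly) ^ q = Const c" using Const_power_q[of c 1] by simp
      finally show ?thesis by (simp only: w mult_ac)
    qed
    ultimately show ?thesis by (simp add: poly_monom mult.commute)
  qed
  then have "card ?W \<le> card {w. poly (?\<Phi> - ?\<Psi>) w = 0}"
    using ne by (intro card_mono poly_roots_finite) auto
  also have "\<dots> \<le> Polynomial.degree (?\<Phi> - ?\<Psi>)" using ne by (intro card_poly_roots_bound) simp
  finally show False using degree_le cW by simp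
qed

text \<open>Identifies the formula for \<phi> on a linear form with a product of translates along
  \<open>x\<close>; this is how orbit products pass to the next rank.\<close>

lemma prod_translates:
  fixes x u :: "('v::linorder, 'k) mpoly"
  assumes "x \<noteq> 0"
  shows "(\<Prod>c\<in>UNIV. u + Const c * x) = u ^ q - u * x ^ (q - 1)"
proof -
  have "u ^ q - u * x ^ (q - 1) = poly (\<Prod>w\<in>range (\<lambda>c. Const c * x). [:- w, 1:]) u"
    by (subst prod_translates_poly[OF assms]) (simp add: poly_monom mult.commute)
  also have "\<dots> = (\<Prod>c\<in>UNIV. u - Const c * x)"
    using Const_inj_mult[OF assms] by (simp add: poly_prod prod.reindex)
  also have "\<dots> = (\<Prod>c\<in>UNIV. u + Const c * x)"
    by (rule prod.reindex_bij_witness[of _ uminus uminus]) (auto simp: Const.hom_uminus)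
  finally show ?thesis ..
qed

text \<open>The case of translations by the multiples of \<open>Var w\<close>: here b is
  \<open>Var w ^ (q - 1)\<close>, and \<epsilon> sets \<open>Var w\<close> to 0, so exactly the
  monomials free of \<open>Var w\<close> survive.\<close>

lemma translation_invariant_exponents:
  fixes f :: "('v::linorder, 'k) mpoly"
  assumes inv: "\<And>a. poly_subst (Var(v := Var v + Const a * Var w)) f = f" and vw: "v \<noteq> w"
    and t: "t \<in> keys f" "lookup t w = 0"
  shows "q dvd lookup t v"
proof (rule ccontr)
  assume nd: "\<not> q dvd lookup t v"
  let ?x = "Var w :: ('v, 'k) mpoly"
  let ?W = "range (\<lambda>c :: 'k. Const c * ?x)"
  let ?\<epsilon> = "poly_subst (Var(w := 0)) :: ('v, 'k) mpoly \<Rightarrow> ('v, 'k) mpoly"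
  have x0: "?x \<noteq> 0" using LM_not_0[OF LM_Var] .
  have "?\<epsilon> (coeff (up v f) (lookup t v)) = 0"
  proof (rule translation_invariant_coeff[OF _ _ _ prod_translates_poly[OF x0] q_gt_1 subst.comm_ring_hom_axioms _ _ nd])
    show "0 \<in> ?W" by (rule range_eqI[of _ _ 0]) simp
    show "u - w \<in> ?W" if "u \<in> ?W" "w \<in> ?W" for u w
    proof -
      from that obtain a b where "u = Const a * ?x" "w = Const b * ?x" by blast
      then show ?thesis by (intro range_eqI[of _ _ "a - b"]) (simp add: Const.hom_minus left_diff_distrib)
    qed
    show "?\<epsilon> (?x ^ (q - 1)) = 0" using q_gt_1 by (simp add: subst.hom_power)
    show "pcompose (up v f) [:u, 1:] = up v f" if "u \<in> ?W" for u
    proof -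
      from that obtain a where u: "u = Const a * ?x" by blast
      have "pcompose (up v f) [:u, 1:] = up v (poly_subst (Var(v := Var v + Const a * Var w)) f)"
        by (rule hom_eq_on_poly_ring[of "\<lambda>f. pcompose (up v f) [:u, 1:]" "\<lambda>f. up v (poly_subst (Var(v := Var v + Const a * Var w)) f)" f UNIV])
          (use vw in \<open>auto intro: comm_ring_hom_comp[OF comm_ring_hom_pcompose comm_ring_hom_up] comm_ring_hom_comp[OF comm_ring_hom_up subst.comm_ring_hom_axioms]
           simp: poly_ring_def u up.hom_add up.hom_mult pcompose_pCons\<close>)
      then show ?thesis by (simp add: inv)
    qed
  qed simp
  moreover have "lookup (?\<epsilon> (coeff (up v f) (lookup t v))) (Poly_Mapping.update v 0 t) = lookup f t"
    using t vw by (simp add: lookup_subst_zero lookup_update lookup_coeff_up)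
  ultimately show False using t by (simp add: in_keys_iff)
qed

end


section \<open>Independence of the forms \<open>\<xi>\<close> over \<open>q\<close>-th powers\<close>

text \<open>Partial derivative by \<open>Var v\<close>, read off from the univariate view so that
  the product rule is inherited.\<close>

definition D :: "'v::linorder \<Rightarrow> ('v, 'k::{idom}) mpoly \<Rightarrow> ('v, 'k) mpoly"
  where "D v f = poly (pderiv (up v f)) (Var v)"

lemma D_add: "D v (f + g) = D v f + D v g"
  by (simp add: D_def up.hom_add pderiv_add)

lemma D_mult: "D v (f * g) = f * D v g + g * D v f"
  for f :: "('v::linorder, 'k::idom) mpoly"
  by (simp add: D_def up.hom_mult pderiv_mult)

lemma D_Const [simp]: "D v (Const a) = 0"
  by (simp add: D_def pderiv_pCons)

lemma D_0 [simp]: "D v 0 = 0"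
  by (simp add: D_def)

lemma D_1 [simp]: "D v 1 = 0"
  by (simp add: D_def)

lemma D_Var: "D v (Var w) = (if w = v then 1 else 0)"
  by (simp add: D_def pderiv_pCons one_pCons)

lemma D_sum: "D v (sum f A) = (\<Sum>i\<in>A. D v (f i))"
  by (induction A rule: infinite_finite_induct) (simp_all add: D_add)

lemma D_power: "D v (f ^ n) = of_nat n * f ^ (n - 1) * D v f"
  for f :: "('v::linorder, 'k::idom) mpoly"
proof (induction n)
  case (Suc n)
  then show ?case by (cases n) (simp_all add: D_mult algebra_simps)
qed simp

lemma D_prod: "finite A \<Longrightarrow> D v (prod f A) = (\<Sum>i\<in>A. D v (f i) * prod f (A - {i}))"
  for f :: "'i \<Rightarrow> ('v::linorder, 'k::idom) mpoly"
proof (induction A rule: finite_induct)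
  case (insert x F)
  have "prod f (insert x F - {i}) = f x * prod f (F - {i})" if "i \<in> F" for i
    using that insert.hyps by (subst insert_Diff_if) (auto simp: prod.insert)
  then show ?case using insert by (simp add: D_mult sum_distrib_left mult_ac)
qed simp

text \<open>Chain rule for a monomial in the \<open>\<sigma> i\<close>. For
  \<open>lookup r i = 0\<close> the truncated difference returns \<open>r\<close> itself, but the
  factor \<open>of_nat 0\<close> removes the term.\<close>

lemma D_mon_val:
  fixes \<sigma> :: "nat \<Rightarrow> ('v::linorder, 'k::idom) mpoly"
  assumes "finite A" "keys r \<subseteq> A"
  shows "D v (mon_val \<sigma> r) = (\<Sum>i\<in>A. of_nat (lookup r i) * mon_val \<sigma> (r - single i 1) * D v (\<sigma> i))"
proof -
  have "D v (mon_val \<sigma> r) = (\<Sum>i\<in>A. D v (\<sigma> i ^ lookup r i) * (\<Prod>j\<in>A - {i}. \<sigma> j ^ lookup r j))"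
    unfolding mon_val_superset[OF assms] by (rule D_prod[OF assms(1)])
  also have "\<dots> = (\<Sum>i\<in>A. of_nat (lookup r i) * mon_val \<sigma> (r - single i 1) * D v (\<sigma> i))"
  proof (rule sum.cong[OF refl])
    fix i assume i: "i \<in> A"
    have "keys (r - single i 1) \<subseteq> A"
      using assms(2) by (auto simp: in_keys_iff lookup_minus)
    then have "mon_val \<sigma> (r - single i 1) = (\<Prod>j\<in>A. \<sigma> j ^ lookup (r - single i 1) j)"
      by (rule mon_val_superset[OF assms(1)])
    also have "\<dots> = \<sigma> i ^ (lookup r i - 1) * (\<Prod>j\<in>A - {i}. \<sigma> j ^ lookup r j)"
      by (subst prod.remove[OF assms(1) i]) (auto simp: lookup_minus lookup_single intro!: prod.cong arg_cong2[of _ _ _ _ "(*)"])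
    finally show "D v (\<sigma> i ^ lookup r i) * (\<Prod>j\<in>A - {i}. \<sigma> j ^ lookup r j) =
        of_nat (lookup r i) * mon_val \<sigma> (r - single i 1) * D v (\<sigma> i)"
      by (simp add: D_power mult_ac)
  qed
  finally show ?thesis .
qed

abbreviation V :: "nat \<Rightarrow> int set"
  where "V m \<equiv> {- int m..int m} - {0}"

lemma single_inj: "single x (Suc n) = single v (Suc n) \<Longrightarrow> x = v"
  by (metis keys_single nat.distinct(1) singleton_inject)

lemma card_V: "card (V m) = 2 * m"
  by (subst card_Diff_singleton) auto

context finite_field_char
begin

lemma \<xi>_eq: "i \<ge> 2 \<Longrightarrow> (\<xi> m i :: (int, 'k) mpoly) = (\<Sum>k = 1..m. yv k ^ (q ^ (i - 1)) * xv k + yv k * xv k ^ (q ^ (i - 1)))"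
  by (simp add: \<xi>_def)

lemma \<xi>_1: "(\<xi> m (Suc 0) :: (int, 'k) mpoly) = (\<Sum>k = 1..m. yv k * xv k)"
  by (simp add: \<xi>_def)

lemma D_q_power: "j \<ge> 1 \<Longrightarrow> D v (f ^ (q ^ j)) = (0 :: ('v::linorder, 'k) mpoly)"
proof -
  assume j: "j \<ge> 1"
  have "e \<noteq> 0" using q_gt_1 card by (intro notI) simp
  then have "p dvd q ^ j" unfolding q_power using j by (intro dvd_power) simp
  then have "of_nat (q ^ j) = (0 :: ('v, 'k) mpoly)"
    by (auto simp: of_nat_p_mpoly elim!: dvdE simp del: of_nat_power)
  then show ?thesis by (simp add: D_power del: of_nat_power)
qed

text \<open>Factors raised to a positive power of \<open>q\<close> have derivative 0, so only the
  linear occurrence of \<open>Var v\<close> contributes, and its cofactor is a power of the dual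
  variable. The Jacobian of the \<xi> is therefore a Moore matrix.\<close>

lemma D_\<xi>:
  assumes "v \<in> V m" "i \<ge> 1"
  shows "D v (\<xi> m i :: (int, 'k) mpoly) = Var (- v) ^ (q ^ (i - 1))"
proof -
  have "D v (\<xi> m i :: (int, 'k) mpoly) = (\<Sum>k = 1..m. yv k ^ (q ^ (i - 1)) * D v (xv k) + xv k ^ (q ^ (i - 1)) * D v (yv k))"
  proof (cases "i = 1")
    case True
    then show ?thesis by (simp add: \<xi>_def D_sum D_mult)
  next
    case False
    then have "i - 1 \<ge> 1" using assms by simp
    then show ?thesis using False assms
      by (simp add: \<xi>_def D_sum D_mult D_add D_q_power)
  qed
  also have "\<dots> = (\<Sum>k = 1..m. if k = nat \<bar>v\<bar> then Var (- v) ^ (q ^ (i - 1)) else 0)"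
    using assms by (intro sum.cong refl) (auto simp: xv_def yv_def D_Var)
  also have "\<dots> = Var (- v) ^ (q ^ (i - 1))" using assms by auto
  finally show ?thesis .
qed

text \<open>Non-vanishing of the Moore determinant: a linearized polynomial of degree less than
  \<open>q ^ (2 * m)\<close> cannot vanish on the span of the variables.\<close>

lemma moore:
  fixes w :: "nat \<Rightarrow> (int, 'k) mpoly"
  assumes w: "\<And>v. v \<in> V m \<Longrightarrow> (\<Sum>i = 1..2 * m. w i * Var v ^ (q ^ (i - 1))) = 0"
    and i: "i \<in> {1..2 * m}"
  shows "w i = 0"
proof -
  define L where "L = (\<Sum>i = 1..2 * m. Polynomial.monom (w i) (q ^ (i - 1)))"
  define lin where "lin c = (\<Sum>v\<in>V m. Const (c v) * Var v :: (int, 'k) mpoly)" for c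
  have "L = 0"
  proof (rule ccontr)
    assume L: "L \<noteq> 0"
    have "poly L (lin c) = 0" for c
    proof -
      have "lin c ^ (q ^ j) = (\<Sum>v\<in>V m. Const (c v) * Var v ^ (q ^ j))" for j
        unfolding lin_def by (subst frob_q_sum) (simp add: power_mult_distrib Const_power_q)
      then have "poly L (lin c) = (\<Sum>i = 1..2 * m. \<Sum>v\<in>V m. Const (c v) * (w i * Var v ^ (q ^ (i - 1))))"
        by (simp add: L_def poly_sum poly_monom sum_distrib_left mult_ac)
      also have "\<dots> = (\<Sum>v\<in>V m. Const (c v) * (\<Sum>i = 1..2 * m. w i * Var v ^ (q ^ (i - 1))))"
        by (subst sum.swap) (simp only: sum_distrib_left)
      also have "\<dots> = 0" by (intro sum.neutral ballI) (simp only: w mult_zero_right)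
      finally show ?thesis .
    qed
    then have sub: "lin ` (PiE (V m) (\<lambda>_. UNIV)) \<subseteq> {x. poly L x = 0}" by auto
    have lookup_lin: "lookup (lin c) (single v 1) = c v" if "v \<in> V m" for c v
    proof -
      have "lookup (lin c) (single v 1) = (\<Sum>w\<in>V m. if w = v then c w else 0)"
        unfolding lin_def lookup_sum lookup_Const_mult
        by (intro sum.cong refl) (auto simp: Var_def lookup_single when_def dest: single_inj)
      then show ?thesis using that by simp
    qed
    have "inj_on lin (PiE (V m) (\<lambda>_. UNIV))"
    proof (rule inj_onI)
      fix c d assume cd: "c \<in> PiE (V m) (\<lambda>_. UNIV)" "d \<in> PiE (V m) (\<lambda>_. UNIV)" "lin c = lin d"
      show "c = d"
        by (rule PiE_ext[OF cd(1,2)]) (metis lookup_lin cd(3))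
    qed
    then have "q ^ (2 * m) = card (lin ` (PiE (V m) (\<lambda>_. UNIV)))"
      by (simp add: card_image card_PiE card_V[of m])
    also have "\<dots> \<le> card {x. poly L x = 0}" by (rule card_mono[OF poly_roots_finite[OF L] sub])
    also have "\<dots> \<le> Polynomial.degree L" by (rule card_poly_roots_bound[OF L])
    also have "\<dots> \<le> q ^ (2 * m - 1)" unfolding L_def
      using q_gt_1 by (intro degree_sum_le) (auto intro!: order_trans[OF degree_monom_le] power_increasing)
    also have "\<dots> < q ^ (2 * m)" using q_gt_1 i by (intro power_strict_increasing) auto
    finally show False by simp
  qed
  \<comment> \<open>Distinct \<open>i\<close> give distinct exponents, so each \<open>w i\<close> is
    a coefficient of \<open>L\<close>.\<close>
  moreover have "coeff L (q ^ (i - 1)) = (\<Sum>j = 1..2 * m. if j = i then w j else 0)"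
    unfolding L_def coeff_sum coeff_monom
    by (intro sum.cong refl if_cong) (use i q_gt_1 in \<open>auto simp: power_inject_exp\<close>)
  ultimately show ?thesis using i by simp
qed

text \<open>Induction on the total degree in the \<xi>. Differentiating a relation by all variables
  gives a linear system with the Moore matrix, so the formal partial derivatives of the relation
  with respect to the \<xi>_j vanish; these are relations of smaller degree. The condition on
  \<open>D\<close> makes the coefficients behave as constants; it is applied below to p-th
  powers.\<close>

lemma \<xi>_independent_p:
  fixes C :: "(nat \<Rightarrow>\<^sub>0 nat) \<Rightarrow> (int, 'k) mpoly"
  assumes "finite K" "\<And>r. r \<in> K \<Longrightarrow> keys r \<subseteq> {1..2 * m} \<and> (\<forall>i. lookup r i < p)"
    and "\<And>r. r \<in> K \<Longrightarrow> mon_weight (\<lambda>_. 1) r \<le> d"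
    and "\<And>r v. r \<in> K \<Longrightarrow> D v (C r) = 0"
    and "(\<Sum>r\<in>K. C r * mon_val (\<xi> m) r) = 0"
  shows "\<forall>r\<in>K. C r = 0"
  using assms
proof (induction d arbitrary: K C)
  case 0
  have r0: "r = 0" if "r \<in> K" for r
  proof (rule poly_mapping_eqI)
    fix i show "lookup r i = lookup 0 i"
      using "0.prems"(3)[OF that] by (cases "i \<in> keys r") (auto simp: mon_weight_def in_keys_iff)
  qed
  then have "K = {} \<or> K = {0}" by auto
  then show ?case using "0.prems"(5) by auto
next
  case (Suc d)
  let ?I = "{1..2 * m}"
  have pos: "C r = 0" if r: "r \<in> K" and i: "lookup r i > 0" for r i
  proof -
    have "i \<in> keys r" using i by (simp add: in_keys_iff)
    then have i_mem: "i \<in> ?I" using Suc.prems(2)[OF r] by blast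
    \<comment> \<open>The formal derivative of the relation with respect to \<xi>_j.\<close>
    define w where "w j = (\<Sum>r\<in>K. C r * of_nat (lookup r j) * mon_val (\<xi> m) (r - single j 1))" for j
    have "(\<Sum>j\<in>?I. w j * Var v ^ (q ^ (j - 1))) = 0" if v: "v \<in> V m" for v
    proof -
      \<comment> \<open>Differentiating by the dual variable \<open>- v\<close> yields powers of
        \<open>Var v\<close>, the form that \<open>moore\<close> expects.\<close>
      have v': "- v \<in> V m" using v by auto
      have "(\<Sum>j\<in>?I. w j * Var v ^ (q ^ (j - 1))) =
          (\<Sum>j\<in>?I. \<Sum>r\<in>K. C r * (of_nat (lookup r j) * mon_val (\<xi> m) (r - single j 1) * D (- v) (\<xi> m j)))"
        unfolding w_def sum_distrib_right
        by (intro sum.cong refl) (simp add: D_\<xi>[OF v'] mult_ac)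
      also have "\<dots> = (\<Sum>r\<in>K. C r * D (- v) (mon_val (\<xi> m) r))"
        unfolding sum.swap[of _ K] sum_distrib_left[symmetric]
        using Suc.prems(2) by (intro sum.cong refl arg_cong2[of _ _ _ _ "(*)"] D_mon_val[symmetric]) auto
      also have "\<dots> = D (- v) (\<Sum>r\<in>K. C r * mon_val (\<xi> m) r)"
        unfolding D_sum using Suc.prems(4) by (intro sum.cong refl) (simp add: D_mult)
      finally show ?thesis by (simp add: Suc.prems(5))
    qed
    from moore[OF this i_mem] have wi: "w i = 0" by simp
    \<comment> \<open>Lowering the exponent of \<xi>_i by one can be undone only where it is
      positive, hence the restriction to \<open>K'\<close>.\<close>
    define K' where "K' = {r \<in> K. lookup r i > 0}"
    define C' where "C' s = C (s + single i 1) * of_nat (lookup s i + 1)" for s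
    have unshift: "s - single i 1 + single i 1 = s" if "lookup s i > 0" for s :: "nat \<Rightarrow>\<^sub>0 nat"
      using that by (intro poly_mapping_eqI) (auto simp: lookup_add lookup_minus lookup_single when_def)
    note unshift' = unshift[unfolded One_nat_def]
    have inj: "inj_on (\<lambda>r. r - single i 1) K'"
      by (rule inj_onI) (metis (mono_tags, lifting) K'_def unshift mem_Collect_eq)
    have "\<forall>s\<in>(\<lambda>r. r - single i 1) ` K'. C' s = 0"
    proof (rule Suc.IH)
      show "finite ((\<lambda>r. r - single i 1) ` K')" using Suc.prems(1) by (simp add: K'_def)
      show "keys s \<subseteq> ?I \<and> (\<forall>i. lookup s i < p)" if "s \<in> (\<lambda>r. r - single i 1) ` K'" for s
      proof -
        from that obtain r where r: "r \<in> K" "s = r - single i 1" by (auto simp: K'_def)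
        have "lookup s j \<le> lookup r j" for j by (simp add: r(2) lookup_minus)
        then show ?thesis using Suc.prems(2)[OF r(1)]
          by (metis (no_types, lifting) in_keys_iff le_zero_eq order_le_less_trans subset_iff)
      qed
      show "mon_weight (\<lambda>_. 1) s \<le> d" if "s \<in> (\<lambda>r. r - single i 1) ` K'" for s
      proof -
        from that obtain r where r: "r \<in> K" "lookup r i > 0" "s = r - single i 1" by (auto simp: K'_def)
        have "mon_weight (\<lambda>_. 1) r = mon_weight (\<lambda>_. 1) s + 1"
          using mon_weight_add[of "\<lambda>_. 1" s "single i 1"] unshift[OF r(2)] by (simp add: r(3))
        then show ?thesis using Suc.prems(3)[OF r(1)] by simp
      qed
      show "D v (C' s) = 0" if "s \<in> (\<lambda>r. r - single i 1) ` K'" for s v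
      proof -
        from that obtain r where r: "r \<in> K" "lookup r i > 0" "s = r - single i 1" by (auto simp: K'_def)
        have "of_nat n = (Const (of_nat n) :: (int, 'k) mpoly)" for n by (simp only: Const.hom_of_nat)
        then have "D v (of_nat n :: (int, 'k) mpoly) = 0" for n by (metis D_Const)
        moreover have "C' s = C r * of_nat (lookup s i + 1)" by (simp only: C'_def r(3) unshift[OF r(2)])
        ultimately show ?thesis using Suc.prems(4)[OF r(1)] by (simp add: D_mult del: of_nat_add of_nat_Suc)
      qed
      have "(\<Sum>s\<in>(\<lambda>r. r - single i 1) ` K'. C' s * mon_val (\<xi> m) s) =
          (\<Sum>r\<in>K'. C r * of_nat (lookup r i) * mon_val (\<xi> m) (r - single i 1))"
        unfolding sum.reindex[OF inj] o_def
      proof (intro sum.cong refl arg_cong2[of _ _ _ _ "(*)"])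
        fix r assume "r \<in> K'"
        then have "lookup r i > 0" by (simp add: K'_def)
        then show "C' (r - single i 1) = C r * of_nat (lookup r i)"
          by (simp add: C'_def unshift' lookup_minus del: of_nat_add of_nat_Suc)
      qed
      also have "\<dots> = w i"
        unfolding w_def using Suc.prems(1) by (intro sum.mono_neutral_left) (auto simp: K'_def)
      finally show "(\<Sum>s\<in>(\<lambda>r. r - single i 1) ` K'. C' s * mon_val (\<xi> m) s) = 0" by (simp add: wi)
    qed
    then have "C' (r - single i 1) = 0" using r i by (auto simp: K'_def)
    then have "C r * of_nat (lookup r i) = 0" using i by (simp add: C'_def unshift' lookup_minus del: of_nat_add of_nat_Suc)
    \<comment> \<open>The exponent lies strictly between 0 and \<open>p\<close>, so it is nonzero in
      characteristic \<open>p\<close>.\<close>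
    moreover have "of_nat (lookup r i) \<noteq> (0 :: (int, 'k) mpoly)"
      unfolding of_nat_eq_0_iff_char_dvd char_eq[OF of_nat_p_mpoly[where ?'v = int]]
      using i Suc.prems(2)[OF r] nat_dvd_not_less by blast
    ultimately show ?thesis by simp
  qed
  have pos': "C r = 0" if "r \<in> K" "r \<noteq> 0" for r
  proof -
    from that(2) obtain i where "lookup r i \<noteq> 0" by (metis keys_eq_empty in_keys_iff ex_in_conv)
    then show ?thesis using pos[OF that(1), of i] by simp
  qed
  have "C 0 = 0" if "0 \<in> K"
  proof -
    have "(\<Sum>r\<in>K. C r * mon_val (\<xi> m) r) = (\<Sum>r\<in>{0}. C r * mon_val (\<xi> m) r)"
      using that pos' Suc.prems(1) by (intro sum.mono_neutral_right) auto
    then show ?thesis using Suc.prems(5) by simp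
  qed
  then show ?case using pos' by metis
qed

text \<open>Induction on \<open>n\<close> through base p digits. Writing an exponent as p times
  \<open>dv\<close> plus \<open>md\<close>, the terms with equal \<open>md\<close> combine into a
  p-th power. The previous lemma applies to the remainders and leaves, for each of them, a relation
  with exponents below \<open>p ^ n\<close>.\<close>

lemma \<xi>_independent_power:
  fixes g :: "(nat \<Rightarrow>\<^sub>0 nat) \<Rightarrow> (int, 'k) mpoly"
  assumes "finite K" "\<And>a. a \<in> K \<Longrightarrow> keys a \<subseteq> {1..2 * m} \<and> (\<forall>i. lookup a i < p ^ n)"
    and "(\<Sum>a\<in>K. g a ^ (p ^ n) * mon_val (\<xi> m) a) = 0"
  shows "\<forall>a\<in>K. g a = 0"
  using assms
proof (induction n arbitrary: K g)
  case 0
  have r0: "a = 0" if "a \<in> K" for a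
    using "0.prems"(2)[OF that] by (intro poly_mapping_eqI) simp
  then have "K = {} \<or> K = {0}" by auto
  then show ?case using "0.prems"(3) by auto
next
  case (Suc n)
  have p0: "p > 0" using p(1) prime_gt_0_nat by blast
  define dv where "dv a = Poly_Mapping.map (\<lambda>x. x div p) a" for a :: "nat \<Rightarrow>\<^sub>0 nat"
  define md where "md a = Poly_Mapping.map (\<lambda>x. x mod p) a" for a :: "nat \<Rightarrow>\<^sub>0 nat"
  have ldv: "lookup (dv a) i = lookup a i div p" and lmd: "lookup (md a) i = lookup a i mod p" for a i
    by (simp_all add: dv_def md_def map.rep_eq when_def)
  have dec: "mon_pow p (dv a) + md a = a" for a
    by (rule poly_mapping_eqI) (simp add: lookup_add ldv lmd)
  have keys_dv: "keys (dv a) \<subseteq> keys a" and keys_md: "keys (md a) \<subseteq> keys a" for a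
    by (metis div_0 in_keys_iff ldv subsetI, metis mod_0 in_keys_iff lmd subsetI)
  have mon_val_pow: "mon_val \<sigma> (mon_pow p b) = mon_val \<sigma> b ^ p" for \<sigma> :: "nat \<Rightarrow> (int, 'k) mpoly" and b
  proof -
    have "keys (mon_pow p b) = keys b" using p0 by (auto simp: in_keys_iff)
    then show ?thesis by (simp add: mon_val_def prod_power_distrib power_mult[symmetric] mult.commute)
  qed
  \<comment> \<open>The p-th root of the collected coefficient of the monomial with remainder
    \<open>r\<close>.\<close>
  define I where "I r = (\<Sum>a\<in>{a \<in> K. md a = r}. g a ^ (p ^ n) * mon_val (\<xi> m) (dv a))" for r
  have Ip: "I r ^ p = (\<Sum>a\<in>{a \<in> K. md a = r}. g a ^ (p ^ Suc n) * mon_val (\<xi> m) (mon_pow p (dv a)))" for r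
    unfolding I_def frob(2)[of _ _ 1, unfolded power_one_right]
    by (simp add: power_mult_distrib mon_val_pow power_mult[symmetric] mult.commute)
  have "(\<Sum>r\<in>md ` K. I r ^ p * mon_val (\<xi> m) r) = (\<Sum>a\<in>K. g a ^ (p ^ Suc n) * mon_val (\<xi> m) a)"
    unfolding sum.image_gen[OF Suc.prems(1), of _ md] Ip sum_distrib_right
    by (intro sum.cong refl) (metis (mono_tags, lifting) dec mem_Collect_eq mon_val_add mult.assoc)
  then have sum0: "(\<Sum>r\<in>md ` K. I r ^ p * mon_val (\<xi> m) r) = 0" using Suc.prems(3) by simp
  have "\<forall>r\<in>md ` K. I r ^ p = 0"
  proof (rule \<xi>_independent_p[OF _ _ _ _ sum0])
    show "finite (md ` K)" using Suc.prems(1) by simp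
    show "keys r \<subseteq> {1..2 * m} \<and> (\<forall>i. lookup r i < p)" if "r \<in> md ` K" for r
      using that Suc.prems(2) keys_md p0 by (fastforce simp: lmd)
    show "mon_weight (\<lambda>_. 1) r \<le> (\<Sum>r\<in>md ` K. mon_weight (\<lambda>_. 1) r)" if "r \<in> md ` K" for r
      using member_le_sum[OF that, of "mon_weight (\<lambda>_. 1)"] Suc.prems(1) by simp
    show "D v (I r ^ p) = 0" for v r
      by (simp add: D_power of_nat_p_mpoly)
  qed
  then have I0: "I r = 0" if "r \<in> md ` K" for r using that p0 by auto
  show ?case
  proof
    fix a assume a: "a \<in> K"
    define Kr where "Kr = {b \<in> K. md b = md a}"
    have inj: "inj_on dv Kr"
      by (rule inj_onI) (metis (mono_tags, lifting) Kr_def dec mem_Collect_eq)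
    have "\<forall>b\<in>dv ` Kr. g (mon_pow p b + md a) = 0"
    proof (rule Suc.IH)
      show "finite (dv ` Kr)" using Suc.prems(1) by (simp add: Kr_def)
      show "keys b \<subseteq> {1..2 * m} \<and> (\<forall>i. lookup b i < p ^ n)" if "b \<in> dv ` Kr" for b
      proof -
        from that obtain c where c: "c \<in> K" "b = dv c" by (auto simp: Kr_def)
        have "lookup c i div p < p ^ n" for i
          using Suc.prems(2)[OF c(1)] by (intro less_mult_imp_div_less) (simp add: mult.commute)
        then show ?thesis using Suc.prems(2)[OF c(1)] keys_dv[of c] by (simp add: c(2) ldv) blast
      qed
      have "(\<Sum>b\<in>dv ` Kr. g (mon_pow p b + md a) ^ p ^ n * mon_val (\<xi> m) b) = I (md a)"
        unfolding sum.reindex[OF inj] o_def I_def Kr_def[symmetric]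
        by (intro sum.cong refl) (metis (mono_tags, lifting) Kr_def dec mem_Collect_eq)
      then show "(\<Sum>b\<in>dv ` Kr. g (mon_pow p b + md a) ^ p ^ n * mon_val (\<xi> m) b) = 0"
        using I0 a by simp
    qed
    moreover have "dv a \<in> dv ` Kr" using a by (simp add: Kr_def)
    ultimately show "g a = 0" using dec[of a] by metis
  qed
qed

lemma \<xi>_independent:
  fixes g :: "(nat \<Rightarrow>\<^sub>0 nat) \<Rightarrow> (int, 'k) mpoly"
  assumes "finite K" "\<And>a. a \<in> K \<Longrightarrow> keys a \<subseteq> {1..2 * m} \<and> (\<forall>i. lookup a i < q)"
    and "(\<Sum>a\<in>K. g a ^ q * mon_val (\<xi> m) a) = 0" "a \<in> K"
  shows "g a = 0"
  using \<xi>_independent_power[of K m e g] assms by (simp add: card)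

end


section \<open>The group in coordinates\<close>

lemma basis_index_V: "j < 2 * m \<Longrightarrow> basis_index m j \<in> V m"
  by (auto simp: basis_index_def)

lemma basis_pos_less: "v \<in> V m \<Longrightarrow> basis_pos m v < 2 * m"
  by (auto simp: basis_pos_def)

lemma basis_pos_index: "j < 2 * m \<Longrightarrow> basis_pos m (basis_index m j) = j"
  by (auto simp: basis_pos_def basis_index_def)

lemma basis_index_pos: "v \<in> V m \<Longrightarrow> basis_index m (basis_pos m v) = v"
  by (auto simp: basis_pos_def basis_index_def)

lemma basis_pos_mono: "v \<in> V m \<Longrightarrow> w \<in> V m \<Longrightarrow> w < v \<Longrightarrow> basis_pos m w < basis_pos m v"
  by (auto simp: basis_pos_def)

lemma basis_index_mono: "i < j \<Longrightarrow> basis_index m i < basis_index m j"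
  by (auto simp: basis_index_def)

lemma bij_basis_index: "bij_betw (basis_index m) {..<2 * m} (V m)"
  by (rule bij_betwI[where g = "basis_pos m"])
    (simp_all add: basis_index_V basis_pos_less basis_pos_index basis_index_pos del: Diff_iff)

lemma sum_basis_index: "(\<Sum>j<2 * m. f (basis_index m j)) = (\<Sum>v\<in>V m. f v)"
  by (rule sum.reindex_bij_betw[OF bij_basis_index])

definition lin :: "nat \<Rightarrow> (int \<Rightarrow> int \<Rightarrow> 'k::comm_ring_1) \<Rightarrow> int \<Rightarrow> (int, 'k) mpoly"
  where "lin m c v = (\<Sum>w\<in>V m. Const (c v w) * Var w)"

text \<open>\<open>c v w\<close> is the coefficient of \<open>Var w\<close> in the image of \<open>Var v\<close>; the values of \<open>c\<close> outside
  \<open>V m\<close> are irrelevant.\<close>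

definition U :: "nat \<Rightarrow> (int \<Rightarrow> int \<Rightarrow> 'k::{field,finite}) set"
  where "U m = {c. (\<forall>v\<in>V m. c v v = 1 \<and> (\<forall>w\<in>V m. w < v \<longrightarrow> c v w = 0)) \<and>
    poly_subst (lin m c) (\<xi> m 1) = \<xi> m 1}"

text \<open>Replaces matrix positions by variable indices, so that later arguments can work with
  coefficient functions on \<open>V m\<close>.\<close>

lemma act_eq_lin: "act m g = poly_subst (lin m (\<lambda>v w. g $$ (basis_pos m v, basis_pos m w)))"
proof -
  have "(\<Sum>j<2 * m. Const (g $$ (basis_pos m v, j)) * Var (basis_index m j)) =
      lin m (\<lambda>v w. g $$ (basis_pos m v, basis_pos m w)) v" for v
    unfolding lin_def sum_basis_index[symmetric] by (intro sum.cong refl) (simp add: basis_pos_index)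
  then show ?thesis by (simp add: act_def)
qed

lemma P_imp_U: "g \<in> P m \<Longrightarrow> (\<lambda>v w. g $$ (basis_pos m v, basis_pos m w)) \<in> U m"
proof -
  assume g: "g \<in> P m"
  then have c: "g \<in> carrier_mat (2 * m) (2 * m)" "upper_triangular g" "\<forall>i<2 * m. g $$ (i, i) = 1"
    "act m g (\<xi> m 1) = \<xi> m 1"
    by (auto simp: P_def G_def GL_def)
  have "g $$ (basis_pos m v, basis_pos m w) = 0" if "v \<in> V m" "w \<in> V m" "w < v" for v w
    using c(1,2) basis_pos_less[OF that(1)] basis_pos_mono[OF that] by (auto simp: upper_triangular_def)
  then show ?thesis using c(3,4) basis_pos_less by (simp add: U_def act_eq_lin del: Diff_iff)
qed

definition mat_of :: "nat \<Rightarrow> (int \<Rightarrow> int \<Rightarrow> 'k) \<Rightarrow> 'k mat"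
  where "mat_of m c = mat (2 * m) (2 * m) (\<lambda>(i, j). c (basis_index m i) (basis_index m j))"

lemma act_mat_of:
  assumes "f \<in> S m"
  shows "act m (mat_of m c) f = poly_subst (lin m c) f"
  unfolding act_eq_lin
proof (rule subst_cong[OF assms[unfolded S_def]])
  fix v assume v: "v \<in> V m"
  show "lin m (\<lambda>v w. mat_of m c $$ (basis_pos m v, basis_pos m w)) v = lin m c v"
    unfolding lin_def
    by (intro sum.cong refl) (simp add: mat_of_def basis_pos_less[OF v] basis_index_pos[OF v] basis_pos_less basis_index_pos del: Diff_iff)
qed

lemma S_Var: "v \<in> V m \<Longrightarrow> Var v \<in> S m"
  unfolding S_def by (rule poly_ring_Var)

lemma \<xi>_S: "\<xi> m i \<in> S m"
  unfolding \<xi>_def S_def xv_def yv_def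
  by (auto intro!: poly_ring_sum poly_ring_add poly_ring_mult poly_ring_power)

lemma U_imp_P: "c \<in> U m \<Longrightarrow> mat_of m c \<in> P m"
proof -
  assume c: "c \<in> U m"
  let ?A = "mat_of m c"
  have car: "?A \<in> carrier_mat (2 * m) (2 * m)" by (simp add: mat_of_def)
  have ut: "upper_triangular ?A"
    using c unfolding upper_triangular_def U_def
    by (auto simp: mat_of_def basis_index_V basis_index_mono simp del: Diff_iff)
  have diag: "?A $$ (i, i) = 1" if "i < 2 * m" for i
    using c basis_index_V[OF that] that by (simp add: U_def mat_of_def del: Diff_iff)
  \<comment> \<open>The unit diagonal gives determinant 1, from which invertibility follows.\<close>
  have "det ?A = 1"
    using car diag by (simp add: det_upper_triangular[OF ut car] diag_mat_def prod.distinct_set_conv_list[symmetric])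
  then have "?A \<in> Units (ring_mat TYPE('a) (2 * m) ())"
    by (intro det_non_zero_imp_unit[OF car]) simp
  then obtain B where B: "B \<in> carrier_mat (2 * m) (2 * m)" "B * ?A = 1\<^sub>m (2 * m)" "?A * B = 1\<^sub>m (2 * m)"
    by (auto simp: Units_def ring_mat_def)
  then have "invertible_mat ?A"
    unfolding invertible_mat_def inverts_mat_def using car by auto
  moreover have "act m ?A (\<xi> m 1) = \<xi> m 1"
    using c by (simp add: act_mat_of \<xi>_S U_def)
  ultimately show ?thesis using car ut diag by (simp add: P_def G_def GL_def)
qed

text \<open>From here on \<open>U m\<close> takes the place of the matrix group.\<close>

lemma invariants_iff: "f \<in> invariants m \<longleftrightarrow> f \<in> S m \<and> (\<forall>c\<in>U m. poly_subst (lin m c) f = f)"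
proof (intro iffI conjI ballI)
  assume f: "f \<in> invariants m"
  then show S: "f \<in> S m" by (simp add: invariants_def)
  fix c :: "int \<Rightarrow> int \<Rightarrow> 'a" assume "c \<in> U m"
  then show "poly_subst (lin m c) f = f"
    using f U_imp_P[of c m] act_mat_of[OF S, of c] by (simp add: invariants_def)
next
  assume f: "f \<in> S m \<and> (\<forall>c\<in>U m. poly_subst (lin m c) f = f)"
  have "act m g f = f" if "g \<in> P m" for g
    unfolding act_eq_lin using f P_imp_U[OF that] by blast
  then show "f \<in> invariants m" using f by (simp add: invariants_def)
qed

section \<open>Orbits and their products\<close>

definition orb :: "nat \<Rightarrow> int \<Rightarrow> (int, 'k::{field,finite}) mpoly set"
  where "orb m v = (\<lambda>c. lin m c v) ` U m"

lemma orbit_prod_eq: "v \<in> V m \<Longrightarrow> orbit_prod m (Var v) = \<Prod>(orb m v :: (int, 'k::{field,finite}) mpoly set)"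
proof -
  assume v: "v \<in> V m"
  have "(\<lambda>g. act m g (Var v)) ` P m = (orb m v :: (int, 'k) mpoly set)"
  proof (intro equalityI subsetI)
    fix x :: "(int, 'k) mpoly" assume "x \<in> (\<lambda>g. act m g (Var v)) ` P m"
    then show "x \<in> orb m v" using P_imp_U by (auto simp: orb_def act_eq_lin)
  next
    fix x :: "(int, 'k) mpoly" assume "x \<in> orb m v"
    then obtain c where "c \<in> U m" "x = lin m c v" by (auto simp: orb_def)
    then show "x \<in> (\<lambda>g. act m g (Var v)) ` P m"
      using U_imp_P act_mat_of[OF S_Var[OF v], of c] by (intro image_eqI[of _ _ "mat_of m c"]) simp_all
  qed
  then show ?thesis by (simp add: orbit_prod_def)
qed

lemma lin_ring: "lin m c v \<in> poly_ring (V m)"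
  unfolding lin_def by (intro poly_ring_sum poly_ring_mult poly_ring_Const poly_ring_Var)

lemma lin_ring': "lin m c v \<in> S m"
  using lin_ring by (simp add: S_def)

lemma homogeneous_lin: "homogeneous (\<lambda>_. 1) 1 (lin m c v)"
  unfolding lin_def
proof (rule homogeneous_sum)
  fix w show "homogeneous (\<lambda>_. 1) 1 (Const (c v w) * Var w)"
    using homogeneous_mult[OF homogeneous_Const[of "\<lambda>_. 1" "c v w"] homogeneous_Var[of "\<lambda>_. 1" w]] by simp
qed

lemma lookup_lin: "w \<in> V m \<Longrightarrow> lookup (lin m c v) (single w 1) = c v w"
proof -
  assume w: "w \<in> V m"
  have "lookup (lin m c v) (single w 1) = (\<Sum>u\<in>V m. if u = w then c v u else 0)"
    unfolding lin_def lookup_sum lookup_Const_mult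
    by (intro sum.cong refl) (auto simp: Var_def lookup_single when_def dest: single_inj)
  then show ?thesis using w by simp
qed

lemma single_le_single: "w \<ge> v \<Longrightarrow> single w (Suc 0) \<le> single (v :: int) (Suc 0)"
proof (cases "w = v")
  case False
  assume "w \<ge> v"
  then have "single w (Suc 0) < single v (Suc 0)"
    using False unfolding less_poly_mapping.rep_eq less_fun_def
    by (intro exI[of _ v]) (auto simp: lookup_single when_def)
  then show ?thesis by simp
qed simp

text \<open>A larger index means a smaller variable, so a unitriangular row is led by its diagonal
  entry.\<close>

lemma LM_lin:
  assumes "v \<in> V m" "c v v = 1" "\<And>w. w \<in> V m \<Longrightarrow> w < v \<Longrightarrow> c v w = 0"
  shows "LM (lin m c v) (single v 1)"
  unfolding LM_def
proof (intro conjI ballI)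
  show "lookup (lin m c v) (single v 1) = 1" using assms by (simp add: lookup_lin del: Diff_iff One_nat_def)
  fix s assume s: "s \<in> keys (lin m c v)"
  obtain w where w: "w \<in> V m" "s \<in> keys (Const (c v w) * Var w)"
    using subsetD[OF keys_sum s[unfolded lin_def]] by blast
  have "lookup (Const (c v w) * Var w) s \<noteq> 0" using w(2) by (simp only: in_keys_iff not_False_eq_True)
  then have "c v w \<noteq> 0" "s = single w 1"
    unfolding lookup_Const_mult by (auto simp: Var_def lookup_single when_def split: if_splits)
  moreover from this w(1) assms(3) have "w \<ge> v" by (meson not_less)
  ultimately show "s \<le> single v 1" by (simp add: single_le_single)
qed

lemma LM_lin_U: "c \<in> U m \<Longrightarrow> v \<in> V m \<Longrightarrow> LM (lin m c v) (single v 1)"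
  by (rule LM_lin) (auto simp: U_def)

text \<open>Among distinct leading monomials the largest cannot cancel. This yields both the lead
  term of a combination and its non-vanishing.\<close>

lemma lead_term_sum:
  fixes g :: "'i \<Rightarrow> ('v::linorder, 'k::idom) mpoly"
  assumes K: "finite K" "K \<noteq> {}" and LM: "\<And>t. t \<in> K \<Longrightarrow> LM (g t) (\<nu> t)" and inj: "inj_on \<nu> K"
    and c: "\<And>t. t \<in> K \<Longrightarrow> c t \<noteq> 0"
  obtains t where "t \<in> K" "lead_term (\<Sum>t\<in>K. Const (c t) * g t) = single (\<nu> t) (c t)"
    "(\<Sum>t\<in>K. Const (c t) * g t) \<noteq> 0"
proof -
  let ?f = "\<Sum>t\<in>K. Const (c t) * g t"
  have "Max (\<nu> ` K) \<in> \<nu> ` K" using K by (intro Max_in) auto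
  then obtain t where t: "t \<in> K" "\<nu> t = Max (\<nu> ` K)" by force
  have le: "\<nu> s \<le> \<nu> t" if "s \<in> K" for s using K that by (simp add: t(2))
  have "lookup ?f (\<nu> t) = (\<Sum>s\<in>K. if s = t then c s else 0)"
    unfolding lookup_sum lookup_Const_mult
  proof (intro sum.cong refl)
    fix s assume s: "s \<in> K"
    show "c s * lookup (g s) (\<nu> t) = (if s = t then c s else 0)"
    proof (cases "s = t")
      case True
      then show ?thesis using LM[OF s] by (simp add: LM_def)
    next
      case False
      then have "\<nu> s < \<nu> t" using le[OF s] inj s t(1) by (auto simp: inj_on_def order_less_le)
      then have "\<nu> t \<notin> keys (g s)" using LM[OF s] by (auto simp: LM_def)
      then show ?thesis using False by (simp add: in_keys_iff)
    qed
  qed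
  then have l: "lookup ?f (\<nu> t) = c t" using t K by simp
  have "s \<le> \<nu> t" if s: "s \<in> keys ?f" for s
  proof -
    obtain u where u: "u \<in> K" "s \<in> keys (Const (c u) * g u)"
      using subsetD[OF keys_sum s] by blast
    then have "s \<in> keys (g u)" by (auto simp: in_keys_iff lookup_Const_mult)
    then have "s \<le> \<nu> u" using LM[OF u(1)] by (simp add: LM_def)
    then show ?thesis using le[OF u(1)] by simp
  qed
  moreover have "\<nu> t \<in> keys ?f" using l c[OF t(1)] by (simp only: in_keys_iff not_False_eq_True)
  ultimately have "Max (keys ?f) = \<nu> t" by (intro Max_eqI) auto
  then have "lead_term ?f = single (\<nu> t) (c t)" by (simp add: lead_term_def Let_def l)
  moreover have "?f \<noteq> 0" using l c[OF t(1)] by auto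
  ultimately show ?thesis using that t(1) by blast
qed

text \<open>Every monomial is the leading monomial of its own image, so the images of distinct
  monomials are linearly independent.\<close>

lemma subst_unipotent_inj:
  fixes f :: "(int, 'k::field) mpoly"
  assumes "\<And>v. v \<in> V m \<Longrightarrow> LM (\<sigma> v) (single v 1)" "f \<in> S m" "poly_subst \<sigma> f = 0"
  shows "f = 0"
proof (rule ccontr)
  assume "f \<noteq> 0"
  have "LM (mon_val \<sigma> t) t" if "t \<in> keys f" for t
  proof -
    have "v \<in> V m" if "v \<in> keys t" for v
      using assms(2) \<open>t \<in> keys f\<close> that unfolding S_def poly_ring_def by blast
    then have "LM (mon_val \<sigma> t) (\<Sum>v\<in>keys t. mon_pow (lookup t v) (single v 1))"
      unfolding mon_val_def by (intro LM_prod LM_power assms(1))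
    also have "(\<Sum>v\<in>keys t. mon_pow (lookup t v) (single v 1)) = t"
      by (rule poly_mapping_eqI) (auto simp: lookup_sum lookup_single when_def in_keys_iff if_distrib cong: if_cong)
    finally show ?thesis .
  qed
  then obtain t where "(\<Sum>t\<in>keys f. Const (lookup f t) * mon_val \<sigma> t) \<noteq> 0"
    using \<open>f \<noteq> 0\<close> by (elim lead_term_sum[of "keys f" "mon_val \<sigma>" "\<lambda>t. t" "lookup f", rotated 2]) (auto simp: in_keys_iff)
  then show False using assms(3) by (simp add: subst_eq_sum)
qed

text \<open>The matrix product in the order that fits a right action: \<open>c\<close> is applied
  before \<open>d\<close>.\<close>

definition comp :: "nat \<Rightarrow> (int \<Rightarrow> int \<Rightarrow> 'k::comm_ring_1) \<Rightarrow> (int \<Rightarrow> int \<Rightarrow> 'k) \<Rightarrow> int \<Rightarrow> int \<Rightarrow> 'k"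
  where "comp m c d v w = (\<Sum>u\<in>V m. c v u * d u w)"

lemma lin_comp: "lin m (comp m c d) v = poly_subst (lin m d) (lin m c v)"
proof -
  have "poly_subst (lin m d) (lin m c v) = (\<Sum>u\<in>V m. \<Sum>w\<in>V m. Const (c v u * d u w) * Var w)"
    by (simp add: lin_def subst.hom_sum subst.hom_mult Const.hom_mult sum_distrib_left mult.assoc)
  also have "\<dots> = (\<Sum>w\<in>V m. \<Sum>u\<in>V m. Const (c v u * d u w) * Var w)"
    by (rule sum.swap)
  also have "\<dots> = lin m (comp m c d) v"
    by (simp only: lin_def comp_def Const.hom_sum sum_distrib_right)
  finally show ?thesis ..
qed

lemma comp_U: "c \<in> U m \<Longrightarrow> d \<in> U m \<Longrightarrow> comp m c d \<in> U m"
proof -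
  assume c: "c \<in> U m" and d: "d \<in> U m"
  have ut: "c v u * d u w = 0" if "v \<in> V m" "u \<in> V m" "w \<in> V m" "w \<le> v" "u \<noteq> v" for u v w
    using c d that unfolding U_def by (cases "u < v") auto
  have "comp m c d v w = c v v * d v w" if "v \<in> V m" "w \<in> V m" "w \<le> v" for v w
  proof -
    have "comp m c d v w = (\<Sum>u\<in>{v}. c v u * d u w)"
      unfolding comp_def using that ut by (intro sum.mono_neutral_right) auto
    then show ?thesis by simp
  qed
  then have "\<forall>v\<in>V m. comp m c d v v = 1 \<and> (\<forall>w\<in>V m. w < v \<longrightarrow> comp m c d v w = 0)"
    using c d by (auto simp: U_def)
  moreover have "poly_subst (lin m (comp m c d)) (\<xi> m 1) = \<xi> m 1"
    using c d unfolding lin_comp subst_subst[symmetric] by (simp add: U_def)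
  ultimately show ?thesis unfolding U_def by blast
qed

text \<open>\<open>U m\<close> is infinite, since the values of its members outside
  \<open>V m\<close> are arbitrary; only the restriction of a row to \<open>V m\<close> enters the
  linear form.\<close>

lemma finite_orb: "finite (orb m v)"
proof -
  have "lin m c v = (\<Sum>w\<in>V m. Const (restrict (c v) (V m) w) * Var w)" for c :: "int \<Rightarrow> int \<Rightarrow> 'k::{field,finite}"
    by (simp add: lin_def)
  then have "orb m v \<subseteq> (\<lambda>l. \<Sum>w\<in>V m. Const (l w) * Var w) ` (PiE (V m) (\<lambda>_. UNIV))"
    unfolding orb_def by (intro image_subsetI image_eqI[of _ _ "restrict (c v) (V m)" for c]) auto
  then show ?thesis by (rule finite_subset) (intro finite_imageI finite_PiE, auto)
qed

text \<open>An injective map of a finite set into itself is onto, so finiteness takes the place of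
  inverses.\<close>

lemma orb_permuted: "c \<in> U m \<Longrightarrow> poly_subst (lin m c) ` orb m v = orb m v"
proof (rule endo_inj_surj[OF finite_orb])
  assume c: "c \<in> U m"
  show "poly_subst (lin m c) ` orb m v \<subseteq> orb m v"
    using comp_U[OF _ c] by (auto simp: orb_def lin_comp[symmetric])
  show "inj_on (poly_subst (lin m c)) (orb m v)"
  proof (rule inj_onI)
    fix f g assume fg: "f \<in> orb m v" "g \<in> orb m v" "poly_subst (lin m c) f = poly_subst (lin m c) g"
    then have S: "f - g \<in> S m" using lin_ring by (auto simp: orb_def S_def intro!: poly_ring_diff)
    have 0: "poly_subst (lin m c) (f - g) = 0" using fg by (simp add: subst.hom_minus)
    have "f - g = 0" by (rule subst_unipotent_inj[OF _ S 0]) (rule LM_lin_U[OF c])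
    then show "f = g" by simp
  qed
qed

lemma orbit_prod_invariant:
  assumes "v \<in> V m"
  shows "orbit_prod m (Var v) \<in> invariants m"
  unfolding invariants_iff orbit_prod_eq[OF assms]
proof (intro conjI ballI)
  show "\<Prod>(orb m v) \<in> S m"
    unfolding S_def using lin_ring by (auto intro!: poly_ring_prod simp: orb_def)
  fix c :: "int \<Rightarrow> int \<Rightarrow> 'a" assume c: "c \<in> U m"
  have inj: "inj_on (poly_subst (lin m c)) (orb m v)"
    by (rule eq_card_imp_inj_on[OF finite_orb]) (simp only: orb_permuted[OF c])
  have "poly_subst (lin m c) (\<Prod>(orb m v)) = (\<Prod>f\<in>orb m v. poly_subst (lin m c) f)"
    by (simp add: subst.hom_prod)
  also have "\<dots> = \<Prod>(poly_subst (lin m c) ` orb m v)"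
    using inj by (simp add: prod.reindex)
  finally show "poly_subst (lin m c) (\<Prod>(orb m v)) = \<Prod>(orb m v)"
    by (simp add: orb_permuted[OF c])
qed

lemma invariants_add: "f \<in> invariants m \<Longrightarrow> g \<in> invariants m \<Longrightarrow> f + g \<in> invariants m"
  by (simp add: invariants_iff S_def poly_ring_add subst.hom_add)

lemma invariants_mult: "f \<in> invariants m \<Longrightarrow> g \<in> invariants m \<Longrightarrow> f * g \<in> invariants m"
  by (simp add: invariants_iff S_def poly_ring_mult subst.hom_mult)

lemma invariants_diff: "f \<in> invariants m \<Longrightarrow> g \<in> invariants m \<Longrightarrow> f - g \<in> invariants m"
  by (simp add: invariants_iff S_def poly_ring_diff subst.hom_minus)

lemma invariants_Const: "Const a \<in> invariants m"
  by (simp add: invariants_iff S_def)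

lemma invariants_0: "0 \<in> invariants m" and invariants_1: "1 \<in> invariants m"
  by (simp_all add: invariants_iff S_def)

lemma invariants_power: "f \<in> invariants m \<Longrightarrow> f ^ n \<in> invariants m"
  by (induction n) (simp_all add: invariants_1 invariants_mult)

lemma invariants_prod: "(\<And>i. i \<in> A \<Longrightarrow> f i \<in> invariants m) \<Longrightarrow> prod f A \<in> invariants m"
  by (induction A rule: infinite_finite_induct) (simp_all add: invariants_1 invariants_mult)

lemma invariants_mon_val: "(\<And>v. v \<in> keys t \<Longrightarrow> \<sigma> v \<in> invariants m) \<Longrightarrow> mon_val \<sigma> t \<in> invariants m"
  unfolding mon_val_def by (intro invariants_prod invariants_power) simp


section \<open>Passing from \<open>m\<close> to \<open>m + 1\<close>\<close>

lemma V_Suc: "V (Suc m) = insert (- int (Suc m)) (insert (int (Suc m)) (V m))"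
  by auto

lemma V_Suc_notin: "- int (Suc m) \<notin> V m" "int (Suc m) \<notin> V m" "- int (Suc m) \<noteq> int (Suc m)"
  by auto

lemma V_SucI: "v \<in> V m \<Longrightarrow> v \<in> V (Suc m)" "int (Suc m) \<in> V (Suc m)" "- int (Suc m) \<in> V (Suc m)"
  by auto

lemma sum_V_Suc: "(\<Sum>v\<in>V (Suc m). f v) = f (- int (Suc m)) + (f (int (Suc m)) + (\<Sum>v\<in>V m. f v))"
  for f :: "int \<Rightarrow> 'a::comm_monoid_add"
  unfolding V_Suc using V_Suc_notin by (subst sum.insert) (auto simp del: Diff_iff of_nat_Suc)

lemma sum_V: "(\<Sum>v\<in>V m. f v) = (\<Sum>k = 1..m. f (int k) + f (- int k))"
  for f :: "int \<Rightarrow> 'a::comm_monoid_add"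
proof (induction m)
  case (Suc m)
  then show ?case by (simp only: sum_V_Suc sum.cl_ivl_Suc) (simp add: ac_simps)
qed simp

lemma V_uminus: "v \<in> V m \<Longrightarrow> - v \<in> V m"
  by auto

section \<open>Reduction modulo x and isometries in consecutive ranks\<close>

abbreviation (input) "xM m \<equiv> Var (int (Suc m))"
abbreviation (input) "yM m \<equiv> Var (- int (Suc m))"

definition at0 :: "nat \<Rightarrow> (int, 'k) mpoly \<Rightarrow> (int, 'k::comm_ring_1) mpoly"
  where "at0 m = poly_subst (Var(int (Suc m) := 0))"

interpretation at0: comm_ring_hom "at0 m :: (int, 'k::comm_ring_1) mpoly \<Rightarrow> _"
  unfolding at0_def by (rule subst.comm_ring_hom_axioms)

lemma at0_Const [simp]: "at0 m (Const a) = Const a"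
  by (simp add: at0_def)

lemma at0_Var: "at0 m (Var v) = (if v = int (Suc m) then 0 else Var v)"
  by (simp add: at0_def)

lemma at0_id: "f \<in> S m \<Longrightarrow> at0 m f = f"
  unfolding at0_def S_def by (erule subst_Var_id) auto

lemma lin_Suc: "lin (Suc m) c v = Const (c v (- int (Suc m))) * yM m + (Const (c v (int (Suc m))) * xM m + lin m c v)"
  unfolding lin_def by (rule sum_V_Suc)

lemma lin_Suc_V: "c \<in> U (Suc m) \<Longrightarrow> v \<in> V m \<Longrightarrow> lin (Suc m) c v = lin m c v + Const (c v (int (Suc m))) * xM m"
  unfolding lin_Suc U_def by auto

lemma lin_U_x: "c \<in> U (Suc m) \<Longrightarrow> lin (Suc m) c (int (Suc m)) = xM m"
proof -
  assume c: "c \<in> U (Suc m)"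
  have "c (int (Suc m)) w = (if w = int (Suc m) then 1 else 0)" if "w \<in> V (Suc m)" for w
    using c that V_SucI(2)[of m] unfolding U_def by (cases "w < int (Suc m)") auto
  then have "lin (Suc m) c (int (Suc m)) = (\<Sum>w\<in>V (Suc m). if w = int (Suc m) then Var w else 0)"
    unfolding lin_def by (intro sum.cong refl) auto
  then show ?thesis by simp
qed

lemma lin_U_y: "c \<in> U (Suc m) \<Longrightarrow> lin (Suc m) c (- int (Suc m)) =
    yM m + (lin m c (- int (Suc m)) + Const (c (- int (Suc m)) (int (Suc m))) * xM m)"
  unfolding lin_Suc U_def using V_SucI(3)[of m] by (auto simp: algebra_simps)

context finite_field_char
begin

lemma subst_\<xi>_1: "poly_subst \<sigma> (\<xi> m 1 :: (int, 'k) mpoly) = (\<Sum>k = 1..m. \<sigma> (- int k) * \<sigma> (int k))"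
  by (simp add: \<xi>_def xv_def yv_def subst.hom_sum subst.hom_mult)

lemma \<xi>_1_Suc: "(\<xi> (Suc m) 1 :: (int, 'k) mpoly) = \<xi> m 1 + yM m * xM m"
  by (simp add: \<xi>_def xv_def yv_def)

text \<open>Modulo x the map \<open>c\<close> acts on the variables of rank \<open>m\<close> through
  its restriction, and the extra summand y x of the quadratic form disappears.\<close>

lemma U_Suc_imp_U:
  fixes c :: "int \<Rightarrow> int \<Rightarrow> 'k"
  assumes c: "c \<in> U (Suc m)"
  shows "c \<in> U m"
proof -
  have lin: "at0 m (lin (Suc m) c v) = lin m c v" if "v \<in> V m" for v
    using at0_id[OF lin_ring'] by (simp add: lin_Suc_V[OF c that] at0.hom_add at0.hom_mult at0_Var)
  have "at0 m (poly_subst (lin (Suc m) c) (\<xi> (Suc m) 1)) = at0 m (\<xi> (Suc m) 1)"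
    using c by (simp add: U_def)
  then have "poly_subst (lin m c) (\<xi> m 1) = (\<xi> m 1 :: (int, 'k) mpoly)"
    using lin_U_x[OF c] unfolding subst_\<xi>_1
    by (simp add: at0.hom_sum at0.hom_mult at0.hom_add lin at0_Var \<xi>_1_Suc[unfolded One_nat_def] at0_id[OF \<xi>_S])
  then show ?thesis using c V_SucI(1)[of _ m] unfolding U_def by blast
qed

definition embed :: "nat \<Rightarrow> (int \<Rightarrow> int \<Rightarrow> 'k) \<Rightarrow> int \<Rightarrow> int \<Rightarrow> 'k"
  where "embed m c v w = (if v \<in> V m \<and> w \<in> V m then c v w else if v = w then 1 else 0)"

lemma lin_embed:
  shows "v \<in> V m \<Longrightarrow> lin (Suc m) (embed m c) v = lin m c v"
    and "lin (Suc m) (embed m c) (int (Suc m)) = xM m"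
    and "lin (Suc m) (embed m c) (- int (Suc m)) = yM m"
proof -
  show "lin (Suc m) (embed m c) v = lin m c v" if "v \<in> V m"
  proof -
    have "lin m (embed m c) v = lin m c v"
      unfolding lin_def by (intro sum.cong refl) (use that in \<open>simp add: embed_def\<close>)
    then show ?thesis using that unfolding lin_Suc by (auto simp: embed_def)
  qed
  have "lin m (embed m c) v = 0" if "v \<notin> V m" for v
    unfolding lin_def by (intro sum.neutral ballI) (use that in \<open>auto simp: embed_def\<close>)
  then show "lin (Suc m) (embed m c) (int (Suc m)) = xM m" "lin (Suc m) (embed m c) (- int (Suc m)) = yM m"
    unfolding lin_Suc using V_Suc_notin[of m] by (auto simp: embed_def simp del: Diff_iff of_nat_Suc)
qed

lemma embed_U: "c \<in> U m \<Longrightarrow> embed m c \<in> U (Suc m)"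
proof -
  assume c: "c \<in> U m"
  have "(\<Sum>k = 1..m. lin (Suc m) (embed m c) (- int k) * lin (Suc m) (embed m c) (int k)) =
      (\<Sum>k = 1..m. lin m c (- int k) * lin m c (int k))"
    by (intro sum.cong refl arg_cong2[of _ _ _ _ "(*)"] lin_embed(1)) auto
  also have "\<dots> = \<xi> m 1" unfolding subst_\<xi>_1[symmetric] using c by (simp add: U_def)
  finally have "poly_subst (lin (Suc m) (embed m c)) (\<xi> (Suc m) 1) = \<xi> (Suc m) 1"
    unfolding subst_\<xi>_1 unfolding sum.cl_ivl_Suc lin_embed \<xi>_1_Suc by simp
  moreover have "\<forall>v\<in>V (Suc m). embed m c v v = 1 \<and> (\<forall>w\<in>V (Suc m). w < v \<longrightarrow> embed m c v w = 0)"
    using c unfolding embed_def U_def by (auto simp del: Diff_iff)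
  ultimately show ?thesis unfolding U_def by blast
qed

text \<open>The isometry \<open>v \<mapsto> v + a x\<close>, \<open>y \<mapsto> y - a v'\<close>, where \<open>v' = Var (- v)\<close> is dual to \<open>v\<close>.\<close>

definition elem :: "nat \<Rightarrow> int \<Rightarrow> 'k \<Rightarrow> int \<Rightarrow> int \<Rightarrow> 'k"
  where "elem m v a u w = (if u = w then 1 else if u = v \<and> w = int (Suc m) then a
    else if u = - int (Suc m) \<and> w = - v then - a else 0)"

lemma lin_elem:
  assumes v: "v \<in> V m" and u: "u \<in> V (Suc m)"
  shows "lin (Suc m) (elem m v a) u =
    Var u + ((if u = v then Const a * xM m else 0) - (if u = - int (Suc m) then Const a * Var (- v) else 0))"
proof -
  have *: "elem m v a u w = (if w = u then 1 else 0) + ((if w = int (Suc m) then if u = v then a else 0 else 0)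
     - (if w = - v then if u = - int (Suc m) then a else 0 else 0))" for w
    using v by (auto simp: elem_def)
  have "lin (Suc m) (elem m v a) u = (\<Sum>w\<in>V (Suc m). (if w = u then Var w else 0) +
     ((if w = int (Suc m) then if u = v then Const a * Var w else 0 else 0)
     - (if w = - v then if u = - int (Suc m) then Const a * Var w else 0 else 0)))"
    unfolding lin_def * by (intro sum.cong refl) (simp add: Const.hom_add Const.hom_minus distrib_right left_diff_distrib)
  also have "\<dots> = (if u \<in> V (Suc m) then Var u else 0) +
     ((if int (Suc m) \<in> V (Suc m) then if u = v then Const a * xM m else 0 else 0)
     - (if - v \<in> V (Suc m) then if u = - int (Suc m) then Const a * Var (- v) else 0 else 0))"
    unfolding sum.distrib sum_subtractf by (intro arg_cong2[of _ _ _ _ "(+)"] arg_cong2[of _ _ _ _ "(-)"] sum.delta) auto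
  finally show ?thesis using u v V_SucI(1)[OF V_uminus[OF v]] V_SucI(2)[of m] by (simp del: Diff_iff of_nat_Suc)
qed

text \<open>The term a x v' gained in the summand containing \<open>v\<close> cancels the one lost
  in y x; triangularity holds because y has the least and x the greatest index.\<close>

lemma elem_U:
  assumes v: "v \<in> V m"
  shows "elem m v a \<in> U (Suc m)"
proof -
  let ?M = "int (Suc m)"
  have "lin (Suc m) (elem m v a) (- int k) * lin (Suc m) (elem m v a) (int k) =
      Var (- int k) * Var (int k) + (if k = nat \<bar>v\<bar> then Const a * xM m * Var (- v) else 0)" if "k \<in> {1..m}" for k
  proof -
    have "- int k \<in> V (Suc m)" "int k \<in> V (Suc m)" "- int k \<noteq> - ?M" "int k \<noteq> - ?M" using that by auto
    moreover have "k = nat \<bar>v\<bar> \<longleftrightarrow> v = int k \<or> v = - int k" "int k \<noteq> - int k" using v that by auto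
    ultimately show ?thesis by (simp only: lin_elem[OF v]) (auto simp: algebra_simps)
  qed
  then have "(\<Sum>k = 1..m. lin (Suc m) (elem m v a) (- int k) * lin (Suc m) (elem m v a) (int k)) =
      \<xi> m 1 + Const a * xM m * Var (- v)"
    using v by (subst sum.cong[OF refl]) (auto simp: sum.distrib \<xi>_def xv_def yv_def)
  moreover have "- ?M \<noteq> v" "?M \<noteq> v" "?M \<noteq> - ?M" using v by auto
  ultimately have "poly_subst (lin (Suc m) (elem m v a)) (\<xi> (Suc m) 1) = \<xi> (Suc m) 1"
    unfolding subst_\<xi>_1 unfolding sum.cl_ivl_Suc lin_elem[OF v V_SucI(2)] lin_elem[OF v V_SucI(3)] \<xi>_1_Suc
    by (simp add: algebra_simps)
  moreover have "\<forall>u\<in>V (Suc m). elem m v a u u = 1 \<and> (\<forall>w\<in>V (Suc m). w < u \<longrightarrow> elem m v a u w = 0)"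
    using v unfolding elem_def by auto
  ultimately show ?thesis unfolding U_def by blast
qed

text \<open>An isometry of the quadratic form preserves its polar form; evaluated at the unit
  vectors \<open>un a\<close> and \<open>un b\<close>, this becomes a relation between two columns
  of \<open>c\<close>.\<close>

lemma polar:
  fixes c :: "int \<Rightarrow> int \<Rightarrow> 'k"
  assumes c: "c \<in> U m" and ab: "a \<in> V m" "b \<in> V m"
  shows "(\<Sum>v\<in>V m. c (- v) a * c v b) = (if b = - a then 1 else 0)"
proof -
  define Q where "Q z = (\<Sum>k = 1..m. z (- int k) * z (int k))" for z :: "int \<Rightarrow> 'k"
  define B where "B z w = (\<Sum>v\<in>V m. z (- v) * w v)" for z w :: "int \<Rightarrow> 'k"
  define T where "T z v = (\<Sum>w\<in>V m. c v w * z w)" for z v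
  have Q_add: "Q (\<lambda>v. z v + w v) = Q z + Q w + B z w" for z w
    unfolding Q_def B_def sum_V by (simp add: sum.distrib[symmetric] algebra_simps)
  have QT: "Q (T z) = Q z" for z
  proof -
    interpret e: comm_ring_hom "ev (\<lambda>a. a) z :: (int, 'k) mpoly \<Rightarrow> 'k"
      by (rule comm_ring_hom_ev[OF comm_ring_hom_id])
    have "ev (\<lambda>a. a) z (lin m c v) = T z v" for v
      by (simp add: lin_def e.hom_sum e.hom_mult T_def)
    then have "ev (\<lambda>a. a) z (poly_subst (lin m c) (\<xi> m 1)) = Q (T z)"
      by (simp add: subst_\<xi>_1[unfolded One_nat_def] e.hom_sum e.hom_mult Q_def)
    moreover have "ev (\<lambda>a. a) z (\<xi> m 1) = Q z"
      by (simp add: \<xi>_def xv_def yv_def e.hom_sum e.hom_mult Q_def)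
    ultimately show ?thesis using c by (simp add: U_def)
  qed
  have T_add: "T (\<lambda>v. z v + w v) = (\<lambda>v. T z v + T w v)" for z w
    by (rule ext) (simp add: T_def sum.distrib distrib_left)
  have BT: "B (T z) (T w) = B z w" for z w
    using QT[of "\<lambda>v. z v + w v"] unfolding T_add Q_add QT by simp
  define un where "un a = (\<lambda>w. if w = a then 1 else 0 :: 'k)" for a :: int
  have "T (un a) v = c v a" if "a \<in> V m" for a v
  proof -
    have "T (un a) v = (\<Sum>w\<in>V m. if w = a then c v w else 0)"
      unfolding T_def un_def by (intro sum.cong refl) simp
    then show ?thesis using that by simp
  qed
  then have "(\<Sum>v\<in>V m. c (- v) a * c v b) = B (un a) (un b)"
    using BT[of "un a" "un b"] ab by (simp add: B_def del: Diff_iff)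
  also have "\<dots> = (\<Sum>v\<in>V m. if v = b then if b = - a then 1 else 0 else 0)"
    unfolding B_def un_def by (intro sum.cong refl) auto
  finally show ?thesis using ab by simp
qed

text \<open>\<open>polar\<close> speaks of columns, the claim of a row. The passage uses that a left
  inverse of a square matrix is also a right inverse.\<close>

lemma isotropic:
  fixes c :: "int \<Rightarrow> int \<Rightarrow> 'k"
  assumes c: "c \<in> U m" and v: "v \<in> V m"
  shows "(\<Sum>a\<in>V m. c v a * c v (- a)) = 0"
proof -
  let ?i = "basis_index m" and ?n = "2 * m"
  define A where "A = mat ?n ?n (\<lambda>(i, j). c (?i i) (?i j))"
  \<comment> \<open>The adjoint of \<open>A\<close> for the polar form: transpose and negate both
    indices.\<close>
  define L where "L = mat ?n ?n (\<lambda>(i, j). c (- ?i j) (- ?i i))"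
  have car: "A \<in> carrier_mat ?n ?n" "L \<in> carrier_mat ?n ?n" by (simp_all add: A_def L_def)
  have inj: "?i i = ?i j \<longleftrightarrow> i = j" if "i < ?n" "j < ?n" for i j
    using that basis_pos_index by metis
  have "L * A = 1\<^sub>m ?n"
  proof (rule eq_matI)
    fix i j assume ij: "i < dim_row (1\<^sub>m ?n)" "j < dim_col (1\<^sub>m ?n)"
    then have ij': "i < ?n" "j < ?n" by simp_all
    have "(L * A) $$ (i, j) = (\<Sum>k<?n. c (- ?i k) (- ?i i) * c (?i k) (?i j))"
      using ij' by (simp add: A_def L_def scalar_prod_def atLeast0LessThan)
    also have "\<dots> = (\<Sum>v\<in>V m. c (- v) (- ?i i) * c v (?i j))"
      by (rule sum_basis_index)
    also have "\<dots> = (if ?i j = - (- ?i i) then 1 else 0)"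
      by (rule polar[OF c V_uminus[OF basis_index_V[OF ij'(1)]] basis_index_V[OF ij'(2)]])
    finally show "(L * A) $$ (i, j) = 1\<^sub>m ?n $$ (i, j)" using ij' inj by auto
  qed (use car in auto)
  then have AL: "A * L = 1\<^sub>m ?n" using mat_mult_left_right_inverse[OF car(2,1)] by simp
  let ?a = "basis_pos m v" and ?b = "basis_pos m (- v)"
  have ab: "?a < ?n" "?b < ?n" using basis_pos_less v V_uminus[OF v] by blast+
  have iab: "?i ?a = v" "?i ?b = - v" using basis_index_pos v V_uminus[OF v] by blast+
  have "v \<noteq> - v" using v by auto
  then have "?a \<noteq> ?b" using iab by metis
  have "(A * L) $$ (?a, ?b) = (\<Sum>k<?n. c v (?i k) * c v (- ?i k))"
    using ab iab by (simp add: A_def L_def scalar_prod_def atLeast0LessThan)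
  also have "\<dots> = (\<Sum>a\<in>V m. c v a * c v (- a))"
    by (rule sum_basis_index)
  finally show ?thesis using AL ab \<open>?a \<noteq> ?b\<close> by simp
qed

lemma two_neq_0: "2 \<noteq> (0 :: 'k)"
proof
  assume "2 = (0 :: 'k)"
  then have "p dvd 2" using char_eq[OF of_nat_p] of_nat_eq_0_iff_char_dvd[of 2, where ?'a = 'k] by simp
  then have "p \<le> 2" by (intro dvd_imp_le) simp_all
  with prime_ge_2_nat[OF p(1)] have "p = 2" by simp
  then show False using p(2) by simp
qed

text \<open>The image of \<open>y\<close> is isotropic, so that its other coefficients determine that of \<open>x\<close>.\<close>

lemma y_coefficient:
  fixes c :: "int \<Rightarrow> int \<Rightarrow> 'k"
  assumes "c \<in> U (Suc m)"
  defines "y \<equiv> - int (Suc m)"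
  shows "c y (int (Suc m)) = - (\<Sum>k = 1..m. c y (int k) * c y (- int k))"
proof -
  have "0 = (\<Sum>a\<in>V (Suc m). c y a * c y (- a))"
    using isotropic[OF assms(1) V_SucI(3)] by (simp add: y_def)
  \<comment> \<open>Each pair \<open>k\<close>, \<open>- k\<close> is met twice; cancelling the
    factor 2 is where odd \<open>p\<close> enters.\<close>
  also have "\<dots> = 2 * (\<Sum>k = 1..Suc m. c y (int k) * c y (- int k))"
    unfolding sum_V sum_distrib_left by (intro sum.cong refl) simp
  also have "(\<Sum>k = 1..Suc m. c y (int k) * c y (- int k)) =
      (\<Sum>k = 1..m. c y (int k) * c y (- int k)) + c y (int (Suc m)) * c y y"
    by (simp only: sum.cl_ivl_Suc y_def) simp
  also have "c y y = 1" using assms(1) V_SucI(3)[of m] unfolding U_def y_def by blast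
  finally have "2 * ((\<Sum>k = 1..m. c y (int k) * c y (- int k)) + c y (int (Suc m))) = 0"
    by (simp only: mult_1_right)
  then have "(\<Sum>k = 1..m. c y (int k) * c y (- int k)) + c y (int (Suc m)) = 0"
    using two_neq_0 unfolding mult_eq_0_iff by blast
  then show ?thesis by (simp only: eq_neg_iff_add_eq_0 add.commute)
qed

lemma U_id: "(\<lambda>v w. if v = w then 1 else 0 :: 'k) \<in> U m"
proof -
  have "lin m (\<lambda>v w. if v = w then 1 else 0 :: 'k) v = Var v" if "v \<in> V m" for v
  proof -
    have "lin m (\<lambda>v w. if v = w then 1 else 0 :: 'k) v = (\<Sum>w\<in>V m. if w = v then Var w else 0)"
      unfolding lin_def by (intro sum.cong refl) auto
    then show ?thesis using that by simp
  qed
  then have "poly_subst (lin m (\<lambda>v w. if v = w then 1 else 0 :: 'k)) (\<xi> m 1) = \<xi> m 1"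
    using \<xi>_S unfolding S_def by (rule subst_Var_id[rotated])
  then show ?thesis unfolding U_def by auto
qed

text \<open>For each \<open>u\<close> an elementary isometry adds a prescribed multiple of
  \<open>Var u\<close> to the image of y and leaves its other coefficients on \<open>V m\<close>
  alone, so the coefficients can be set one after another.\<close>

lemma y_coefficients_arbitrary:
  fixes l :: "int \<Rightarrow> 'k"
  shows "\<exists>c\<in>U (Suc m). \<forall>w\<in>V m. c (- int (Suc m)) w = l w"
proof -
  let ?y = "- int (Suc m)"
  have "\<exists>c\<in>U (Suc m). \<forall>w\<in>V m. c ?y w = (if w \<in> A then l w else 0)" if "finite A" "A \<subseteq> V m" for A
    using that
  proof (induction A rule: finite_induct)
    case empty
    show ?case by (rule bexI[OF _ U_id]) auto
  next
    case (insert u A)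
    then obtain c where c: "c \<in> U (Suc m)" "\<forall>w\<in>V m. c ?y w = (if w \<in> A then l w else 0)" by auto
    have u: "- u \<in> V m" using insert.prems V_uminus by blast
    let ?E = "elem m (- u) (- l u)"
    have "comp (Suc m) c ?E ?y w = (if w \<in> insert u A then l w else 0)" if w: "w \<in> V m" for w
    proof -
      have E: "?E s w = (if s = w then 1 else 0) + (if s = ?y then if w = u then l u else 0 else 0)" for s
        using w u by (auto simp: elem_def)
      have "comp (Suc m) c ?E ?y w = (\<Sum>s\<in>V (Suc m). (if s = w then c ?y s else 0) + (if s = ?y then if w = u then c ?y s * l u else 0 else 0))"
        unfolding comp_def E by (intro sum.cong refl) (simp add: distrib_left)
      also have "\<dots> = c ?y w + (if w = u then c ?y ?y * l u else 0)"
        unfolding sum.distrib using V_SucI(1)[OF w] V_SucI(3)[of m] by (simp add: sum.delta del: Diff_iff of_nat_Suc)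
      also have "c ?y ?y = 1" using c(1) V_SucI(3)[of m] unfolding U_def by blast
      finally show ?thesis using c(2) w insert.hyps by auto
    qed
    then show ?case using comp_U[OF c(1) elem_U[OF u, of "- l u"]] by blast
  qed
  from this[of "V m"] show ?thesis by auto
qed

text \<open>In an image of y the coefficient of y is 1 and that of x is forced by isotropy, while
  the \<open>2 * m\<close> others are arbitrary.\<close>

lemma card_orb_y: "card (orb (Suc m) (- int (Suc m)) :: (int, 'k) mpoly set) = q ^ (2 * m)"
proof -
  let ?y = "- int (Suc m)"
  let ?\<Psi> = "\<lambda>f :: (int, 'k) mpoly. \<lambda>w\<in>V m. lookup f (single w 1)"
  have \<Psi>: "?\<Psi> (lin (Suc m) c ?y) = restrict (c ?y) (V m)" for c
    by (rule restrict_ext) (rule lookup_lin[OF V_SucI(1)])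
  have "inj_on ?\<Psi> (orb (Suc m) ?y)"
  proof (rule inj_onI)
    fix f g assume "f \<in> orb (Suc m) ?y" "g \<in> orb (Suc m) ?y" and eq: "?\<Psi> f = ?\<Psi> g"
    then obtain c d where c: "c \<in> U (Suc m)" "f = lin (Suc m) c ?y" and d: "d \<in> U (Suc m)" "g = lin (Suc m) d ?y"
      by (auto simp: orb_def)
    have "restrict (c ?y) (V m) = restrict (d ?y) (V m)" using eq unfolding c(2) d(2) \<Psi> .
    then have cd: "c ?y w = d ?y w" if "w \<in> V m" for w using that by (metis restrict_apply')
    then have "lin m c ?y = lin m d ?y" by (simp add: lin_def)
    moreover have "c ?y (int (Suc m)) = d ?y (int (Suc m))"
      unfolding y_coefficient[OF c(1)] y_coefficient[OF d(1)] using cd by (auto intro!: sum.cong)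
    ultimately show "f = g" unfolding c(2) d(2) lin_U_y[OF c(1)] lin_U_y[OF d(1)] by simp
  qed
  then have "card (orb (Suc m) ?y :: (int, 'k) mpoly set) = card (?\<Psi> ` orb (Suc m) ?y)" by (simp add: card_image)
  also have "?\<Psi> ` orb (Suc m) ?y = PiE (V m) (\<lambda>_. UNIV)"
  proof (intro equalityI subsetI)
    fix l :: "int \<Rightarrow> 'k" assume l: "l \<in> PiE (V m) (\<lambda>_. UNIV)"
    obtain c where c: "c \<in> U (Suc m)" "\<forall>w\<in>V m. c ?y w = l w" using y_coefficients_arbitrary by blast
    have "?\<Psi> (lin (Suc m) c ?y) = l" unfolding \<Psi>
      by (rule PiE_ext[OF _ l]) (use c(2) in auto)
    then show "l \<in> ?\<Psi> ` orb (Suc m) ?y" using c(1) by (auto simp: orb_def)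
  next
    fix l assume "l \<in> ?\<Psi> ` orb (Suc m) ?y"
    then obtain f where l: "l = ?\<Psi> f" by blast
    show "l \<in> PiE (V m) (\<lambda>_. UNIV)" unfolding l by (simp only: restrict_PiE_iff UNIV_I) simp
  qed
  finally show ?thesis by (simp add: card_PiE card_V)
qed

end


context finite_field_char
begin

section \<open>The map \<phi> and the invariance of the \<xi>\<close>

lemma comm_ring_hom_\<phi>: "comm_ring_hom (\<phi> m :: (int, 'k) mpoly \<Rightarrow> _)"
  unfolding \<phi>_def by (rule subst.comm_ring_hom_axioms)

sublocale phi: comm_ring_hom "\<phi> m :: (int, 'k) mpoly \<Rightarrow> _" for m
  by (rule comm_ring_hom_\<phi>)

lemma phi_Const [simp]: "\<phi> m (Const a :: (int, 'k) mpoly) = Const a"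
  by (simp add: \<phi>_def)

lemma phi_Var: "\<phi> (Suc m) (Var v :: (int, 'k) mpoly) = Var v ^ q - Var v * xM m ^ (q - 1)"
  by (simp add: \<phi>_def xv_def)

lemma phi_S: "f \<in> S m \<Longrightarrow> \<phi> (Suc m) (f :: (int, 'k) mpoly) \<in> S (Suc m)"
  unfolding \<phi>_def S_def xv_def
  by (erule poly_ring_subst, intro poly_ring_diff poly_ring_mult poly_ring_power poly_ring_Var) auto

lemma phi_lin: "\<phi> (Suc m) (lin m c v) = lin m c v ^ q - lin m c v * (xM m :: (int, 'k) mpoly) ^ (q - 1)"
proof -
  have "lin m c v ^ q = (\<Sum>w\<in>V m. Const (c v w) * Var w ^ q)"
    using frob_q_sum[of "\<lambda>w. Const (c v w) * Var w" "V m" 1] Const_power_q[where j = 1 and ?'v = int]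
    by (simp add: lin_def power_mult_distrib)
  moreover have "\<phi> (Suc m) (lin m c v) = (\<Sum>w\<in>V m. Const (c v w) * Var w ^ q) - lin m c v * xM m ^ (q - 1)"
    by (simp only: lin_def phi.hom_sum phi.hom_mult phi_Const phi_Var right_diff_distrib sum_subtractf
        sum_distrib_right mult.assoc)
  ultimately show ?thesis by simp
qed

lemma comm_ring_hom_frob: "comm_ring_hom (\<lambda>f :: (int, 'k) mpoly. f ^ q)"
proof
  fix f g :: "(int, 'k) mpoly"
  show "(f + g) ^ q = f ^ q + g ^ q" using frob_q_add[of f g 1] by simp
  show "(f * g) ^ q = f ^ q * g ^ q" by (rule power_mult_distrib)
qed (use q_gt_1 in auto)

lemma at0_phi: "f \<in> S m \<Longrightarrow> at0 m (\<phi> (Suc m) (f :: (int, 'k) mpoly)) = f ^ q"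
  unfolding S_def
proof (erule hom_eq_on_poly_ring[OF comm_ring_hom_comp[OF at0.comm_ring_hom_axioms comm_ring_hom_\<phi>] comm_ring_hom_frob])
  fix v assume "v \<in> V m"
  then have "v \<noteq> int (Suc m)" by auto
  then show "at0 m (\<phi> (Suc m) (Var v :: (int, 'k) mpoly)) = Var v ^ q"
    using q_gt_1 by (simp add: phi_Var at0.hom_minus at0.hom_mult at0.hom_power at0_Var)
qed (use Const_power_q[where j = 1 and ?'v = int] in auto)

text \<open>In rank \<open>m + 1\<close> a variable of rank \<open>m\<close> goes to its image in
  rank \<open>m\<close> plus some b x. Since b^q = b, the expression v^q - v x^(q-1) vanishes at v =
  b x, so \<phi> does not see this summand.\<close>

lemma phi_equivariant:
  fixes f :: "(int, 'k) mpoly"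
  assumes c: "c \<in> U (Suc m)" and f: "f \<in> S m"
  shows "poly_subst (lin (Suc m) c) (\<phi> (Suc m) f) = \<phi> (Suc m) (poly_subst (lin m c) f)"
proof (rule hom_eq_on_poly_ring[OF comm_ring_hom_comp[OF subst.comm_ring_hom_axioms comm_ring_hom_\<phi>]
        comm_ring_hom_comp[OF comm_ring_hom_\<phi> subst.comm_ring_hom_axioms] f[unfolded S_def]])
  fix v assume v: "v \<in> V m"
  let ?b = "Const (c v (int (Suc m)))" and ?x = "xM m :: (int, 'k) mpoly"
  have "(lin m c v + ?b * ?x) ^ q = lin m c v ^ q + ?b * ?x ^ q"
    using frob_q_add[of "lin m c v" "?b * ?x" 1] Const_power_q[of _ 1, where ?'v = int] by (simp add: power_mult_distrib)
  moreover have "?x ^ q = ?x * ?x ^ (q - 1)"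
    using q_gt_1 by (simp only: power_minus_mult mult.commute[of ?x])
  ultimately show "poly_subst (lin (Suc m) c) (\<phi> (Suc m) (Var v)) = \<phi> (Suc m) (poly_subst (lin m c) (Var v))"
    using lin_U_x[OF c] lin_Suc_V[OF c v]
    by (simp add: phi_Var phi_lin subst.hom_minus subst.hom_mult subst.hom_power algebra_simps)
qed simp

lemma phi_invariants: "(f :: (int, 'k) mpoly) \<in> invariants m \<Longrightarrow> \<phi> (Suc m) f \<in> invariants (Suc m)"
  using phi_S U_Suc_imp_U by (auto simp: invariants_iff phi_equivariant)

lemma xM_invariant: "(xM m :: (int, 'k) mpoly) \<in> invariants (Suc m)"
  by (simp add: invariants_iff S_Var V_SucI lin_U_x del: of_nat_Suc)

text \<open>\<xi>_i polarizes the quadratic form between v and v^Q: substituting v + v^Q in \<xi>_1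
  gives \<xi>_1 + \<xi>_i + \<xi>_1^Q. This substitution commutes with linear ones because their
  coefficients are fixed by the Q-th power.\<close>

lemma \<xi>_invariant:
  assumes "i \<ge> 1"
  shows "(\<xi> m i :: (int, 'k) mpoly) \<in> invariants m"
  unfolding invariants_iff
proof (intro conjI ballI \<xi>_S)
  fix c :: "int \<Rightarrow> int \<Rightarrow> 'k" assume c: "c \<in> U m"
  let ?Q = "q ^ (i - 1)"
  have 1: "poly_subst (lin m c) (\<xi> m 1) = \<xi> m 1" using c by (simp add: U_def)
  show "poly_subst (lin m c) (\<xi> m i) = \<xi> m i"
  proof (cases "i = 1")
    case False
    let ?\<psi> = "poly_subst (\<lambda>v. Var v + Var v ^ ?Q) :: (int, 'k) mpoly \<Rightarrow> (int, 'k) mpoly"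
    have "?\<psi> (\<xi> m 1) = (\<Sum>k = 1..m. yv k * xv k) + \<xi> m i + (\<Sum>k = 1..m. yv k * xv k) ^ ?Q"
      using False assms unfolding subst_\<xi>_1 frob_q_sum
      by (simp add: \<xi>_def sum.distrib[symmetric] xv_def yv_def algebra_simps power_mult_distrib)
    then have eq: "\<xi> m i = ?\<psi> (\<xi> m 1) - \<xi> m 1 - \<xi> m 1 ^ ?Q"
      by (simp add: \<xi>_1)
    have "poly_subst (lin m c) (?\<psi> (\<xi> m 1)) = ?\<psi> (poly_subst (lin m c) (\<xi> m 1))"
    proof (rule hom_eq_on_poly_ring[OF comm_ring_hom_comp[OF subst.comm_ring_hom_axioms subst.comm_ring_hom_axioms]
            comm_ring_hom_comp[OF subst.comm_ring_hom_axioms subst.comm_ring_hom_axioms] \<xi>_S[unfolded S_def]])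
      fix v
      have "lin m c v ^ ?Q = (\<Sum>w\<in>V m. Const (c v w) * Var w ^ ?Q)"
        unfolding lin_def frob_q_sum by (simp add: power_mult_distrib Const_power_q)
      then show "poly_subst (lin m c) (?\<psi> (Var v)) = ?\<psi> (poly_subst (lin m c) (Var v))"
        by (simp add: subst.hom_add subst.hom_power)
          (simp add: lin_def subst.hom_sum subst.hom_mult sum.distrib[symmetric] distrib_left)
    qed simp
    then show ?thesis unfolding eq by (simp only: subst.hom_minus subst.hom_power 1)
  qed (use 1 in simp)
qed

text \<open>Over each form of the smaller orbit the coefficient of x is free, thanks to the
  isometries \<open>elem\<close>.\<close>

lemma orb_V:
  assumes v: "v \<in> V m"
  shows "orb (Suc m) v = (\<lambda>(u, a). u + Const a * xM m) ` (orb m v \<times> (UNIV :: 'k set))"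
proof (intro equalityI subsetI)
  fix f :: "(int, 'k) mpoly" assume "f \<in> orb (Suc m) v"
  then obtain c where c: "c \<in> U (Suc m)" "f = lin (Suc m) c v" by (auto simp: orb_def)
  then have "f = (\<lambda>(u, a). u + Const a * xM m) (lin m c v, c v (int (Suc m)))"
    by (simp add: lin_Suc_V[OF c(1) v])
  then show "f \<in> (\<lambda>(u, a). u + Const a * xM m) ` (orb m v \<times> UNIV)"
    using U_Suc_imp_U[OF c(1)] by (rule_tac image_eqI) (auto simp: orb_def)
next
  fix f :: "(int, 'k) mpoly" assume "f \<in> (\<lambda>(u, a). u + Const a * xM m) ` (orb m v \<times> UNIV)"
  then obtain c a where c: "c \<in> U m" "f = lin m c v + Const a * xM m" by (auto simp: orb_def)
  \<comment> \<open>Only the occurrence of \<open>Var v\<close> is moved by \<open>elem\<close>, and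
    its coefficient \<open>c v v\<close> is 1, so exactly a x is added.\<close>
  let ?d = "comp (Suc m) (embed m c) (elem m v a)"
  have "lin (Suc m) ?d v = poly_subst (lin (Suc m) (elem m v a)) (lin m c v)"
    by (simp only: lin_comp lin_embed(1)[OF v])
  also have "\<dots> = (\<Sum>w\<in>V m. Const (c v w) * (Var w + (if w = v then Const a * xM m else 0)))"
    unfolding lin_def[of m] subst.hom_sum subst.hom_mult subst_Const subst_Var
    by (intro sum.cong refl, subst lin_elem[OF v V_SucI(1)]) auto
  also have "\<dots> = lin m c v + (\<Sum>w\<in>V m. if w = v then Const (c v v) * (Const a * xM m) else 0)"
    unfolding lin_def[of m] distrib_left sum.distrib by (intro arg_cong2[of _ _ _ _ "(+)"] refl sum.cong) auto
  also have "\<dots> = f" using v c by (simp add: U_def)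
  finally have "f = lin (Suc m) ?d v" ..
  moreover have "?d \<in> U (Suc m)" by (intro comp_U embed_U elem_U c v)
  ultimately show "f \<in> orb (Suc m) v" by (auto simp: orb_def)
qed

text \<open>The larger orbit consists of all translates u + a x, and the product over
  \<open>a\<close> is \<phi> of u by \<open>prod_translates\<close>.\<close>

lemma phi_orbit_prod:
  assumes v: "v \<in> V m"
  shows "\<phi> (Suc m) (orbit_prod m (Var v)) = (orbit_prod (Suc m) (Var v) :: (int, 'k) mpoly)"
proof -
  let ?x = "xM m :: (int, 'k) mpoly"
  have x0: "?x \<noteq> 0" using LM_not_0[OF LM_Var] .
  have a: "at0 m u = u" if "u \<in> orb m v" for u :: "(int, 'k) mpoly"
    using that at0_id[OF lin_ring'] by (auto simp: orb_def)
  have inj: "inj_on (\<lambda>(u, a). u + Const a * ?x) (orb m v \<times> UNIV)"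
  proof (rule inj_onI, clarify)
    fix u a u' a' assume u: "u \<in> orb m v" "u' \<in> orb m v" and eq: "u + Const a * ?x = u' + Const a' * ?x"
    from arg_cong[OF eq, of "at0 m"] have "u = u'"
      by (simp add: at0.hom_add at0.hom_mult at0_Var a[OF u(1)] a[OF u(2)])
    with eq show "u = u' \<and> a = a'" using injD[OF Const_inj_mult[OF x0], of a a'] by simp
  qed
  have "orbit_prod (Suc m) (Var v) = (\<Prod>(u, a)\<in>orb m v \<times> UNIV. u + Const a * ?x)"
    unfolding orbit_prod_eq[OF V_SucI(1)[OF v]] orb_V[OF v] prod.reindex[OF inj] by (simp add: case_prod_beta)
  also have "\<dots> = (\<Prod>u\<in>orb m v. \<Prod>a\<in>UNIV. u + Const a * ?x)"
    by (rule prod.cartesian_product[symmetric])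
  also have "\<dots> = (\<Prod>u\<in>orb m v. \<phi> (Suc m) u)"
    by (intro prod.cong refl) (auto simp: orb_def phi_lin prod_translates[OF x0] simp del: of_nat_Suc)
  finally show ?thesis by (simp add: orbit_prod_eq[OF v] phi.hom_prod)
qed

section \<open>Orbit products of x and y\<close>

lemma orbit_prod_x: "orbit_prod (Suc m) (xM m) = (xM m :: (int, 'k) mpoly)"
proof -
  have "orb (Suc m) (int (Suc m)) = {xM m :: (int, 'k) mpoly}"
    using U_id[of "Suc m"] by (auto simp: orb_def lin_U_x simp del: of_nat_Suc intro!: rev_image_eqI)
  then show ?thesis by (simp add: orbit_prod_eq V_SucI del: of_nat_Suc)
qed

text \<open>This is N(y) for the y of index \<open>m + 1\<close>, an invariant in rank
  \<open>m + 1\<close>: the argument is one less than the rank.\<close>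

definition Ny :: "nat \<Rightarrow> (int, 'k) mpoly"
  where "Ny m = orbit_prod (Suc m) (yM m)"

lemma Ny_eq: "Ny m = \<Prod>(orb (Suc m) (- int (Suc m)))"
  unfolding Ny_def by (rule orbit_prod_eq[OF V_SucI(3)])

lemma Ny_invariant: "Ny m \<in> invariants (Suc m)"
  unfolding Ny_def by (rule orbit_prod_invariant[OF V_SucI(3)])

lemma LM_Ny: "LM (Ny m) (single (- int (Suc m)) (q ^ (2 * m)))"
proof -
  have "LM (Ny m) (\<Sum>f\<in>(orb (Suc m) (- int (Suc m)) :: (int, 'k) mpoly set). single (- int (Suc m)) 1)"
    unfolding Ny_eq
  proof (rule LM_prod)
    fix f :: "(int, 'k) mpoly" assume "f \<in> orb (Suc m) (- int (Suc m))"
    then obtain c where c: "c \<in> U (Suc m)" "f = lin (Suc m) c (- int (Suc m))" by (auto simp: orb_def)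
    show "LM f (single (- int (Suc m)) 1)" unfolding c(2) by (rule LM_lin_U[OF c(1) V_SucI(3)])
  qed
  also have "(\<Sum>f\<in>(orb (Suc m) (- int (Suc m)) :: (int, 'k) mpoly set). single (- int (Suc m)) 1) =
      single (- int (Suc m)) (q ^ (2 * m))"
    by (rule poly_mapping_eqI) (simp add: lookup_sum lookup_single when_def card_orb_y del: of_nat_Suc sum_constant, auto simp: card_orb_y simp del: of_nat_Suc)
  finally show ?thesis .
qed

lemma homogeneous_Ny: "homogeneous (\<lambda>_. 1) (q ^ (2 * m)) (Ny m)"
proof -
  have "homogeneous (\<lambda>_. 1) (\<Sum>f\<in>(orb (Suc m) (- int (Suc m)) :: (int, 'k) mpoly set). 1) (Ny m)"
    unfolding Ny_eq by (rule homogeneous_prod) (auto simp: orb_def intro: homogeneous_lin[unfolded One_nat_def])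
  then show ?thesis by (simp add: card_orb_y del: of_nat_Suc)
qed

text \<open>Every factor is y plus a form free of y, and this remains so when x is set to 0. The
  degree at x = 0 keeps the powers of N(y) independent in \<open>B_saturated\<close>.\<close>

lemma up_Ny:
  shows "Polynomial.degree (up (- int (Suc m)) (Ny m)) = q ^ (2 * m)"
    and "lead_coeff (up (- int (Suc m)) (Ny m)) = 1"
    and "Polynomial.degree (up (- int (Suc m)) (at0 m (Ny m))) = q ^ (2 * m)"
proof -
  let ?y = "- int (Suc m)"
  let ?O = "orb (Suc m) ?y :: (int, 'k) mpoly set"
  have ex: "\<exists>g. f = Var ?y + g \<and> g \<in> poly_ring (- {?y})" if f: "f \<in> ?O" for f
  proof -
    from f obtain c where c: "c \<in> U (Suc m)" "f = lin (Suc m) c ?y" by (auto simp: orb_def)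
    have "lin m c ?y \<in> poly_ring (- {?y})"
      using lin_ring by (rule subsetD[OF poly_ring_mono, rotated]) auto
    then have "lin m c ?y + Const (c ?y (int (Suc m))) * xM m \<in> poly_ring (- {?y})"
      by (intro poly_ring_add poly_ring_mult) simp_all
    then show ?thesis using lin_U_y[OF c(1)] c(2) by blast
  qed
  have 1: "\<exists>g. up ?y f = [:g, 1:]" if "f \<in> ?O" for f
    using ex[OF that] by (auto simp: up.hom_add up_free)
  have 2: "\<exists>g. up ?y (at0 m f) = [:g, 1:]" if f: "f \<in> ?O" for f
  proof -
    from ex[OF f] obtain g where g: "f = Var ?y + g" "g \<in> poly_ring (- {?y})" by blast
    have "at0 m g \<in> poly_ring (- {?y})" unfolding at0_def by (rule poly_ring_subst[OF g(2)]) simp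
    then show ?thesis by (simp add: g(1) at0.hom_add at0_Var up.hom_add up_free)
  qed
  have deg: "Polynomial.degree (\<Prod>f\<in>?O. h f) = q ^ (2 * m)" if "\<And>f. f \<in> ?O \<Longrightarrow> \<exists>g. h f = [:g, 1 :: (int, 'k) mpoly:]" for h
  proof -
    have h: "h f \<noteq> 0 \<and> Polynomial.degree (h f) = 1" if "f \<in> ?O" for f
      using \<open>\<And>f. f \<in> ?O \<Longrightarrow> \<exists>g. h f = [:g, 1:]\<close>[OF that] by auto
    then have "Polynomial.degree (\<Prod>f\<in>?O. h f) = (\<Sum>f\<in>?O. Polynomial.degree (h f))"
      by (intro degree_prod_eq_sum_degree) auto
    also have "\<dots> = (\<Sum>f\<in>?O. 1)" using h by (intro sum.cong) auto
    finally show ?thesis by (simp add: card_orb_y del: of_nat_Suc)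
  qed
  show "Polynomial.degree (up ?y (Ny m)) = q ^ (2 * m)"
    unfolding Ny_eq up.hom_prod by (rule deg[OF 1])
  show "Polynomial.degree (up ?y (at0 m (Ny m))) = q ^ (2 * m)"
    unfolding Ny_eq up.hom_prod at0.hom_prod by (rule deg[OF 2])
  have "lead_coeff (up ?y f) = 1" if "f \<in> ?O" for f using 1[OF that] by auto
  then show "lead_coeff (up ?y (Ny m)) = 1"
    unfolding Ny_eq up.hom_prod lead_coeff_prod by (intro prod.neutral) simp
qed

section \<open>Leading monomials and degrees of the generators\<close>

lemma \<xi>_Suc: "i \<ge> 2 \<Longrightarrow> (\<xi> (Suc m) i :: (int, 'k) mpoly) =
    yM m ^ (q ^ (i - 1)) * xM m + (yM m * xM m ^ (q ^ (i - 1)) + \<xi> m i)"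
  by (simp add: \<xi>_eq xv_def yv_def)

lemma at0_\<xi>: "i \<ge> 1 \<Longrightarrow> at0 m (\<xi> (Suc m) i :: (int, 'k) mpoly) = \<xi> m i"
proof (cases "i = 1")
  case True
  then show ?thesis by (simp only: True \<xi>_1_Suc at0.hom_add at0.hom_mult at0_id[OF \<xi>_S] at0_Var) simp
next
  case False
  assume "i \<ge> 1"
  with False have "i \<ge> 2" by simp
  then show ?thesis using q_gt_1
    by (simp only: \<xi>_Suc at0.hom_add at0.hom_mult at0.hom_power at0_id[OF \<xi>_S] at0_Var) (simp add: power_0_left)
qed

text \<open>y is the largest variable, so its exponent decides the comparison first.\<close>

lemma monomial_less:
  assumes "keys s \<subseteq> V (Suc m)" "keys t \<subseteq> V (Suc m)" "lookup s (- int (Suc m)) < lookup t (- int (Suc m))"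
  shows "s < t"
proof -
  have "lookup s k = 0" "lookup t k = 0" if "k < - int (Suc m)" for k
    using assms(1,2) that by (auto simp: in_keys_iff subset_iff)
  then show ?thesis unfolding less_poly_mapping.rep_eq less_fun_def
    using assms(3) by (intro exI[of _ "- int (Suc m)"]) auto
qed

text \<open>Exactly one term attains the maximal exponent of y, the largest variable.\<close>

lemma LM_\<xi>:
  assumes i: "i \<ge> 1"
  shows "LM (\<xi> (Suc m) i :: (int, 'k) mpoly) (single (- int (Suc m)) (q ^ (i - 1)) + single (int (Suc m)) 1)"
proof -
  let ?y = "- int (Suc m)" and ?x = "int (Suc m)" and ?Q = "q ^ (i - 1)"
  let ?t = "single ?y ?Q + single ?x 1"
  have Q0: "?Q > 0" using q_gt_1 by simp
  have lead: "LM (Var ?y ^ ?Q * Var ?x :: (int, 'k) mpoly) ?t"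
    unfolding Var_power by (intro LM_mult LM_single LM_Var)
  have kt: "keys ?t \<subseteq> V (Suc m)" by (auto simp: keys_add_nat split: if_splits)
  have lt: "lookup ?t ?y = ?Q" by (simp add: lookup_add lookup_single)
  have small: "s < ?t" if s: "s \<in> keys (\<xi> m i :: (int, 'k) mpoly)" for s
  proof (rule monomial_less[OF _ kt])
    have "keys s \<subseteq> V m" using \<xi>_S[of m i] s unfolding S_def poly_ring_def by blast
    then show "keys s \<subseteq> V (Suc m)" by auto
    have "?y \<notin> keys s" using \<open>keys s \<subseteq> V m\<close> V_Suc_notin(1)[of m] by blast
    then have "lookup s ?y = 0" by (simp only: in_keys_iff not_not)
    then show "lookup s ?y < lookup ?t ?y" unfolding lt using Q0 by (simp only:)
  qed
  show ?thesis
  proof (cases "i = 1")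
    case True
    have "\<xi> (Suc m) i = Var ?y ^ ?Q * Var ?x + (\<xi> m i :: (int, 'k) mpoly)"
      by (simp only: True \<xi>_1_Suc) simp
    then show ?thesis using LM_add[OF lead small] by simp
  next
    case False
    then have i2: "i \<ge> 2" using i by simp
    have Q1: "?Q > 1" using i2 by (intro one_less_power q_gt_1) simp
    show ?thesis unfolding \<xi>_Suc[OF i2]
    proof (rule LM_add[OF lead])
      fix s assume "s \<in> keys (Var ?y * Var ?x ^ ?Q + \<xi> m i :: (int, 'k) mpoly)"
      then have "s \<in> keys (Var ?y * Var ?x ^ ?Q :: (int, 'k) mpoly) \<union> keys (\<xi> m i :: (int, 'k) mpoly)"
        by (rule rev_subsetD) (rule keys_add)
      moreover have "(Var ?y * Var ?x ^ ?Q :: (int, 'k) mpoly) = single (single ?y 1 + single ?x ?Q) 1"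
        unfolding Var_power by (simp add: Var_def mult_single)
      moreover have "single ?y 1 + single ?x ?Q < ?t"
      proof (rule monomial_less[OF _ kt])
        show "keys (single ?y 1 + single ?x ?Q) \<subseteq> V (Suc m)" by (auto simp: keys_add_nat split: if_splits)
        show "lookup (single ?y 1 + single ?x ?Q) ?y < lookup ?t ?y"
          unfolding lt using Q1 by (simp add: lookup_add lookup_single)
      qed
      ultimately show "s < ?t" using small by auto
    qed
  qed
qed

lemma homogeneous_\<xi>: "i \<ge> 1 \<Longrightarrow> homogeneous (\<lambda>_. 1) (q ^ (i - 1) + 1) (\<xi> m i :: (int, 'k) mpoly)"
proof (cases "i = 1")
  case True
  have "homogeneous (\<lambda>_. 1) (1 + 1) (yv k * xv k :: (int, 'k) mpoly)" for k
    unfolding xv_def yv_def by (rule homogeneous_mult[OF homogeneous_Var homogeneous_Var])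
  then show ?thesis by (simp add: True \<xi>_1 homogeneous_sum)
next
  case False
  assume "i \<ge> 1"
  with False have "i \<ge> 2" by simp
  let ?Q = "q ^ (i - 1)"
  have "homogeneous (\<lambda>_. 1) (1 * ?Q + 1) (yv k ^ ?Q * xv k :: (int, 'k) mpoly)"
    "homogeneous (\<lambda>_. 1) (1 + 1 * ?Q) (yv k * xv k ^ ?Q :: (int, 'k) mpoly)" for k
    unfolding xv_def yv_def by (intro homogeneous_mult homogeneous_power homogeneous_Var)+
  then show ?thesis unfolding \<xi>_eq[OF \<open>i \<ge> 2\<close>]
    by (intro homogeneous_sum homogeneous_add) (simp_all add: add.commute)
qed

lemma homogeneous_phi:
  assumes f: "f \<in> S m" "homogeneous (\<lambda>_. 1) d f"
  shows "homogeneous (\<lambda>_. 1) (q * d) (\<phi> (Suc m) (f :: (int, 'k) mpoly))"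
proof -
  have "homogeneous (\<lambda>_. 1) q (Var v ^ q - Var v * xv (Suc m) ^ (q - 1) :: (int, 'k) mpoly)" for v
  proof (rule homogeneous_diff)
    show "homogeneous (\<lambda>_. 1) q (Var v ^ q :: (int, 'k) mpoly)"
      using homogeneous_power[OF homogeneous_Var[of "\<lambda>_. 1" v], of q] by simp
    show "homogeneous (\<lambda>_. 1) q (Var v * xv (Suc m) ^ (q - 1) :: (int, 'k) mpoly)"
      using homogeneous_mult[OF homogeneous_Var[of "\<lambda>_. 1" v] homogeneous_power[OF homogeneous_Var[of "\<lambda>_. 1" "int (Suc m)"], of "q - 1"]] q_gt_1
      by (simp add: xv_def)
  qed
  moreover have "homogeneous (\<lambda>_. q) (q * d) f"
    using f(2) by (simp add: homogeneous_def mon_weight_def sum_distrib_left[symmetric])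
  ultimately show ?thesis unfolding \<phi>_def card_field
    by (intro homogeneous_subst[OF _ f(1)[unfolded S_def]]) simp_all
qed

lemma LM_phi_Var:
  assumes "v \<in> V m"
  shows "LM (\<phi> (Suc m) (Var v :: (int, 'k) mpoly)) (single v q)"
proof -
  let ?x = "int (Suc m)"
  have eq: "- (Var v * Var ?x ^ (q - 1) :: (int, 'k) mpoly) = single (single v 1 + single ?x (q - 1)) (- 1)"
    unfolding Var_power by (simp add: Var_def mult_single single_uminus)
  have "LM (Var v ^ q + - (Var v * Var ?x ^ (q - 1)) :: (int, 'k) mpoly) (single v q)"
    unfolding Var_power[of v q]
  proof (rule LM_add[OF LM_single])
    fix s assume "s \<in> keys (- (Var v * Var ?x ^ (q - 1)) :: (int, 'k) mpoly)"
    then have s: "s = single v 1 + single ?x (q - 1)" unfolding eq by simp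
    have "v < ?x" using assms by auto
    then show "s < single v q" unfolding s less_poly_mapping.rep_eq less_fun_def
      using q_gt_1 by (intro exI[of _ v]) (auto simp: lookup_add lookup_single when_def)
  qed
  then show ?thesis by (simp add: phi_Var)
qed

lemma mon_pow_mono: "s < t \<Longrightarrow> mon_pow q s < mon_pow q t"
  unfolding less_poly_mapping.rep_eq less_fun_def using q_gt_1 by auto

text \<open>\<phi> sends a variable v > x to a polynomial led by v^q, and multiplying exponents by
  \<open>q\<close> preserves the order.\<close>

lemma LM_phi:
  fixes f :: "(int, 'k) mpoly"
  assumes f: "f \<in> S m" and t: "LM f t"
  shows "LM (\<phi> (Suc m) f) (mon_pow q t)"
proof -
  have mono: "LM (\<phi> (Suc m) (mon_val Var s :: (int, 'k) mpoly)) (mon_pow q s)" if "keys s \<subseteq> V m" for s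
  proof -
    have "LM (\<phi> (Suc m) (mon_val Var s :: (int, 'k) mpoly)) (\<Sum>v\<in>keys s. mon_pow (lookup s v) (single v q))"
      unfolding phi.hom_mon_val unfolding mon_val_def using that by (intro LM_prod LM_power LM_phi_Var) auto
    also have "(\<Sum>v\<in>keys s. mon_pow (lookup s v) (single v q)) = mon_pow q s"
      by (rule poly_mapping_eqI) (auto simp: lookup_sum lookup_single when_def in_keys_iff if_distrib mult.commute cong: if_cong)
    finally show ?thesis .
  qed
  have kV: "keys s \<subseteq> V m" if "s \<in> keys f" for s using f that unfolding S_def poly_ring_def by blast
  have tk: "t \<in> keys f" using t by (simp add: LM_def in_keys_iff)
  have "f = mon_val Var t + (\<Sum>s\<in>keys f - {t}. Const (lookup f s) * mon_val Var s)"
    using t by (intro trans[OF mpoly_sum'[of f]], subst sum.remove[OF finite_keys tk]) (simp add: LM_def)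
  then have "\<phi> (Suc m) f = \<phi> (Suc m) (mon_val Var t) + (\<Sum>s\<in>keys f - {t}. Const (lookup f s) * \<phi> (Suc m) (mon_val Var s))"
    by (metis (no_types, lifting) phi.hom_add phi.hom_mult phi.hom_sum phi_Const sum.cong)
  also have "LM \<dots> (mon_pow q t)"
  proof (rule LM_add[OF mono[OF kV[OF tk]]])
    fix r assume r: "r \<in> keys (\<Sum>s\<in>keys f - {t}. Const (lookup f s) * \<phi> (Suc m) (mon_val Var s))"
    obtain s where s: "s \<in> keys f" "s \<noteq> t" "r \<in> keys (Const (lookup f s) * \<phi> (Suc m) (mon_val Var s))"
      using subsetD[OF keys_sum r] by blast
    then have "r \<in> keys (\<phi> (Suc m) (mon_val Var s) :: (int, 'k) mpoly)" by (auto simp: in_keys_iff lookup_Const_mult)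
    then have "r \<le> mon_pow q s" using mono[OF kV[OF s(1)]] by (simp add: LM_def)
    also have "s < t" using t s by (auto simp: LM_def order_less_le)
    then have "mon_pow q s < mon_pow q t" by (rule mon_pow_mono)
    finally show "r < mon_pow q t" .
  qed
  finally show ?thesis .
qed

lemma H0_Suc: "(H0 (Suc m) :: (int, 'k) mpoly set) = \<phi> (Suc m) ` H0 m \<union> {Ny m, xM m}"
proof -
  have V: "int k \<in> V m" "- int k \<in> V m" if "k \<in> {1..m}" for k using that by auto
  have I: "{1..Suc m} = insert (Suc m) {1..m}" by auto
  have "(\<lambda>k. orbit_prod (Suc m) (yv k)) ` {1..m} = \<phi> (Suc m) ` (\<lambda>k. orbit_prod m (yv k :: (int, 'k) mpoly)) ` {1..m}"
    "(\<lambda>k. orbit_prod (Suc m) (xv k)) ` {1..m} = \<phi> (Suc m) ` (\<lambda>k. orbit_prod m (xv k :: (int, 'k) mpoly)) ` {1..m}"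
    unfolding image_image xv_def yv_def by (intro image_cong refl phi_orbit_prod[symmetric] V; assumption)+
  moreover have "orbit_prod (Suc m) (yv (Suc m)) = Ny m" "orbit_prod (Suc m) (xv (Suc m)) = (xM m :: (int, 'k) mpoly)"
    unfolding Ny_def xv_def yv_def by (rule refl, rule orbit_prod_x)
  ultimately show ?thesis unfolding H0_def I image_insert image_Un by auto
qed

text \<open>Extends the recursion down to \<open>m = 0\<close>, where \<open>BH\<close> contains
  only the empty product, so that the inductions below can start in rank 0.\<close>

lemma M_Suc: "(M (Suc m) :: (int, 'k) mpoly set) = {\<beta> * c | \<beta> c. \<beta> \<in> BH (Suc m) \<and> c \<in> \<phi> (Suc m) ` M m}"
proof (cases m)
  case 0
  have "BH (Suc 0) = {1 :: (int, 'k) mpoly}" by (auto simp: BH_def)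
  then show ?thesis using 0 by simp
qed simp

end


section \<open>The structure of the invariant ring\<close>

lemma single_power: "single s a ^ n = (single (mon_pow n s) (a ^ n) :: ('v, 'k::comm_ring_1) mpoly)"
proof (induction n)
  case (Suc n)
  then show ?case by (simp add: mon_pow_Suc mult_single)
qed simp

lemma lookup_at0: "lookup (at0 m f) t = (if lookup t (int (Suc m)) = 0 then lookup f t else 0)"
  unfolding at0_def by (rule lookup_subst_zero)

text \<open>The statement about \<open>keys\<close> carries bounds on degree and variables over to
  the quotient.\<close>

lemma at0_eq_0_imp:
  fixes f :: "(int, 'k::comm_ring_1) mpoly"
  assumes "at0 m f = 0"
  obtains g where "f = xM m * g" "\<And>t. t \<in> keys g \<Longrightarrow> t + single (int (Suc m)) 1 \<in> keys f"
proof -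
  let ?e = "single (int (Suc m)) 1"
  have pos: "t = ?e + (t - ?e)" if "t \<in> keys f" for t
  proof -
    have "lookup t (int (Suc m)) \<noteq> 0"
    proof
      assume "lookup t (int (Suc m)) = 0"
      then have "lookup f t = lookup (at0 m f) t" by (simp add: lookup_at0 del: of_nat_Suc)
      then show False using that assms by (simp only: in_keys_iff lookup_zero) simp
    qed
    then show ?thesis by (intro poly_mapping_eqI) (auto simp: lookup_add lookup_minus lookup_single when_def)
  qed
  define g where "g = (\<Sum>t\<in>keys f. single (t - ?e) (lookup f t))"
  have "xM m * g = (\<Sum>t\<in>keys f. single t (lookup f t))"
    unfolding g_def sum_distrib_left
  proof (intro sum.cong refl)
    fix t assume "t \<in> keys f"
    then show "xM m * single (t - ?e) (lookup f t) = single t (lookup f t)"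
      unfolding Var_def mult_single mult_1 by (simp only: pos[symmetric])
  qed
  then have "f = xM m * g" by (simp only: mpoly_sum[symmetric])
  moreover have "s + ?e \<in> keys f" if s: "s \<in> keys g" for s
  proof -
    obtain t where t: "t \<in> keys f" "s \<in> keys (single (t - ?e) (lookup f t))"
      using subsetD[OF keys_sum s[unfolded g_def]] by blast
    then have "s = t - ?e" by (simp split: if_splits)
    then have "s + ?e = t" using pos[OF t(1)] by (metis add.commute)
    then show ?thesis using t(1) by simp
  qed
  ultimately show ?thesis using that by blast
qed

lemma xV_subset: "insert (int (Suc m)) (V m) \<subseteq> V (Suc m)"
  and xV_free: "insert (int (Suc m)) (V m) \<subseteq> - {- int (Suc m)}"
  and V_free: "V m \<subseteq> - {- int (Suc m)}"
  by auto

context finite_field_char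
begin

lemma xM_neq_0: "(xM m :: (int, 'k) mpoly) \<noteq> 0"
  by (rule LM_not_0[OF LM_Var])

lemma subst_at0_embed:
  fixes c :: "(int, 'k) mpoly"
  assumes "c \<in> poly_ring (insert (int (Suc m)) (V m))"
  shows "poly_subst (lin m d) (at0 m c) = at0 m (poly_subst (lin (Suc m) (embed m d)) c)"
proof (rule hom_eq_on_poly_ring[OF comm_ring_hom_comp[OF subst.comm_ring_hom_axioms at0.comm_ring_hom_axioms]
        comm_ring_hom_comp[OF at0.comm_ring_hom_axioms subst.comm_ring_hom_axioms] assms])
  fix v assume v: "v \<in> insert (int (Suc m)) (V m)"
  show "poly_subst (lin m d) (at0 m (Var v)) = at0 m (poly_subst (lin (Suc m) (embed m d)) (Var v))"
  proof (cases "v = int (Suc m)")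
    case True
    then show ?thesis by (simp only: True at0_Var subst_Var lin_embed(2) if_True subst.hom_zero refl)
  next
    case False
    then have "v \<in> V m" using v by blast
    then show ?thesis using False by (simp only: at0_Var subst_Var lin_embed(1) if_False at0_id[OF lin_ring'])
  qed
qed simp

text \<open>x is fixed by the group and can be cancelled in a domain, so the quotient is invariant
  too.\<close>

lemma invariant_div_x:
  fixes f :: "(int, 'k) mpoly"
  assumes f: "f \<in> invariants (Suc m)" and f0: "at0 m f = 0"
  obtains g where "g \<in> invariants (Suc m)" "f = xM m * g"
    "\<And>t. t \<in> keys g \<Longrightarrow> t + single (int (Suc m)) 1 \<in> keys f"
proof -
  obtain g where g: "f = xM m * g" "\<And>t. t \<in> keys g \<Longrightarrow> t + single (int (Suc m)) 1 \<in> keys f"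
    by (rule at0_eq_0_imp[OF f0]) (rule that)
  have "g \<in> invariants (Suc m)"
    unfolding invariants_iff
  proof (intro conjI ballI)
    show "g \<in> S (Suc m)" unfolding S_def poly_ring_def
    proof (intro CollectI ballI)
      fix t assume "t \<in> keys g"
      from g(2)[OF this] have "keys (t + single (int (Suc m)) 1) \<subseteq> V (Suc m)"
        using f unfolding invariants_iff S_def poly_ring_def by blast
      then show "keys t \<subseteq> V (Suc m)" unfolding keys_add_nat by (rule le_supE)
    qed
    fix u :: "int \<Rightarrow> int \<Rightarrow> 'k" assume u: "u \<in> U (Suc m)"
    have "poly_subst (lin (Suc m) u) f = f" using f u unfolding invariants_iff by blast
    then have "xM m * poly_subst (lin (Suc m) u) g = xM m * g"
      unfolding g(1) by (simp only: subst.hom_mult subst_Var lin_U_x[OF u])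
    then show "poly_subst (lin (Suc m) u) g = g"
      using xM_neq_0[of m] by (simp only: mult_cancel_left) blast
  qed
  then show ?thesis using g by (rule that)
qed

text \<open>An invariant not involving \<open>y\<close> becomes a \<open>q\<close>-th power modulo \<open>x\<close>, and \<open>\<phi>\<close> of the root
  lifts it, so that the difference is divisible by \<open>x\<close>.\<close>

lemma y_free_invariant:
  fixes c :: "(int, 'k) mpoly"
  assumes "c \<in> invariants (Suc m)" "c \<in> poly_ring (insert (int (Suc m)) (V m))"
  shows "\<exists>n G. (\<forall>j. G j \<in> invariants m) \<and> c = (\<Sum>j<n. \<phi> (Suc m) (G j) * xM m ^ j)"
proof -
  \<comment> \<open>Induction on a bound for the total degree, which drops when x is divided
    out.\<close>
  have "\<exists>n G. (\<forall>j. G j \<in> invariants m) \<and> c = (\<Sum>j<n. \<phi> (Suc m) (G j) * xM m ^ j)"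
    if "c \<in> invariants (Suc m)" "c \<in> poly_ring (insert (int (Suc m)) (V m))"
      "\<And>t. t \<in> keys c \<Longrightarrow> mon_weight (\<lambda>_. 1) t < d" for c :: "(int, 'k) mpoly" and d
    using that
  proof (induction d arbitrary: c)
    case 0
    then have "c = 0" by (metis keys_eq_empty not_less0 ex_in_conv)
    then show ?case using invariants_0 by (intro exI[of _ 0] exI[of _ "\<lambda>_. 0"]) simp
  next
    case (Suc d)
    let ?x = "int (Suc m)"
    define c0 where "c0 = at0 m c"
    have kc0: "t \<in> keys c \<and> lookup t ?x = 0" if "t \<in> keys c0" for t
    proof -
      have "lookup c0 t \<noteq> 0" using that by (simp only: in_keys_iff not_False_eq_True)
      then show ?thesis unfolding c0_def lookup_at0 in_keys_iff by (simp split: if_splits)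
    qed
    have kV: "keys t \<subseteq> V m" if "t \<in> keys c0" for t
    proof -
      have "keys t \<subseteq> insert ?x (V m)" using Suc.prems(2) kc0[OF that] unfolding poly_ring_def by blast
      moreover have "?x \<notin> keys t" using kc0[OF that] by (simp only: in_keys_iff not_not)
      ultimately show ?thesis by (metis subset_insert)
    qed
    \<comment> \<open>As y does not occur in \<open>c\<close>, the isometry \<open>elem\<close> acts
      on it as the mere translation of \<open>v\<close> by multiples of x.\<close>
    have dvd: "q dvd lookup t v" if t: "t \<in> keys c0" for t v
    proof (cases "v \<in> V m")
      case True
      have "poly_subst (Var(v := Var v + Const a * xM m)) c = c" for a
      proof -
        have "poly_subst (lin (Suc m) (elem m v a)) c = c"
          using Suc.prems(1) elem_U[OF True] unfolding invariants_iff by blast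
        also have "poly_subst (lin (Suc m) (elem m v a)) c = poly_subst (Var(v := Var v + Const a * xM m)) c"
        proof (rule subst_cong[OF Suc.prems(2)])
          fix u assume "u \<in> insert ?x (V m)"
          then have u: "u \<in> V (Suc m)" "u \<noteq> - int (Suc m)" using V_SucI(1,2) V_Suc_notin by auto
          show "lin (Suc m) (elem m v a) u = (Var(v := Var v + Const a * xM m)) u"
            unfolding lin_elem[OF True u(1)] using u(2) by simp
        qed
        finally show ?thesis .
      qed
      moreover have "v \<noteq> ?x" using True V_Suc_notin(2)[of m] by blast
      ultimately show ?thesis using kc0[OF t] by (intro translation_invariant_exponents[of v ?x c]) auto
    next
      case False
      then have "v \<notin> keys t" using kV[OF t] by blast
      then show ?thesis by (simp add: in_keys_iff)
    qed
    define dq where "dq t = Poly_Mapping.map (\<lambda>n. n div q) t" for t :: "int \<Rightarrow>\<^sub>0 nat"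
    have ldq: "lookup (dq t) v = lookup t v div q" for t v by (simp add: dq_def map.rep_eq when_def)
    have pdq: "mon_pow q (dq t) = t" if "t \<in> keys c0" for t
      using dvd[OF that] by (intro poly_mapping_eqI) (simp add: ldq)
    have kdq: "keys (dq t) \<subseteq> V m" if "t \<in> keys c0" for t
    proof -
      have "lookup t v \<noteq> 0" if "lookup (dq t) v \<noteq> 0" for v using that unfolding ldq by (metis div_0)
      then show ?thesis using kV[OF that] unfolding in_keys_iff subset_iff by blast
    qed
    \<comment> \<open>The q-th root of \<open>c0\<close>: its exponents are divisible by
      \<open>q\<close>, and its coefficients are their own q-th powers.\<close>
    define g where "g = (\<Sum>t\<in>keys c0. single (dq t) (lookup c0 t))"
    have gq: "g ^ q = c0"
    proof -
      have "g ^ q = (\<Sum>t\<in>keys c0. single (dq t) (lookup c0 t) ^ q)"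
        unfolding g_def using frob_q_sum[of _ _ 1] by simp
      also have "\<dots> = (\<Sum>t\<in>keys c0. single t (lookup c0 t))"
        by (intro sum.cong refl) (simp add: single_power pdq)
      finally show ?thesis by (simp only: mpoly_sum[symmetric])
    qed
    have sS: "single (dq t) (lookup c0 t) \<in> S m" if "t \<in> keys c0" for t
      using kdq[OF that] unfolding S_def poly_ring_def by (auto split: if_splits)
    have gS: "g \<in> S m"
      unfolding g_def S_def by (rule poly_ring_sum) (rule sS[unfolded S_def])
    have gI: "g \<in> invariants m"
      unfolding invariants_iff
    proof (intro conjI gS ballI)
      fix u :: "int \<Rightarrow> int \<Rightarrow> 'k" assume u: "u \<in> U m"
      have "poly_subst (lin m u) g ^ q = poly_subst (lin m u) c0"
        by (simp only: gq[symmetric] subst.hom_power)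
      also have "\<dots> = at0 m (poly_subst (lin (Suc m) (embed m u)) c)"
        unfolding c0_def by (rule subst_at0_embed[OF Suc.prems(2)])
      also have "\<dots> = c0"
        using Suc.prems(1) embed_U[OF u] by (simp add: invariants_iff c0_def)
      \<comment> \<open>Uniqueness of q-th roots passes invariance from \<open>c0\<close> to
        \<open>g\<close>.\<close>
      finally have "poly_subst (lin m u) g ^ (p ^ e) = g ^ (p ^ e)" by (simp only: gq card[symmetric])
      then show "poly_subst (lin m u) g = g" by (rule frob_inj[OF of_nat_p_mpoly])
    qed
    have diff0: "at0 m (c - \<phi> (Suc m) g) = 0"
      by (simp add: at0.hom_minus at0_phi[OF gS] gq c0_def)
    have diff_inv: "c - \<phi> (Suc m) g \<in> invariants (Suc m)"
      by (intro invariants_diff Suc.prems(1) phi_invariants gI)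
    obtain c1 where c1_inv: "c1 \<in> invariants (Suc m)" and c1: "c - \<phi> (Suc m) g = xM m * c1"
      and kc1: "\<And>t. t \<in> keys c1 \<Longrightarrow> t + single ?x 1 \<in> keys (c - \<phi> (Suc m) g)"
      by (rule invariant_div_x[OF diff_inv diff0]) (rule that)
    have phi_ring: "\<phi> (Suc m) g \<in> poly_ring (insert ?x (V m))"
      unfolding \<phi>_def xv_def using gS unfolding S_def
      by (rule poly_ring_subst) (intro poly_ring_diff poly_ring_mult poly_ring_power poly_ring_Var; blast)
    \<comment> \<open>\<phi> multiplies degrees by \<open>q\<close>, so the terms of \<phi> of
      \<open>g\<close> have the degrees occurring in \<open>c0\<close>, and subtracting it respects
      the bound.\<close>
    have keys_phi: "mon_weight (\<lambda>_. 1) t < Suc d" if t: "t \<in> keys (\<phi> (Suc m) g)" for t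
    proof -
      have "\<phi> (Suc m) g = (\<Sum>t\<in>keys c0. \<phi> (Suc m) (single (dq t) (lookup c0 t)))"
        by (simp only: g_def phi.hom_sum)
      from subsetD[OF keys_sum t[unfolded this]] obtain s where
        s: "s \<in> keys c0" "t \<in> keys (\<phi> (Suc m) (single (dq s) (lookup c0 s)))" by blast
      have "homogeneous (\<lambda>_. 1) (mon_weight (\<lambda>_. 1) (dq s)) (single (dq s) (lookup c0 s))"
        by (simp add: homogeneous_def)
      from homogeneous_phi[OF sS[OF s(1)] this] s(2)
      have "mon_weight (\<lambda>_. 1) t = q * mon_weight (\<lambda>_. 1) (dq s)" unfolding homogeneous_def by blast
      also have "\<dots> = mon_weight (\<lambda>_. 1) (mon_pow q (dq s))"
        using kdq[OF s(1)] finite_subset[OF kdq[OF s(1)]] q_gt_1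
        by (subst (1 2) mon_weight_superset[of "keys (dq s)"]) (auto simp: sum_distrib_left in_keys_iff)
      also have "\<dots> < Suc d" unfolding pdq[OF s(1)] using kc0[OF s(1)] Suc.prems(3) by blast
      finally show ?thesis .
    qed
    have "\<exists>n G. (\<forall>j. G j \<in> invariants m) \<and> c1 = (\<Sum>j<n. \<phi> (Suc m) (G j) * xM m ^ j)"
    proof (rule Suc.IH)
      have k: "keys t \<subseteq> insert ?x (V m)" if "t \<in> keys (c - \<phi> (Suc m) g)" for t
        using poly_ring_diff[OF Suc.prems(2) phi_ring] that unfolding poly_ring_def by blast
      show "c1 \<in> poly_ring (insert ?x (V m))"
        unfolding poly_ring_def
      proof (intro CollectI ballI)
        fix t assume "t \<in> keys c1"
        from k[OF kc1[OF this]] show "keys t \<subseteq> insert ?x (V m)" unfolding keys_add_nat by blast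
      qed
      show "mon_weight (\<lambda>_. 1) t < d" if t: "t \<in> keys c1" for t
      proof -
        have "t + single ?x 1 \<in> keys c \<union> keys (\<phi> (Suc m) g)"
          using kc1[OF t] by (rule rev_subsetD) (rule keys_diff)
        then have "mon_weight (\<lambda>_. 1) (t + single ?x 1) < Suc d" using Suc.prems(3) keys_phi by blast
        then show ?thesis by (simp add: mon_weight_add del: of_nat_Suc)
      qed
    qed (rule c1_inv)
    then obtain n G where G: "\<forall>j. G j \<in> invariants m" "c1 = (\<Sum>j<n. \<phi> (Suc m) (G j) * xM m ^ j)" by blast
    have "c = \<phi> (Suc m) g + xM m * c1" using c1 by (simp only: diff_eq_eq add.commute)
    also have "\<dots> = (\<Sum>j<Suc n. \<phi> (Suc m) (case j of 0 \<Rightarrow> g | Suc j \<Rightarrow> G j) * xM m ^ j)"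
      unfolding G(2) sum.lessThan_Suc_shift by (simp add: sum_distrib_left mult_ac del: of_nat_Suc)
    finally show ?case
      using G(1) gI by (intro exI[of _ "Suc n"] exI[of _ "case_nat g G"] conjI) (auto split: nat.splits)
  qed
  moreover have "mon_weight (\<lambda>_. 1) t < Suc (\<Sum>t\<in>keys c. mon_weight (\<lambda>_. 1) t)" if "t \<in> keys c" for t
    using member_le_sum[of t "keys c" "mon_weight (\<lambda>_. 1)"] that by simp
  ultimately show ?thesis using assms by blast
qed

section \<open>The span B\<close>

definition red_exps :: "nat \<Rightarrow> (nat \<Rightarrow>\<^sub>0 nat) set"
  where "red_exps m = {a. keys a \<subseteq> {1..2 * m} \<and> (\<forall>i. lookup a i < q)}"

definition gen_term :: "nat \<Rightarrow> (int, 'k) mpoly \<Rightarrow> nat \<Rightarrow> nat \<Rightarrow> (nat \<Rightarrow>\<^sub>0 nat) \<Rightarrow> (int, 'k) mpoly"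
  where "gen_term m g j t a = \<phi> (Suc m) g * xM m ^ j * Ny m ^ t * mon_val (\<xi> (Suc m)) a"

text \<open>Each triple (j, t, a) carries a single coefficient \<open>g (j, t, a)\<close>, so that
  independence can be applied to the coefficients one by one.\<close>

definition B :: "nat \<Rightarrow> (int, 'k) mpoly set"
  where "B m = {\<Sum>(j, t, a)\<in>I. gen_term m (g (j, t, a)) j t a | I g.
    finite I \<and> I \<subseteq> UNIV \<times> UNIV \<times> red_exps m \<and> (\<forall>i. g i \<in> invariants m)}"

lemma B_I:
  assumes "finite I" "I \<subseteq> UNIV \<times> UNIV \<times> red_exps m" "\<And>i. g i \<in> invariants m"
    "f = (\<Sum>(j, t, a)\<in>I. gen_term m (g (j, t, a)) j t a)"
  shows "f \<in> B m"
  unfolding B_def using assms by blast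

lemma B_E:
  assumes "f \<in> B m"
  obtains I g where "finite I" "I \<subseteq> UNIV \<times> UNIV \<times> red_exps m" "\<And>i. g i \<in> invariants m"
    "f = (\<Sum>(j, t, a)\<in>I. gen_term m (g (j, t, a)) j t a)"
  using assms unfolding B_def by blast

lemma gen_term_0 [simp]: "gen_term m 0 j t a = 0"
  by (simp add: gen_term_def)

lemma gen_term_add: "gen_term m (f + g) j t a = gen_term m f j t a + gen_term m g j t a"
  by (simp add: gen_term_def phi.hom_add distrib_right)

lemma B_0: "0 \<in> B m"
  by (rule B_I[of "{}" _ "\<lambda>_. 0"]) (simp_all add: invariants_0)

lemma B_add:
  assumes "f \<in> B m" "h \<in> B m"
  shows "f + h \<in> B m"
proof -
  obtain I1 g1 where 1: "finite I1" "I1 \<subseteq> UNIV \<times> UNIV \<times> red_exps m" "\<And>i. g1 i \<in> invariants m"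
    "f = (\<Sum>(j, t, a)\<in>I1. gen_term m (g1 (j, t, a)) j t a)" by (rule B_E[OF assms(1)]) (rule that)
  obtain I2 g2 where 2: "finite I2" "I2 \<subseteq> UNIV \<times> UNIV \<times> red_exps m" "\<And>i. g2 i \<in> invariants m"
    "h = (\<Sum>(j, t, a)\<in>I2. gen_term m (g2 (j, t, a)) j t a)" by (rule B_E[OF assms(2)]) (rule that)
  let ?g1 = "\<lambda>i. if i \<in> I1 then g1 i else 0" and ?g2 = "\<lambda>i. if i \<in> I2 then g2 i else 0"
  have "f = (\<Sum>(j, t, a)\<in>I1 \<union> I2. gen_term m (?g1 (j, t, a)) j t a)"
    unfolding 1(4) using 1(1) 2(1) by (intro sum.mono_neutral_cong_left) auto
  moreover have "h = (\<Sum>(j, t, a)\<in>I1 \<union> I2. gen_term m (?g2 (j, t, a)) j t a)"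
    unfolding 2(4) using 1(1) 2(1) by (intro sum.mono_neutral_cong_left) auto
  ultimately have "f + h = (\<Sum>(j, t, a)\<in>I1 \<union> I2. gen_term m (?g1 (j, t, a) + ?g2 (j, t, a)) j t a)"
    by (simp only: sum.distrib[symmetric]) (rule sum.cong[OF refl], simp only: gen_term_add split: prod.splits, simp)
  then show ?thesis using 1 2
    by (intro B_I[of "I1 \<union> I2" m "\<lambda>i. ?g1 i + ?g2 i"]) (auto intro: invariants_add simp: invariants_0)
qed

lemma B_sum: "(\<And>i. i \<in> A \<Longrightarrow> f i \<in> B m) \<Longrightarrow> sum f A \<in> B m"
  by (induction A rule: infinite_finite_induct) (simp_all add: B_0 B_add)

lemma B_gen_term: "g \<in> invariants m \<Longrightarrow> a \<in> red_exps m \<Longrightarrow> gen_term m g j t a \<in> B m"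
  by (rule B_I[of "{(j, t, a)}" m "\<lambda>_. g"]) simp_all

lemma B_mult_x: "f \<in> B m \<Longrightarrow> xM m ^ n * f \<in> B m"
proof -
  assume f: "f \<in> B m"
  obtain I g where I: "finite I" "I \<subseteq> UNIV \<times> UNIV \<times> red_exps m" "\<And>i. g i \<in> invariants m"
    "f = (\<Sum>(j, t, a)\<in>I. gen_term m (g (j, t, a)) j t a)" by (rule B_E[OF f]) (rule that)
  have "xM m ^ n * f = (\<Sum>(j, t, a)\<in>I. gen_term m (g (j, t, a)) (n + j) t a)"
    unfolding I(4) sum_distrib_left by (intro sum.cong refl) (auto simp: gen_term_def power_add mult_ac simp del: of_nat_Suc)
  also have "\<dots> \<in> B m" using I by (intro B_sum) (auto intro: B_gen_term)
  finally show ?thesis .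
qed

lemma digits_exist: "s < q ^ n \<Longrightarrow> \<exists>a. keys a \<subseteq> {1..n} \<and> (\<forall>i. lookup a i < q) \<and> (\<Sum>i = 1..n. lookup a i * q ^ (i - 1)) = s"
proof (induction n arbitrary: s)
  case 0
  then show ?case using q_gt_1 by (intro exI[of _ 0]) simp
next
  case (Suc n)
  have q0: "q ^ n > 0" using q_gt_1 by simp
  then have "s mod q ^ n < q ^ n" by simp
  from Suc.IH[OF this] obtain a where a: "keys a \<subseteq> {1..n}" "\<forall>i. lookup a i < q"
    "(\<Sum>i = 1..n. lookup a i * q ^ (i - 1)) = s mod q ^ n" by blast
  have d: "s div q ^ n < q" using Suc.prems by (intro less_mult_imp_div_less) simp
  have a0: "lookup a (Suc n) = 0" using a(1) by (auto simp: in_keys_iff subset_iff)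
  let ?a = "a + single (Suc n) (s div q ^ n)"
  have "keys ?a \<subseteq> {1..Suc n}" using a(1) by (auto simp: keys_add_nat split: if_splits)
  moreover have "\<forall>i. lookup ?a i < q" using a(2) a0 d by (simp add: lookup_add lookup_single when_def)
  moreover have "(\<Sum>i = 1..Suc n. lookup ?a i * q ^ (i - 1)) = s"
  proof -
    have "(\<Sum>i = 1..n. lookup ?a i * q ^ (i - 1)) = s mod q ^ n"
      unfolding a(3)[symmetric] by (intro sum.cong refl) (simp add: lookup_add lookup_single)
    then show ?thesis using a0 by (simp add: lookup_add lookup_single mod_mult_div_eq mult.commute)
  qed
  ultimately show ?case by blast
qed

text \<open>Records degree and leading coefficient in y; over a domain both are
  multiplicative.\<close>

definition LC :: "nat \<Rightarrow> nat \<Rightarrow> (int, 'k) mpoly \<Rightarrow> (int, 'k) mpoly \<Rightarrow> bool"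
  where "LC m d l f \<longleftrightarrow> Polynomial.degree (up (- int (Suc m)) f) = d \<and> lead_coeff (up (- int (Suc m)) f) = l \<and> l \<noteq> 0"

lemma LC_mult: "LC m d l f \<Longrightarrow> LC m d' l' g \<Longrightarrow> LC m (d + d') (l * l') (f * g)"
  unfolding LC_def by (auto simp: up.hom_mult degree_mult_eq coeff_degree_mult simp del: of_nat_Suc)

lemma LC_1: "LC m 0 1 1"
  by (simp add: LC_def)

lemma LC_power: "LC m d l f \<Longrightarrow> LC m (n * d) (l ^ n) (f ^ n)"
  by (induction n) (simp_all add: LC_1 LC_mult)

lemma LC_prod: "(\<And>i. i \<in> A \<Longrightarrow> LC m (d i) (l i) (f i)) \<Longrightarrow> LC m (sum d A) (prod l A) (prod f A)"
  by (induction A rule: infinite_finite_induct) (simp_all add: LC_1 LC_mult)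

lemma LC_\<xi>:
  assumes "i \<ge> 1"
  shows "LC m (q ^ (i - 1)) (xM m) (\<xi> (Suc m) i)"
proof -
  let ?y = "- int (Suc m)" and ?Q = "q ^ (i - 1)"
  have xf: "up ?y (xM m :: (int, 'k) mpoly) = [:xM m:]" by (rule up_free) (rule poly_ring_Var, simp)
  have \<xi>f: "up ?y (\<xi> m i :: (int, 'k) mpoly) = [:\<xi> m i:]"
  proof (rule up_free)
    have "V m \<subseteq> - {?y}" by (rule V_free)
    then show "\<xi> m i \<in> poly_ring (- {?y})" using \<xi>_S[of m i] unfolding S_def using poly_ring_mono by blast
  qed
  have yf: "up ?y (yM m :: (int, 'k) mpoly) = [:0, 1:]" by simp
  obtain r where r: "up ?y (\<xi> (Suc m) i :: (int, 'k) mpoly) = Polynomial.monom (xM m) ?Q + r" "Polynomial.degree r < ?Q"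
  proof (cases "i = 1")
    case True
    have "up ?y (\<xi> (Suc m) i) = Polynomial.monom (xM m) ?Q + [:\<xi> m i :: (int, 'k) mpoly:]"
      unfolding True \<xi>_1_Suc up.hom_add up.hom_mult xf yf \<xi>f[unfolded True]
      by (simp add: monom_Suc monom_0)
    then show ?thesis by (rule that) (simp add: True)
  next
    case False
    then have i2: "i \<ge> 2" using assms by simp
    have Q1: "?Q > 1" using i2 by (intro one_less_power q_gt_1) simp
    have "up ?y (\<xi> (Suc m) i) = Polynomial.monom (xM m) ?Q + [:\<xi> m i :: (int, 'k) mpoly, xM m ^ ?Q:]"
      unfolding \<xi>_Suc[OF i2] up.hom_add up.hom_mult up.hom_power xf yf \<xi>f
      by (simp add: monom_altdef mult.commute poly_const_pow)
    moreover have "Polynomial.degree [:\<xi> m i :: (int, 'k) mpoly, xM m ^ ?Q:] \<le> 1" by simp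
    ultimately show ?thesis using that Q1 by (meson order_le_less_trans)
  qed
  have dm: "Polynomial.degree (Polynomial.monom (xM m :: (int, 'k) mpoly) ?Q) = ?Q"
    by (rule degree_monom_eq[OF xM_neq_0])
  have deg: "Polynomial.degree (up ?y (\<xi> (Suc m) i :: (int, 'k) mpoly)) = ?Q"
    unfolding r(1) using r(2) dm by (subst degree_add_eq_left) simp_all
  have "coeff (Polynomial.monom (xM m) ?Q + r) ?Q = xM m"
    using coeff_eq_0[OF r(2)] by (simp only: coeff_add coeff_monom) simp
  then have "lead_coeff (up ?y (\<xi> (Suc m) i)) = (xM m :: (int, 'k) mpoly)" unfolding deg unfolding r(1) .
  then show ?thesis unfolding LC_def using deg xM_neq_0 by blast
qed

lemma LC_Ny: "LC m (q ^ (2 * m)) 1 (Ny m)"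
  unfolding LC_def using up_Ny by simp

lemma LC_mon_val_\<xi>:
  assumes "keys a \<subseteq> {1..2 * m}"
  shows "LC m (\<Sum>i = 1..2 * m. lookup a i * q ^ (i - 1)) (\<Prod>i = 1..2 * m. xM m ^ lookup a i) (mon_val (\<xi> (Suc m)) a)"
  unfolding mon_val_superset[OF finite_atLeastAtMost assms] by (intro LC_prod LC_power LC_\<xi>) simp

text \<open>The group maps y to y + b with b free of y and preserves the polynomials free of y, so
  the top coefficient in y is transformed without interference from the lower ones.\<close>

lemma leading_y_coeff_invariant:
  fixes f :: "(int, 'k) mpoly"
  assumes f: "f \<in> invariants (Suc m)"
  defines "c \<equiv> lead_coeff (up (- int (Suc m)) f)"
  shows "c \<in> invariants (Suc m)" "c \<in> poly_ring (insert (int (Suc m)) (V m))"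
proof -
  let ?y = "- int (Suc m)" and ?x = "int (Suc m)"
  let ?d = "Polynomial.degree (up ?y f)"
  have W: "V (Suc m) - {?y} = insert ?x (V m)" by auto
  have fS: "f \<in> poly_ring (V (Suc m))" using f unfolding invariants_iff S_def by (rule conjunct1)
  have ci: "coeff (up ?y f) i \<in> poly_ring (insert ?x (V m))" for i
    using coeff_up_ring[OF fS, of ?y i] unfolding W .
  show "c \<in> poly_ring (insert ?x (V m))" unfolding c_def by (rule ci)
  have sub: "insert ?x (V m) \<subseteq> - {?y}" by (rule xV_free)
  show "c \<in> invariants (Suc m)"
    unfolding invariants_iff
  proof (intro conjI ballI)
    from xV_subset[of m] show "c \<in> S (Suc m)" unfolding S_def c_def using ci poly_ring_mono by blast
    fix u :: "int \<Rightarrow> int \<Rightarrow> 'k" assume u: "u \<in> U (Suc m)"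
    let ?\<sigma> = "poly_subst (lin (Suc m) u) :: (int, 'k) mpoly \<Rightarrow> (int, 'k) mpoly"
    have \<sigma>free: "up ?y (?\<sigma> g) = [:?\<sigma> g:]" if g: "g \<in> poly_ring (insert ?x (V m))" for g
    proof (rule up_free, rule subsetD[OF poly_ring_mono[OF sub]], rule poly_ring_subst[OF g])
      fix v assume "v \<in> insert ?x (V m)"
      then consider "v = ?x" | "v \<in> V m" by blast
      then show "lin (Suc m) u v \<in> poly_ring (insert ?x (V m))"
      proof cases
        case 1
        then show ?thesis using lin_U_x[OF u] by (simp only:) (rule poly_ring_Var, simp)
      next
        case 2
        have "lin m u v \<in> poly_ring (insert ?x (V m))" using lin_ring poly_ring_mono[of "V m" "insert ?x (V m)"] by blast
        then show ?thesis unfolding lin_Suc_V[OF u 2]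
          by (intro poly_ring_add poly_ring_mult poly_ring_Const poly_ring_Var) simp_all
      qed
    qed
    define b where "b = lin m u ?y + Const (u ?y ?x) * xM m"
    have bf: "up ?y b = [:b:]"
    proof (rule up_free)
      have "V m \<subseteq> - {?y}" by (rule V_free)
      then have "lin m u ?y \<in> poly_ring (- {?y})" using lin_ring poly_ring_mono by blast
      then show "b \<in> poly_ring (- {?y})" unfolding b_def
        by (intro poly_ring_add poly_ring_mult poly_ring_Const poly_ring_Var) simp_all
    qed
    have \<sigma>y: "up ?y (?\<sigma> (Var ?y)) = [:b, 1:]"
      unfolding subst_Var lin_U_y[OF u] b_def[symmetric] up.hom_add bf by simp
    have "f = (\<Sum>i\<le>?d. coeff (up ?y f) i * Var ?y ^ i)"
      using poly_up_Var[of ?y f] unfolding poly_altdef by simp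
    then have "?\<sigma> f = (\<Sum>i\<le>?d. ?\<sigma> (coeff (up ?y f) i) * ?\<sigma> (Var ?y) ^ i)"
      by (metis (no_types, lifting) subst.hom_sum subst.hom_mult subst.hom_power sum.cong)
    moreover have "?\<sigma> f = f" using f u unfolding invariants_iff by blast
    ultimately have "up ?y f = (\<Sum>i\<le>?d. [:?\<sigma> (coeff (up ?y f) i):] * [:b, 1:] ^ i)"
      by (metis (no_types, lifting) up.hom_sum up.hom_mult up.hom_power sum.cong \<sigma>free[OF ci] \<sigma>y)
    then have "coeff (up ?y f) ?d = coeff (\<Sum>i\<le>?d. [:?\<sigma> (coeff (up ?y f) i):] * [:b, 1:] ^ i) ?d"
      by (rule arg_cong)
    also have "\<dots> = (\<Sum>i\<le>?d. ?\<sigma> (coeff (up ?y f) i) * coeff ([:b, 1:] ^ i) ?d)"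
      by (simp add: coeff_sum del: of_nat_Suc)
    also have "\<dots> = (\<Sum>i\<le>?d. if i = ?d then ?\<sigma> (coeff (up ?y f) i) else 0)"
    proof (intro sum.cong refl)
      fix i assume i: "i \<in> {..?d}"
      have deg: "Polynomial.degree ([:b, 1:] ^ i) = i" by (simp add: degree_power_eq)
      show "?\<sigma> (coeff (up ?y f) i) * coeff ([:b, 1:] ^ i) ?d = (if i = ?d then ?\<sigma> (coeff (up ?y f) i) else 0)"
      proof (cases "i = ?d")
        case True
        have "coeff ([:b, 1:] ^ i) i = lead_coeff ([:b, 1:] ^ i)" by (simp only: deg)
        also have "\<dots> = 1" by (simp add: lead_coeff_power)
        finally show ?thesis using True by simp
      next
        case False
        then have "coeff ([:b, 1:] ^ i) ?d = 0" using i by (intro coeff_eq_0) (simp add: deg)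
        then show ?thesis using False by simp
      qed
    qed
    finally show "?\<sigma> c = c" unfolding c_def by simp
  qed
qed

lemma x_power_multiple_in_B:
  fixes f :: "(int, 'k) mpoly"
  assumes "f \<in> invariants (Suc m)"
  shows "\<exists>J. xM m ^ J * f \<in> B m"
  using assms
proof (induction "Polynomial.degree (up (- int (Suc m)) f)" arbitrary: f rule: less_induct)
  case less
  let ?y = "- int (Suc m)"
  show ?case
  proof (cases "f = 0")
    case True
    then show ?thesis using B_0 by simp
  next
    case False
    define d where "d = Polynomial.degree (up ?y f)"
    define c where "c = lead_coeff (up ?y f)"
    have c: "c \<in> invariants (Suc m)" "c \<in> poly_ring (insert (int (Suc m)) (V m))"
      unfolding c_def by (rule leading_y_coeff_invariant[OF less.prems])+
    have c0: "c \<noteq> 0" unfolding c_def using False by (simp only: leading_coeff_neq_0 up_eq_0_iff not_False_eq_True)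
    obtain n G where G: "\<And>j. G j \<in> invariants m" "c = (\<Sum>j<n. \<phi> (Suc m) (G j) * xM m ^ j)"
      using y_free_invariant[OF c] by blast
    \<comment> \<open>Since \<xi>_i has y-degree q^(i-1) and N(y) has y-degree q^(2m), the degree
      \<open>d\<close> is realized by \<open>t\<close> factors N(y) and the base q digits of
      \<open>s\<close>.\<close>
    define s where "s = d mod q ^ (2 * m)"
    define t where "t = d div q ^ (2 * m)"
    have "s < q ^ (2 * m)" unfolding s_def using q_gt_1 by simp
    from digits_exist[OF this] obtain a where a: "keys a \<subseteq> {1..2 * m}" "\<forall>i. lookup a i < q"
      "(\<Sum>i = 1..2 * m. lookup a i * q ^ (i - 1)) = s" by blast
    \<comment> \<open>Each \<xi>_i has leading coefficient x in y, so the digit sum is the power of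
      x by which \<open>f\<close> has to be multiplied.\<close>
    define k where "k = (\<Sum>i = 1..2 * m. lookup a i)"
    define h where "h = mon_val (\<xi> (Suc m)) a * Ny m ^ t"
    have "LC m (s + t * q ^ (2 * m)) ((\<Prod>i = 1..2 * m. xM m ^ lookup a i) * 1 ^ t) h"
      unfolding h_def a(3)[symmetric] by (intro LC_mult LC_power LC_Ny LC_mon_val_\<xi> a(1))
    moreover have "s + t * q ^ (2 * m) = d" unfolding s_def t_def by (rule mod_div_mult_eq)
    moreover have "(\<Prod>i = 1..2 * m. xM m ^ lookup a i) * 1 ^ t = (xM m :: (int, 'k) mpoly) ^ k"
      unfolding k_def power_sum by simp
    ultimately have h: "LC m d (xM m ^ k) h" by simp
    have LCf: "LC m d c f" unfolding LC_def using c0 by (simp only: d_def c_def) simp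
    have free: "LC m 0 g g" if "g \<in> poly_ring (insert (int (Suc m)) (V m))" "g \<noteq> 0" for g
    proof -
      from xV_free[of m] have "up ?y g = [:g:]" using that(1) poly_ring_mono by (intro up_free) blast
      then show ?thesis unfolding LC_def using that(2) by simp
    qed
    have xk: "(xM m :: (int, 'k) mpoly) ^ k \<in> poly_ring (insert (int (Suc m)) (V m))"
      by (intro poly_ring_power poly_ring_Var) simp
    have 1: "LC m (0 + d) (xM m ^ k * c) (xM m ^ k * f)"
      using xM_neq_0 by (intro LC_mult[OF free[OF xk] LCf]) simp
    have 2: "LC m (0 + d) (c * xM m ^ k) (c * h)"
      by (rule LC_mult[OF free[OF c(2) c0] h])
    \<comment> \<open>The leading terms in y of the two products agree, so the difference is zero or
      of smaller y-degree.\<close>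
    define f' where "f' = xM m ^ k * f - c * h"
    have up': "up ?y f' = up ?y (xM m ^ k * f) - up ?y (c * h)" by (simp only: f'_def up.hom_minus)
    have dle: "Polynomial.degree (up ?y f') \<le> d"
      unfolding up' using 1 2 unfolding LC_def by (intro degree_diff_le) simp_all
    have "coeff (up ?y f') d = 0"
      unfolding up' coeff_diff using 1 2 unfolding LC_def add_0 by (metis diff_self mult.commute)
    then have small: "f' = 0 \<or> Polynomial.degree (up ?y f') < d"
      using dle by (metis leading_coeff_0_iff order_less_le up_eq_0_iff)
    have h_inv: "h \<in> invariants (Suc m)"
      unfolding h_def using a(1) by (intro invariants_mult invariants_power Ny_invariant invariants_mon_val \<xi>_invariant) auto
    have f'_inv: "f' \<in> invariants (Suc m)"
      unfolding f'_def by (intro invariants_diff invariants_mult invariants_power xM_invariant less.prems c(1) h_inv)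
    have ch: "c * h \<in> B m"
    proof -
      have "c * h = (\<Sum>j<n. gen_term m (G j) j t a)"
        unfolding G(2) sum_distrib_right h_def gen_term_def by (intro sum.cong refl) (simp only: mult_ac)
      also have "\<dots> \<in> B m" using a by (intro B_sum B_gen_term G(1)) (simp add: red_exps_def)
      finally show ?thesis .
    qed
    obtain J where J: "xM m ^ J * f' \<in> B m"
    proof (cases "f' = 0")
      case True
      then show ?thesis using that[of 0] B_0 by simp
    next
      case False
      then show ?thesis using less.hyps[OF _ f'_inv] small that unfolding d_def by blast
    qed
    have "xM m ^ (J + k) * f = xM m ^ J * f' + xM m ^ J * (c * h)"
      by (simp only: f'_def power_add right_diff_distrib mult.assoc diff_add_cancel)
    also have "\<dots> \<in> B m" by (intro B_add J B_mult_x ch)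
    finally show ?thesis by blast
  qed
qed

text \<open>The sum is the polynomial with coefficients \<open>w t\<close> composed with
  \<open>up v n\<close>, and composition with a polynomial of positive degree kills only 0.\<close>

lemma powers_independent:
  fixes w :: "nat \<Rightarrow> (int, 'k) mpoly"
  assumes "finite T" "\<And>t. t \<in> T \<Longrightarrow> w t \<in> poly_ring (- {v})" "Polynomial.degree (up v n) > 0"
    and "(\<Sum>t\<in>T. w t * n ^ t) = 0" "t \<in> T"
  shows "w t = 0"
proof -
  interpret pc: comm_ring_hom "\<lambda>p. pcompose p (up v n)" by (rule comm_ring_hom_pcompose)
  define W where "W = (\<Sum>t\<in>T. Polynomial.monom (w t) t)"
  have m: "Polynomial.monom a t = [:a:] * [:0, 1:] ^ t" for a :: "(int, 'k) mpoly" and t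
    by (simp add: monom_altdef)
  have "pcompose W (up v n) = (\<Sum>t\<in>T. [:w t:] * up v n ^ t)"
    unfolding W_def pc.hom_sum m pc.hom_mult pc.hom_power by (simp add: pcompose_pCons)
  also have "\<dots> = up v (\<Sum>t\<in>T. w t * n ^ t)"
    unfolding up.hom_sum up.hom_mult up.hom_power using assms(2) by (intro sum.cong refl) (simp add: up_free)
  finally have "pcompose W (up v n) = 0" by (simp add: assms(4))
  then have "W = 0" using assms(3) by (rule pcompose_eq_0)
  then have "coeff W t = 0" by simp
  then show ?thesis unfolding W_def coeff_sum coeff_monom using assms(1,5) by simp
qed

text \<open>Two independence results are stacked. At x = 0 only the terms with j = 0 remain. The
  powers of N(y) separate them by \<open>t\<close>, since their coefficients are free of y; for each
  \<open>t\<close> the monomials in the \<xi> are independent over the q-th powers to which \<phi>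
  reduces.\<close>

lemma B_saturated:
  assumes f: "f \<in> B m" and f0: "at0 m f = 0"
  shows "\<exists>g\<in>B m. f = xM m * g"
proof -
  let ?y = "- int (Suc m)"
  obtain I g where I: "finite I" "I \<subseteq> UNIV \<times> UNIV \<times> red_exps m" "\<And>i. g i \<in> invariants m"
    "f = (\<Sum>(j, t, a)\<in>I. gen_term m (g (j, t, a)) j t a)" by (rule B_E[OF f]) (rule that)
  define K where "K t = {a. (0, t, a) \<in> I}" for t
  define w where "w t = (\<Sum>a\<in>K t. g (0, t, a) ^ q * mon_val (\<xi> m) a)" for t
  define T where "T = (\<lambda>(j, t, a). t) ` I"
  have finT: "finite T" unfolding T_def using I(1) by simp
  have finK: "finite (K t)" for t
  proof -
    have "K t \<subseteq> (\<lambda>(j, t, a). a) ` I" unfolding K_def by force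
    then show ?thesis using I(1) by (simp add: finite_subset)
  qed
  have Kred: "keys a \<subseteq> {1..2 * m} \<and> (\<forall>i. lookup a i < q)" if "a \<in> K t" for a t
    using I(2) that unfolding K_def red_exps_def by blast
  have gS: "g i \<in> S m" for i using I(3)[of i] by (simp add: invariants_iff)
  have at0_\<xi>a: "at0 m (mon_val (\<xi> (Suc m)) a :: (int, 'k) mpoly) = mon_val (\<xi> m) a" if "a \<in> red_exps m" for a
    unfolding at0.hom_mon_val
  proof (rule mon_val_cong)
    fix v assume "v \<in> keys a"
    then have "v \<ge> 1" using that unfolding red_exps_def by fastforce
    then show "at0 m (\<xi> (Suc m) v) = (\<xi> m v :: (int, 'k) mpoly)" by (rule at0_\<xi>)
  qed
  have at0_gen: "at0 m (gen_term m (g i) j t a) = (if j = 0 then g i ^ q * mon_val (\<xi> m) a * at0 m (Ny m) ^ t else 0)"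
    if "a \<in> red_exps m" for i j t a
    unfolding gen_term_def at0.hom_mult at0.hom_power at0_phi[OF gS] at0_\<xi>a[OF that] at0_Var
    by (simp add: power_0_left mult_ac del: of_nat_Suc)
  have "(\<Sum>t\<in>T. w t * at0 m (Ny m) ^ t) = (\<Sum>(t, a)\<in>Sigma T K. g (0, t, a) ^ q * mon_val (\<xi> m) a * at0 m (Ny m) ^ t)"
    unfolding w_def sum_distrib_right using finT finK by (subst sum.Sigma) auto
  also have "\<dots> = (\<Sum>(j, t, a)\<in>(\<lambda>(t, a). (0, t, a)) ` Sigma T K. g (j, t, a) ^ q * mon_val (\<xi> m) a * at0 m (Ny m) ^ t)"
    by (subst sum.reindex) (auto simp: inj_on_def case_prod_beta)
  also have "\<dots> = (\<Sum>(j, t, a)\<in>I. at0 m (gen_term m (g (j, t, a)) j t a))"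
  proof (rule sum.mono_neutral_cong_left)
    show "(\<lambda>(t, a). (0, t, a)) ` Sigma T K \<subseteq> I" unfolding K_def by auto
    show "\<forall>i\<in>I - (\<lambda>(t, a). (0, t, a)) ` Sigma T K. (case i of (j, t, a) \<Rightarrow> at0 m (gen_term m (g (j, t, a)) j t a)) = 0"
    proof (intro ballI, clarify)
      fix j t a assume i: "(j, t, a) \<in> I" "(j, t, a) \<notin> (\<lambda>(t, a). (0, t, a)) ` Sigma T K"
      have "t \<in> T" unfolding T_def using i(1) by force
      have "j \<noteq> 0"
      proof
        assume j: "j = 0"
        then have "a \<in> K t" using i(1) by (simp add: K_def)
        then have "(j, t, a) \<in> (\<lambda>(t, a). (0, t, a)) ` Sigma T K" using j \<open>t \<in> T\<close> by (auto intro!: rev_image_eqI[of "(t, a)"])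
        then show False using i(2) by simp
      qed
      moreover have "a \<in> red_exps m" using i(1) I(2) by blast
      ultimately show "at0 m (gen_term m (g (j, t, a)) j t a) = 0" by (simp add: at0_gen)
    qed
    fix i :: "nat \<times> nat \<times> (nat \<Rightarrow>\<^sub>0 nat)" assume i: "i \<in> (\<lambda>(t, a). (0, t, a)) ` Sigma T K"
    then obtain t a where ta: "i = (0, t, a)" "a \<in> K t" by auto
    then have "a \<in> red_exps m" using Kred by (simp add: red_exps_def)
    then show "(case i of (j, t, a) \<Rightarrow> g (j, t, a) ^ q * mon_val (\<xi> m) a * at0 m (Ny m) ^ t) =
       (case i of (j, t, a) \<Rightarrow> at0 m (gen_term m (g (j, t, a)) j t a))"
      unfolding ta by (simp add: at0_gen)
  qed (rule I(1))
  also have "\<dots> = at0 m f" unfolding I(4) by (simp add: at0.hom_sum case_prod_beta)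
  finally have sum0: "(\<Sum>t\<in>T. w t * at0 m (Ny m) ^ t) = 0" by (simp only: f0)
  have wfree: "w t \<in> poly_ring (- {?y})" for t
  proof -
    have "V m \<subseteq> - {?y}" by (rule V_free)
    moreover have "w t \<in> poly_ring (V m)"
      unfolding w_def using gS \<xi>_S unfolding S_def
      by (intro poly_ring_sum poly_ring_mult poly_ring_power poly_ring_mon_val)
    ultimately show ?thesis using poly_ring_mono by blast
  qed
  have degN: "Polynomial.degree (up ?y (at0 m (Ny m))) > 0"
    unfolding up_Ny(3) using q_gt_1 by simp
  have g0: "g (0, t, a) = 0" if "(0, t, a) \<in> I" for t a
  proof -
    have "t \<in> T" unfolding T_def using that by force
    with powers_independent[OF finT wfree degN sum0] have "w t = 0" by blast
    then show ?thesis unfolding w_def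
      using \<xi>_independent[of "K t" m "\<lambda>a. g (0, t, a)" a] finK Kred that by (simp add: K_def)
  qed
  let ?h = "\<Sum>(j, t, a)\<in>I. if j = 0 then 0 else gen_term m (g (j, t, a)) (j - 1) t a"
  have "?h \<in> B m" using I by (intro B_sum) (auto intro!: B_gen_term B_0)
  moreover have "f = xM m * ?h"
    unfolding I(4) sum_distrib_left
  proof (intro sum.cong refl, clarify)
    fix j t a assume i: "(j, t, a) \<in> I"
    show "gen_term m (g (j, t, a)) j t a = xM m * (if j = 0 then 0 else gen_term m (g (j, t, a)) (j - 1) t a)"
    proof (cases j)
      case 0
      then show ?thesis using g0[of t a] i by simp
    next
      case (Suc j')
      then show ?thesis by (simp add: gen_term_def mult_ac del: of_nat_Suc)
    qed
  qed
  ultimately show ?thesis by blast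
qed

theorem invariants_Suc_subset_B: "f \<in> invariants (Suc m) \<Longrightarrow> f \<in> B m"
proof -
  assume f: "f \<in> invariants (Suc m)"
  obtain J where "xM m ^ J * f \<in> B m" using x_power_multiple_in_B[OF f] by blast
  then show "f \<in> B m"
  proof (induction J)
    case (Suc J)
    have "at0 m (xM m ^ Suc J * f) = 0" by (simp add: at0.hom_mult at0.hom_power at0_Var del: of_nat_Suc)
    from B_saturated[OF Suc.prems this] obtain g where g: "g \<in> B m" "xM m ^ Suc J * f = xM m * g" by blast
    then have "xM m * (xM m ^ J * f) = xM m * g" by (simp only: power_Suc mult.assoc)
    then have "xM m ^ J * f = g" using xM_neq_0[of m] by (simp only: mult_cancel_left) blast
    then show ?case using Suc.IH g(1) by simp
  qed simp
qed

end


section \<open>Generators, their leading monomials and their relations\<close>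

text \<open>The number of generators: rank \<open>m + 1\<close> adds x, N(y) and \<xi>_1, ...,
  \<xi>_2m to the images of the old ones.\<close>

abbreviation nvars :: "nat \<Rightarrow> nat"
  where "nvars m \<equiv> m * (m + 1)"

lemma nvars_Suc: "nvars (Suc m) = nvars m + 2 * m + 2"
  by simp

text \<open>The positions of the \<xi> of all levels, hence m(m - 1) relations; the difference from
  \<open>nvars m\<close> is 2m, the number of variables of the ring.\<close>

fun zvars :: "nat \<Rightarrow> nat list"
  where
    "zvars 0 = []"
  | "zvars (Suc m) = zvars m @ [nvars m + 2..<nvars m + 2 * m + 2]"

lemma zvars_less: "set (zvars m) \<subseteq> {..<nvars m}"
proof (induction m)
  case (Suc m)
  then show ?case unfolding nvars_Suc by auto
qed simp

lemma distinct_zvars: "distinct (zvars m)"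
proof (induction m)
  case (Suc m)
  then show ?case using zvars_less[of m] by auto
qed simp

definition shift :: "nat \<Rightarrow> (nat \<Rightarrow>\<^sub>0 nat) \<Rightarrow> (nat \<Rightarrow>\<^sub>0 nat)"
  where "shift m a = (\<Sum>i = 1..2 * m. single (nvars m + 1 + i) (lookup a i))"

text \<open>Exponents of a monomial in the generators of rank \<open>m + 1\<close>: \<open>t\<close>
  for the old ones, \<open>j\<close> for x, \<open>n\<close> for N(y) and \<open>a\<close> for the
  \<xi>, where \<xi>_i stands at position \<open>nvars m + 1 + i\<close>.\<close>

definition comb :: "nat \<Rightarrow> (nat \<Rightarrow>\<^sub>0 nat) \<Rightarrow> nat \<Rightarrow> nat \<Rightarrow> (nat \<Rightarrow>\<^sub>0 nat) \<Rightarrow> (nat \<Rightarrow>\<^sub>0 nat)"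
  where "comb m t j n a = t + single (nvars m) j + single (nvars m + 1) n + shift m a"

lemma lookup_shift:
  "lookup (shift m a) k = (if k \<in> {nvars m + 2..<nvars m + 2 * m + 2} then lookup a (k - nvars m - 1) else 0)"
proof -
  have "lookup (shift m a) k = (\<Sum>i = 1..2 * m. if i = k - nvars m - 1 \<and> nvars m + 1 < k then lookup a i else 0)"
    unfolding shift_def lookup_sum by (intro sum.cong refl) (auto simp: lookup_single when_def)
  also have "\<dots> = (if k - nvars m - 1 \<in> {1..2 * m} \<and> nvars m + 1 < k then lookup a (k - nvars m - 1) else 0)"
    by (cases "nvars m + 1 < k") simp_all
  finally show ?thesis by auto
qed

lemma comb_exists:
  assumes "keys t \<subseteq> {..<nvars (Suc m)}"
  obtains t' j n a where "t = comb m t' j n a" "keys t' \<subseteq> {..<nvars m}" "\<And>i. i < nvars m \<Longrightarrow> lookup t' i = lookup t i"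
    "keys a \<subseteq> {1..2 * m}" "\<And>i. i \<in> {1..2 * m} \<Longrightarrow> lookup a i = lookup t (nvars m + 1 + i)"
proof -
  define t' where "t' = Poly_Mapping.mapp (\<lambda>i n. n when i < nvars m) t"
  define a where "a = (\<Sum>i = 1..2 * m. single i (lookup t (nvars m + 1 + i)))"
  have lt': "lookup t' i = (lookup t i when i < nvars m)" for i
    by (auto simp: t'_def lookup_mapp when_def in_keys_iff)
  have la: "lookup a i = (if i \<in> {1..2 * m} then lookup t (nvars m + 1 + i) else 0)" for i
  proof -
    have "lookup a i = (\<Sum>j = 1..2 * m. if j = i then lookup t (nvars m + 1 + j) else 0)"
      unfolding a_def lookup_sum by (intro sum.cong refl) (auto simp: lookup_single when_def)
    then show ?thesis by simp
  qed
  show ?thesis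
  proof (rule that[of t' "lookup t (nvars m)" "lookup t (nvars m + 1)" a])
    show "t = comb m t' (lookup t (nvars m)) (lookup t (nvars m + 1)) a"
    proof (rule poly_mapping_eqI)
      fix k
      consider "k < nvars m" | "k = nvars m" | "k = nvars m + 1" | "k \<in> {nvars m + 2..<nvars m + 2 * m + 2}"
        | "k \<ge> nvars (Suc m)" unfolding nvars_Suc by fastforce
      then show "lookup t k = lookup (comb m t' (lookup t (nvars m)) (lookup t (nvars m + 1)) a) k"
      proof cases
        case 4
        then have "k - nvars m - 1 \<in> {1..2 * m}" "nvars m + 1 + (k - nvars m - 1) = k" by auto
        then have "lookup a (k - nvars m - 1) = lookup t k" by (simp only: la if_True)
        then show ?thesis using 4 by (simp add: comb_def lookup_add lookup_shift lt' lookup_single)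
      next
        case 5
        then have "lookup t k = 0" using assms by (auto simp: in_keys_iff subset_iff)
        then show ?thesis using 5 by (simp add: comb_def lookup_add lookup_shift lt' lookup_single)
      qed (simp_all add: comb_def lookup_add lookup_shift lt' lookup_single)
    qed
  qed (auto simp: lt' la in_keys_iff when_def split: if_splits)
qed

lemma keys_shift: "keys (shift m a) \<subseteq> {nvars m + 2..<nvars m + 2 * m + 2}"
  by (auto simp: in_keys_iff lookup_shift split: if_splits)

section \<open>Multiplicativity of lead terms, generated subalgebras\<close>

lemma lead_term_Const_mult:
  fixes f :: "('v::linorder, 'k::field) mpoly"
  assumes "LM f t" "c \<noteq> 0"
  shows "lead_term (Const c * f) = single t c"
proof -
  have "Max (keys (Const c * f)) = t"
    using assms by (intro Max_eqI) (auto simp: in_keys_iff lookup_Const_mult LM_def)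
  then show ?thesis using assms by (simp add: lead_term_def Let_def lookup_Const_mult LM_def)
qed

lemma LM_exists:
  fixes f :: "('v::linorder, 'k::field) mpoly"
  assumes "f \<noteq> 0"
  obtains c g t where "c \<noteq> 0" "f = Const c * g" "LM g t"
proof -
  define t where "t = Max (keys f)"
  have t: "t \<in> keys f" unfolding t_def using assms by (intro Max_in) auto
  then have c: "lookup f t \<noteq> 0" by (simp only: in_keys_iff not_False_eq_True)
  have "f = Const (lookup f t * inverse (lookup f t)) * f" using c by simp
  then have "f = Const (lookup f t) * (Const (inverse (lookup f t)) * f)"
    by (simp only: Const.hom_mult mult.assoc)
  moreover have "LM (Const (inverse (lookup f t)) * f) t"
    using c by (auto simp: LM_def lookup_Const_mult in_keys_iff t_def)
  ultimately show ?thesis using that c by blast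
qed

lemma lead_term_mult:
  fixes f g :: "('v::linorder, 'k::field) mpoly"
  shows "lead_term (f * g) = lead_term f * lead_term g"
proof (cases "f = 0 \<or> g = 0")
  case True
  then show ?thesis by (auto simp: lead_term_def Let_def)
next
  case False
  then have "f \<noteq> 0" "g \<noteq> 0" by auto
  obtain c f1 s where f: "c \<noteq> 0" "f = Const c * f1" "LM f1 s"
    by (rule LM_exists[OF \<open>f \<noteq> 0\<close>]) (rule that)
  obtain d g1 t where g: "d \<noteq> 0" "g = Const d * g1" "LM g1 t"
    by (rule LM_exists[OF \<open>g \<noteq> 0\<close>]) (rule that)
  have fg: "f * g = Const (c * d) * (f1 * g1)" by (simp only: f(2) g(2) Const.hom_mult mult_ac)
  have "lead_term (f * g) = single (s + t) (c * d)"
    unfolding fg by (rule lead_term_Const_mult[OF LM_mult[OF f(3) g(3)]]) (simp add: f(1) g(1))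
  moreover have "lead_term f = single s c" unfolding f(2) by (rule lead_term_Const_mult[OF f(3,1)])
  moreover have "lead_term g = single t d" unfolding g(2) by (rule lead_term_Const_mult[OF g(3,1)])
  ultimately show ?thesis by (simp add: mult_single)
qed

lemma lead_term_prod_list:
  "lead_term (prod_list fs) = prod_list (map lead_term fs)"
  for fs :: "('v::linorder, 'k::field) mpoly list"
proof (induction fs)
  case Nil
  then show ?case using LM_lead_term[OF LM_1, where ?'b = 'k] by simp
qed (simp add: lead_term_mult)

lemma subalgebra_alg_gen: "subalgebra (alg_gen B)"
  unfolding alg_gen_def subalgebra_def hull_def by blast

lemma alg_gen_superset: "B \<subseteq> alg_gen B"
  unfolding alg_gen_def by (rule hull_subset)

lemma alg_gen_minimal: "B \<subseteq> A \<Longrightarrow> subalgebra A \<Longrightarrow> alg_gen B \<subseteq> A"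
  unfolding alg_gen_def by (rule hull_minimal)

lemma alg_gen_mono: "B \<subseteq> C \<Longrightarrow> alg_gen B \<subseteq> alg_gen C"
  unfolding alg_gen_def by (rule hull_mono)

lemma subalgebra_0: "subalgebra A \<Longrightarrow> 0 \<in> A"
  unfolding subalgebra_def using Const.hom_zero by (metis rangeI subsetD)

lemma subalgebra_1: "subalgebra A \<Longrightarrow> 1 \<in> A"
  unfolding subalgebra_def using Const.hom_one by (metis rangeI subsetD)

lemma subalgebra_Const: "subalgebra A \<Longrightarrow> Const c \<in> A"
  unfolding subalgebra_def by blast

lemma subalgebra_mult: "subalgebra A \<Longrightarrow> f \<in> A \<Longrightarrow> g \<in> A \<Longrightarrow> f * g \<in> A"
  unfolding subalgebra_def by blast

lemma subalgebra_sum: "subalgebra A \<Longrightarrow> (\<And>i. i \<in> I \<Longrightarrow> f i \<in> A) \<Longrightarrow> sum f I \<in> A"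
proof (induction I rule: infinite_finite_induct)
  case (insert x F)
  then show ?case by (simp add: subalgebra_def)
qed (simp_all add: subalgebra_0)

lemma subalgebra_prod_list: "subalgebra A \<Longrightarrow> set fs \<subseteq> A \<Longrightarrow> prod_list fs \<in> A"
  by (induction fs) (simp_all add: subalgebra_1 subalgebra_mult)

lemma subalgebra_mon_val:
  fixes \<sigma> :: "'i \<Rightarrow> ('v, 'k::comm_ring_1) mpoly"
  shows "subalgebra A \<Longrightarrow> (\<And>v. v \<in> keys t \<Longrightarrow> \<sigma> v \<in> A) \<Longrightarrow> mon_val \<sigma> t \<in> A"
proof -
  assume A: "subalgebra A" and \<sigma>: "\<And>v. v \<in> keys t \<Longrightarrow> \<sigma> v \<in> A"
  have pow: "f ^ n \<in> A" if "f \<in> A" for f n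
    using that A by (induction n) (simp_all add: subalgebra_1 subalgebra_mult)
  have prd: "prod h I \<in> A" if "\<And>i. i \<in> I \<Longrightarrow> h i \<in> A" for h and I :: "'i set"
    using that A by (induction I rule: infinite_finite_induct) (simp_all add: subalgebra_1 subalgebra_mult)
  show ?thesis unfolding mon_val_def by (intro prd pow \<sigma>)
qed

context finite_field_char
begin

section \<open>Generators, degrees and reduced monomials\<close>

primrec gen :: "nat \<Rightarrow> nat \<Rightarrow> (int, 'k) mpoly"
  where
    "gen 0 = (\<lambda>i. 0)"
  | "gen (Suc m) = (\<lambda>i. if i < nvars m then \<phi> (Suc m) (gen m i) else if i = nvars m then xM m
      else if i = nvars m + 1 then Ny m else \<xi> (Suc m) (i - nvars m - 1))"

text \<open>In the last case position \<open>i\<close> holds \<xi>_k with k = i - nvars m - 1, of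
  degree q^(k-1) + 1; this explains the offset 2.\<close>

primrec gdeg :: "nat \<Rightarrow> nat \<Rightarrow> nat"
  where
    "gdeg 0 = (\<lambda>i. 0)"
  | "gdeg (Suc m) = (\<lambda>i. if i < nvars m then q * gdeg m i else if i = nvars m then 1
      else if i = nvars m + 1 then q ^ (2 * m) else q ^ (i - nvars m - 2) + 1)"

text \<open>The degree times the level of a variable, where the elements of \<open>H0\<close> have level 0. Modulo
  \<open>H0\<close>, the \<open>q\<close>-th power of a generator of some level only involves lower levels.\<close>

primrec gweight :: "nat \<Rightarrow> nat \<Rightarrow> nat"
  where
    "gweight 0 = (\<lambda>i. 0)"
  | "gweight (Suc m) = (\<lambda>i. if i < nvars m then q * gweight m i else if i \<le> nvars m + 1 then 0
      else Suc m * gdeg (Suc m) i)"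

lemma gen_invariant: "i < nvars m \<Longrightarrow> gen m i \<in> invariants m"
proof (induction m arbitrary: i)
  case (Suc m)
  then show ?case
    by (auto intro: phi_invariants xM_invariant Ny_invariant \<xi>_invariant simp del: of_nat_Suc)
qed simp

lemma gen_S: "i < nvars m \<Longrightarrow> gen m i \<in> S m"
  using gen_invariant by (simp add: invariants_iff)

lemma homogeneous_gen: "i < nvars m \<Longrightarrow> homogeneous (\<lambda>_. 1) (gdeg m i) (gen m i)"
proof (induction m arbitrary: i)
  case (Suc m)
  consider "i < nvars m" | "i = nvars m" | "i = nvars m + 1" | "i \<ge> nvars m + 2" by linarith
  then show ?case
  proof cases
    case 1
    then show ?thesis using homogeneous_phi[OF gen_S Suc.IH] by simp
  next
    case 2
    then show ?thesis using homogeneous_Var[of "\<lambda>_. 1" "int (Suc m)"] by (simp del: of_nat_Suc)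
  next
    case 3
    then show ?thesis using homogeneous_Ny by simp
  next
    case 4
    then show ?thesis using homogeneous_\<xi>[of "i - nvars m - 1" "Suc m"] by (simp add: numeral_2_eq_2)
  qed
qed simp

lemma gdeg_pos: "i < nvars m \<Longrightarrow> gdeg m i > 0"
proof (induction m arbitrary: i)
  case (Suc m)
  then show ?case using q_gt_1 by auto
qed simp

text \<open>Levels do not exceed the rank, and \<phi> multiplies weight and degree by the same
  factor.\<close>

lemma gweight_le: "gweight m i \<le> m * gdeg m i"
proof (induction m arbitrary: i)
  case (Suc m)
  have "q * gweight m i \<le> q * (m * gdeg m i)" using Suc.IH by simp
  also have "\<dots> \<le> Suc m * (q * gdeg m i)" by simp
  finally show ?case by (auto simp del: mult_Suc)
qed simp

definition red :: "nat \<Rightarrow> (nat \<Rightarrow>\<^sub>0 nat) set"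
  where "red m = {t. keys t \<subseteq> {..<nvars m} \<and> (\<forall>s\<in>set (zvars m). lookup t s < q)}"

lemma comb_red:
  assumes t: "t \<in> red m" and a: "a \<in> red_exps m"
  shows "comb m t j n a \<in> red (Suc m)"
  unfolding red_def
proof (intro CollectI conjI ballI)
  have kt: "keys t \<subseteq> {..<nvars m}" using t by (simp add: red_def)
  show "keys (comb m t j n a) \<subseteq> {..<nvars (Suc m)}"
    using kt keys_shift[of m a] unfolding comb_def keys_add_nat nvars_Suc by (fastforce split: if_splits)
  fix s assume "s \<in> set (zvars (Suc m))"
  then consider "s \<in> set (zvars m)" | "s \<in> {nvars m + 2..<nvars m + 2 * m + 2}" by auto
  then show "lookup (comb m t j n a) s < q"
  proof cases
    case 1
    then have "s < nvars m" using zvars_less by blast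
    then have "lookup (comb m t j n a) s = lookup t s"
      by (simp add: comb_def lookup_add lookup_shift lookup_single)
    then show ?thesis using t 1 by (simp add: red_def)
  next
    case 2
    then have "lookup t s = 0" using kt by (auto simp: in_keys_iff subset_iff)
    then have "lookup (comb m t j n a) s = lookup a (s - nvars m - 1)"
      using 2 by (simp add: comb_def lookup_add lookup_shift lookup_single)
    then show ?thesis using a by (simp add: red_exps_def)
  qed
qed

lemma red_comb:
  assumes "t \<in> red (Suc m)"
  obtains t' j n a where "t = comb m t' j n a" "t' \<in> red m" "a \<in> red_exps m"
proof -
  have k: "keys t \<subseteq> {..<nvars (Suc m)}" and lt: "\<And>s. s \<in> set (zvars (Suc m)) \<Longrightarrow> lookup t s < q"
    using assms unfolding red_def by blast+
  obtain t' j n a where c: "t = comb m t' j n a" "keys t' \<subseteq> {..<nvars m}" "\<And>i. i < nvars m \<Longrightarrow> lookup t' i = lookup t i"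
    "keys a \<subseteq> {1..2 * m}" "\<And>i. i \<in> {1..2 * m} \<Longrightarrow> lookup a i = lookup t (nvars m + 1 + i)"
    by (rule comb_exists[OF k]) (rule that)
  have "lookup t' s < q" if s: "s \<in> set (zvars m)" for s
  proof -
    have "s < nvars m" using s zvars_less by blast
    then have "lookup t' s = lookup t s" by (rule c(3))
    also have "\<dots> < q" using s by (intro lt) simp
    finally show ?thesis .
  qed
  then have "t' \<in> red m" using c(2) by (simp add: red_def)
  moreover have "lookup a i < q" for i
  proof (cases "i \<in> {1..2 * m}")
    case True
    then have "lookup a i = lookup t (nvars m + 1 + i)" by (rule c(5))
    also have "\<dots> < q" using True by (intro lt) auto
    finally show ?thesis .
  next
    case False
    then have "i \<notin> keys a" using c(4) by blast
    then show ?thesis using q_gt_1 by (simp add: in_keys_iff)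
  qed
  then have "a \<in> red_exps m" using c(4) by (simp add: red_exps_def)
  ultimately show ?thesis using that c(1) by blast
qed

lemma mon_val_gen_comb:
  assumes "keys t \<subseteq> {..<nvars m}"  "keys a \<subseteq> {1..2 * m}"
  shows "mon_val (gen (Suc m)) (comb m t j n a) = gen_term m (mon_val (gen m) t) j n a"
proof -
  have 1: "mon_val (gen (Suc m)) t = \<phi> (Suc m) (mon_val (gen m) t)"
    unfolding phi.hom_mon_val using assms(1) by (intro mon_val_cong) auto
  have "mon_val (gen (Suc m)) (sum h I) = (\<Prod>i\<in>I. mon_val (gen (Suc m)) (h i))" for h and I :: "nat set"
    by (induction I rule: infinite_finite_induct) (simp_all add: mon_val_add del: gen.simps)
  then have "mon_val (gen (Suc m)) (shift m a) = (\<Prod>i = 1..2 * m. \<xi> (Suc m) i ^ lookup a i)"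
    unfolding shift_def by (simp only: mon_val_single) (intro prod.cong refl, simp)
  also have "\<dots> = mon_val (\<xi> (Suc m)) a"
    by (rule mon_val_superset[symmetric, OF finite_atLeastAtMost assms(2)])
  finally have 2: "mon_val (gen (Suc m)) (shift m a) = mon_val (\<xi> (Suc m)) a" .
  show ?thesis unfolding comb_def mon_val_add mon_val_single 1 2 gen_term_def by (simp del: of_nat_Suc)
qed

lemma mon_val_gen_S: "t \<in> red m \<Longrightarrow> mon_val (gen m) t \<in> S m"
  unfolding S_def using gen_S unfolding S_def red_def by (intro poly_ring_mon_val) auto

subsection \<open>Reduced monomials span\<close>

definition span_red :: "nat \<Rightarrow> (int, 'k) mpoly set"
  where "span_red m = {poly_subst (gen m) u | u. keys u \<subseteq> red m}"

lemma span_red_add: "f \<in> span_red m \<Longrightarrow> g \<in> span_red m \<Longrightarrow> f + g \<in> span_red m"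
proof -
  assume "f \<in> span_red m" "g \<in> span_red m"
  then obtain u v where uv: "f = poly_subst (gen m) u" "keys u \<subseteq> red m" "g = poly_subst (gen m) v" "keys v \<subseteq> red m"
    unfolding span_red_def by blast
  have "keys (u + v) \<subseteq> red m" using keys_add[of u v] uv by blast
  moreover have "f + g = poly_subst (gen m) (u + v)" by (simp only: uv subst.hom_add)
  ultimately show ?thesis unfolding span_red_def by blast
qed

lemma span_red_0: "0 \<in> span_red m"
  unfolding span_red_def by (intro CollectI exI[of _ 0]) simp

lemma span_red_sum: "(\<And>i. i \<in> I \<Longrightarrow> f i \<in> span_red m) \<Longrightarrow> sum f I \<in> span_red m"
  by (induction I rule: infinite_finite_induct) (simp_all add: span_red_0 span_red_add)

lemma span_red_mon: "t \<in> red m \<Longrightarrow> Const c * mon_val (gen m) t \<in> span_red m"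
  unfolding span_red_def by (intro CollectI exI[of _ "single t c"]) (simp add: subst_single)

text \<open>Iterates the description by \<open>B\<close>: the coefficients under \<phi> are
  invariants of the previous rank, to which the induction hypothesis applies. In rank 0 only
  constants remain.\<close>

lemma invariants_span: "f \<in> invariants m \<Longrightarrow> f \<in> span_red m"
proof (induction m arbitrary: f)
  case 0
  then have "keys f \<subseteq> {0}" by (auto simp: invariants_iff S_def poly_ring_def)
  then have "f = Const (lookup f 0) * mon_val (gen 0) 0"
    by (intro poly_mapping_eqI) (auto simp: Const_def lookup_single when_def in_keys_iff)
  moreover have "0 \<in> red 0" by (simp add: red_def)
  ultimately show ?case using span_red_mon[of 0 0 "lookup f 0"] by metis
next
  case (Suc m)
  obtain I g where I: "finite I" "I \<subseteq> UNIV \<times> UNIV \<times> red_exps m" "\<And>i. g i \<in> invariants m"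
    "f = (\<Sum>(j, t, a)\<in>I. gen_term m (g (j, t, a)) j t a)"
    by (rule B_E[OF invariants_Suc_subset_B[OF Suc.prems]]) (rule that)
  have "gen_term m h j n a \<in> span_red (Suc m)" if h: "h \<in> invariants m" and a: "a \<in> red_exps m" for h j n a
  proof -
    obtain u where u: "h = poly_subst (gen m) u" "keys u \<subseteq> red m"
      using Suc.IH[OF h] unfolding span_red_def by blast
    have ka: "keys a \<subseteq> {1..2 * m}" using a by (simp add: red_exps_def)
    have "gen_term m h j n a = (\<Sum>t\<in>keys u. Const (lookup u t) * gen_term m (mon_val (gen m) t) j n a)"
      unfolding u(1) subst_eq_sum gen_term_def phi.hom_sum phi.hom_mult phi_Const sum_distrib_right by (simp only: mult.assoc)
    also have "\<dots> = (\<Sum>t\<in>keys u. Const (lookup u t) * mon_val (gen (Suc m)) (comb m t j n a))"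
      using u(2) by (intro sum.cong refl arg_cong2[of _ _ _ _ "(*)"] mon_val_gen_comb[symmetric] ka) (auto simp: red_def)
    also have "\<dots> \<in> span_red (Suc m)"
      using u(2) by (intro span_red_sum span_red_mon comb_red a) blast
    finally show ?thesis .
  qed
  then show ?case unfolding I(4) using I(2,3) by (intro span_red_sum) auto
qed

subsection \<open>Leading monomials of reduced monomials\<close>

lemma digits_less: "(\<And>i. lookup a i < q) \<Longrightarrow> (\<Sum>i = 1..n. lookup a i * q ^ (i - 1)) < q ^ n"
proof (induction n)
  case (Suc n)
  have "lookup a (Suc n) \<le> q - 1" using Suc.prems[of "Suc n"] by simp
  then have "lookup a (Suc n) * q ^ n \<le> (q - 1) * q ^ n" by (rule mult_le_mono1)
  with Suc.IH[OF Suc.prems] have "(\<Sum>i = 1..n. lookup a i * q ^ (i - 1)) + lookup a (Suc n) * q ^ n < q ^ n + (q - 1) * q ^ n"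
    by (rule add_less_le_mono)
  then have "(\<Sum>i = 1..Suc n. lookup a i * q ^ (i - 1)) < q ^ n + (q - 1) * q ^ n"
    by (simp only: sum.cl_ivl_Suc) simp
  also have "\<dots> = q ^ Suc n" using q_gt_1 by (simp add: algebra_simps)
  finally show ?case .
qed simp

lemma digits_unique:
  assumes "\<And>i. lookup a i < q" "\<And>i. lookup b i < q"
    "(\<Sum>i = 1..n. lookup a i * q ^ (i - 1)) = (\<Sum>i = 1..n. lookup b i * q ^ (i - 1))" "i \<in> {1..n}"
  shows "lookup a i = lookup b i"
  using assms(3,4)
proof (induction n)
  case (Suc n)
  define x where "x = (\<Sum>i = 1..n. lookup a i * q ^ (i - 1))"
  define y where "y = (\<Sum>i = 1..n. lookup b i * q ^ (i - 1))"
  have xy: "x < q ^ n" "y < q ^ n" unfolding x_def y_def by (intro digits_less assms)+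
  have "x + lookup a (Suc n) * q ^ n = y + lookup b (Suc n) * q ^ n"
    using Suc.prems(1) by (simp add: x_def y_def)
  then have "(x + lookup a (Suc n) * q ^ n) div q ^ n = (y + lookup b (Suc n) * q ^ n) div q ^ n"
    "(x + lookup a (Suc n) * q ^ n) mod q ^ n = (y + lookup b (Suc n) * q ^ n) mod q ^ n" by simp_all
  then have "lookup a (Suc n) = lookup b (Suc n)" "x = y" using xy q_gt_1 by simp_all
  then show ?case using Suc unfolding x_def y_def by (cases "i = Suc n") auto
qed simp

lemma LM_unique: "LM f s \<Longrightarrow> LM f t \<Longrightarrow> s = t"
  unfolding LM_def by (metis antisym in_keys_iff one_neq_zero)

lemma LM_gen_term:
  assumes f: "f \<in> S m" "LM f u" and a: "a \<in> red_exps m"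
  shows "LM (gen_term m f j n a) (mon_pow q u + single (int (Suc m)) (j + (\<Sum>i = 1..2 * m. lookup a i))
    + single (- int (Suc m)) (n * q ^ (2 * m) + (\<Sum>i = 1..2 * m. lookup a i * q ^ (i - 1))))"
proof -
  let ?x = "int (Suc m)" and ?y = "- int (Suc m)"
  have ka: "keys a \<subseteq> {1..2 * m}" using a by (simp add: red_exps_def)
  have "LM (mon_val (\<xi> (Suc m)) a :: (int, 'k) mpoly) (\<Sum>i = 1..2 * m. mon_pow (lookup a i) (single ?y (q ^ (i - 1)) + single ?x 1))"
    unfolding mon_val_superset[OF finite_atLeastAtMost ka] by (intro LM_prod LM_power LM_\<xi>) simp
  then have "LM (gen_term m f j n a) (mon_pow q u + mon_pow j (single ?x 1) + mon_pow n (single ?y (q ^ (2 * m)))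
      + (\<Sum>i = 1..2 * m. mon_pow (lookup a i) (single ?y (q ^ (i - 1)) + single ?x 1)))"
    unfolding gen_term_def by (intro LM_mult LM_phi LM_power LM_Var LM_Ny f)
  also have "mon_pow q u + mon_pow j (single ?x 1) + mon_pow n (single ?y (q ^ (2 * m)))
      + (\<Sum>i = 1..2 * m. mon_pow (lookup a i) (single ?y (q ^ (i - 1)) + single ?x 1)) =
      mon_pow q u + single ?x (j + (\<Sum>i = 1..2 * m. lookup a i))
        + single ?y (n * q ^ (2 * m) + (\<Sum>i = 1..2 * m. lookup a i * q ^ (i - 1)))"
    using V_Suc_notin(3)[of m]
    by (intro poly_mapping_eqI) (auto simp: lookup_add lookup_sum lookup_single when_def simp del: of_nat_Suc)
  finally show ?thesis .
qed

text \<open>All exponents can be recovered from the leading monomial. The exponent of y has quotient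
  \<open>n\<close> and remainder with digits \<open>a\<close> modulo q^(2m); then the exponent of x
  gives \<open>j\<close>; what is left is the q-th power of a leading monomial of rank
  \<open>m\<close>, to which the induction hypothesis applies.\<close>

lemma LM_red:
  assumes "t \<in> red m"
  shows "\<exists>u. LM (mon_val (gen m) t) u \<and> keys u \<subseteq> V m \<and>
    (\<forall>t'\<in>red m. LM (mon_val (gen m) t') u \<longrightarrow> t' = t)"
  using assms
proof (induction m arbitrary: t)
  case 0
  have "t = 0" if "t \<in> red 0" for t using that by (simp add: red_def)
  moreover from this 0 have "t = 0" .
  ultimately show ?case by (intro exI[of _ 0]) (simp add: LM_1)
next
  case (Suc m)
  let ?x = "int (Suc m)" and ?y = "- int (Suc m)"
  let ?s = "\<lambda>a. \<Sum>i = 1..2 * m. lookup a i * q ^ (i - 1)"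
  let ?lm = "\<lambda>u j n a. mon_pow q u + single ?x (j + (\<Sum>i = 1..2 * m. lookup a i)) + single ?y (n * q ^ (2 * m) + ?s a)"
  have LMc: "LM (mon_val (gen (Suc m)) (comb m t j n a)) (?lm u j n a)"
    if "t \<in> red m" "a \<in> red_exps m" "LM (mon_val (gen m) t) u" for t j n a u
  proof -
    have k: "keys t \<subseteq> {..<nvars m}" "keys a \<subseteq> {1..2 * m}" using that(1,2) unfolding red_def red_exps_def by blast+
    show ?thesis unfolding mon_val_gen_comb[OF k] by (intro LM_gen_term[OF mon_val_gen_S[OF that(1)] that(3,2)])
  qed
  obtain t1 j n a where t: "t = comb m t1 j n a" "t1 \<in> red m" "a \<in> red_exps m"
    by (rule red_comb[OF Suc.prems]) (rule that)
  obtain u where u: "LM (mon_val (gen m) t1) u" "keys u \<subseteq> V m"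
    "\<And>t'. t' \<in> red m \<Longrightarrow> LM (mon_val (gen m) t') u \<Longrightarrow> t' = t1"
    using Suc.IH[OF t(2)] by blast
  have ky: "lookup v ?y = 0" "lookup v ?x = 0" if "keys v \<subseteq> V m" for v
    using that V_Suc_notin[of m] by (metis in_keys_iff subsetD)+
  show ?case
  proof (intro exI[of _ "?lm u j n a"] conjI ballI impI)
    show "LM (mon_val (gen (Suc m)) t) (?lm u j n a)" unfolding t(1) by (rule LMc[OF t(2,3) u(1)])
    have "mon_pow q u \<in> {w. keys w \<subseteq> V m}" using u(2) by (auto simp: in_keys_iff subset_iff)
    then show "keys (?lm u j n a) \<subseteq> V (Suc m)"
      unfolding keys_add_nat using V_SucI(1)[of _ m] V_SucI(2,3)[of m] by (auto split: if_splits)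
    fix t' assume "t' \<in> red (Suc m)" and LM': "LM (mon_val (gen (Suc m)) t') (?lm u j n a)"
    then obtain t1' j' n' a' where t': "t' = comb m t1' j' n' a'" "t1' \<in> red m" "a' \<in> red_exps m"
      by (elim red_comb) blast
    obtain u' where u': "LM (mon_val (gen m) t1') u'" "keys u' \<subseteq> V m" using Suc.IH[OF t'(2)] by blast
    have eq: "?lm u' j' n' a' = ?lm u j n a"
      using LM_unique[OF LMc[OF t'(2,3) u'(1)] LM'[unfolded t'(1)]] .
    have digits: "\<And>i. lookup a i < q" "\<And>i. lookup a' i < q" using t(3) t'(3) by (auto simp: red_exps_def)
    have "n' * q ^ (2 * m) + ?s a' = n * q ^ (2 * m) + ?s a"
      using arg_cong[OF eq, of "\<lambda>w. lookup w ?y"] ky[OF u(2)] ky[OF u'(2)] V_Suc_notin(3)[of m]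
      by (simp add: lookup_add lookup_single del: of_nat_Suc)
    then have "(?s a' + n' * q ^ (2 * m)) div q ^ (2 * m) = (?s a + n * q ^ (2 * m)) div q ^ (2 * m)"
      "(?s a' + n' * q ^ (2 * m)) mod q ^ (2 * m) = (?s a + n * q ^ (2 * m)) mod q ^ (2 * m)"
      by (simp_all only: add.commute)
    moreover have "?s a < q ^ (2 * m)" "?s a' < q ^ (2 * m)" by (intro digits_less digits)+
    ultimately have nn: "n' = n" "?s a' = ?s a" using q_gt_1 by simp_all
    have aa: "a' = a"
    proof (rule poly_mapping_eqI)
      fix i show "lookup a' i = lookup a i"
      proof (cases "i \<in> {1..2 * m}")
        case True
        then show ?thesis by (rule digits_unique[OF digits(2,1) nn(2)])
      next
        case False
        then have "i \<notin> keys a" "i \<notin> keys a'" using t(3) t'(3) unfolding red_exps_def by blast+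
        then show ?thesis by (simp add: in_keys_iff)
      qed
    qed
    have jj: "j' = j"
      using arg_cong[OF eq, of "\<lambda>w. lookup w ?x"] ky[OF u(2)] ky[OF u'(2)] V_Suc_notin(3)[of m]
      by (simp add: lookup_add lookup_single aa del: of_nat_Suc)
    have "mon_pow q u' = mon_pow q u" using eq unfolding nn(1) aa jj by (simp only: add_right_cancel)
    then have "u' = u" using q_gt_1 by (intro poly_mapping_eqI) (metis lookup_mon_pow mult_cancel1 not_less_zero)
    then have "t1' = t1" using u(3)[OF t'(2)] u'(1) by simp
    then show "t' = t" unfolding t(1) t'(1) using nn(1) aa jj by simp
  qed
qed

definition lmon :: "nat \<Rightarrow> (nat \<Rightarrow>\<^sub>0 nat) \<Rightarrow> (int \<Rightarrow>\<^sub>0 nat)"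
  where "lmon m t = (SOME u. LM (mon_val (gen m) t) u)"

lemma LM_lmon: "t \<in> red m \<Longrightarrow> LM (mon_val (gen m) t) (lmon m t)"
  unfolding lmon_def using LM_red by (metis someI_ex)

lemma inj_lmon: "inj_on (lmon m) (red m)"
proof (rule inj_onI)
  fix s t assume st: "s \<in> red m" "t \<in> red m" "lmon m s = lmon m t"
  obtain u where u: "LM (mon_val (gen m) t) u" "\<And>t'. t' \<in> red m \<Longrightarrow> LM (mon_val (gen m) t') u \<Longrightarrow> t' = t"
    using LM_red[OF st(2)] by blast
  have "u = lmon m t" by (rule LM_unique[OF u(1) LM_lmon[OF st(2)]])
  then show "s = t" using u(2)[OF st(1)] LM_lmon[OF st(1)] st(3) by simp
qed

text \<open>Serves twice: the non-vanishing determines the ideal of relations, the lead term gives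
  the Khovanskii basis.\<close>

lemma lead_term_reduced:
  assumes "keys u \<subseteq> red m" "u \<noteq> 0"
  obtains t where "t \<in> keys u" "lead_term (poly_subst (gen m) u) = single (lmon m t) (lookup u t)"
    "poly_subst (gen m) u \<noteq> 0"
proof (rule lead_term_sum[of "keys u" "mon_val (gen m)" "lmon m" "lookup u"])
  show "LM (mon_val (gen m) t) (lmon m t)" if "t \<in> keys u" for t using assms(1) that by (intro LM_lmon) blast
  show "inj_on (lmon m) (keys u)" by (rule inj_on_subset[OF inj_lmon assms(1)])
qed (use assms that in \<open>auto simp: subst_eq_sum in_keys_iff\<close>)

subsection \<open>Relations\<close>

lemma red_Suc: "red m \<subseteq> red (Suc m)"
proof
  fix t assume t: "t \<in> red m"
  have "0 \<in> red_exps m" using q_gt_1 by (simp add: red_exps_def)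
  from comb_red[OF t this, of 0 0] show "t \<in> red (Suc m)" by (simp add: comb_def shift_def)
qed

lemma mon_weight_old:
  assumes "keys t \<subseteq> {..<nvars m}"
  shows "mon_weight (gdeg (Suc m)) t = q * mon_weight (gdeg m) t"
    and "mon_weight (gweight (Suc m)) t = q * mon_weight (gweight m) t"
proof -
  have "\<forall>i\<in>keys t. i < nvars m" using assms by blast
  then show "mon_weight (gdeg (Suc m)) t = q * mon_weight (gdeg m) t"
    "mon_weight (gweight (Suc m)) t = q * mon_weight (gweight m) t"
    unfolding mon_weight_def sum_distrib_left by (auto intro!: sum.cong)
qed

lemma mon_weight_gweight_le: "mon_weight (gweight m) t \<le> m * mon_weight (gdeg m) t"
  unfolding mon_weight_def sum_distrib_left
  by (intro sum_mono) (metis gweight_le mult.assoc mult_le_mono1)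

lemma subst_gen_Suc:
  assumes "u \<in> poly_ring {..<nvars m}"
  shows "poly_subst (gen (Suc m)) u = \<phi> (Suc m) (poly_subst (gen m) u)"
  by (rule hom_eq_on_poly_ring[OF subst.comm_ring_hom_axioms
        comm_ring_hom_comp[OF comm_ring_hom_\<phi> subst.comm_ring_hom_axioms] assms]) simp_all

text \<open>\<open>Var s ^ q - T\<close> is then a homogeneous relation of the triangular shape
  expected by the locale \<open>triangular\<close>.\<close>

definition is_tail :: "nat \<Rightarrow> nat \<Rightarrow> (nat, 'k) mpoly \<Rightarrow> bool"
  where "is_tail m s T \<longleftrightarrow> keys T \<subseteq> red m \<and> homogeneous (gdeg m) (q * gdeg m s) T \<and>
    poly_subst (gen m) T = gen m s ^ q \<and> (\<forall>t\<in>keys T. mon_weight (gweight m) t < q * gweight m s)"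

lemma red_poly_ring: "keys u \<subseteq> red m \<Longrightarrow> u \<in> poly_ring {..<nvars m}"
  unfolding poly_ring_def red_def by blast

text \<open>Since \<open>\<xi>\<^sub>i ^ q - \<phi> \<xi>\<^sub>i\<close> vanishes modulo \<open>x\<close>, it is \<open>x\<close> times an invariant.\<close>

lemma tail_exists: "s \<in> set (zvars m) \<Longrightarrow> \<exists>T. is_tail m s T"
proof (induction m arbitrary: s)
  case (Suc m)
  then consider "s \<in> set (zvars m)" | "s \<in> {nvars m + 2..<nvars m + 2 * m + 2}" by auto
  then show ?case
  proof cases
    case 1
    then have s: "s < nvars m" using zvars_less by blast
    from Suc.IH[OF 1] obtain T where T: "is_tail m s T" by blast
    have k: "keys t \<subseteq> {..<nvars m}" if "t \<in> keys T" for t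
      using T that unfolding is_tail_def red_def by blast
    have w: "mon_weight (gdeg (Suc m)) t = q * (q * gdeg m s)"
      "mon_weight (gweight (Suc m)) t < q * (q * gweight m s)" if "t \<in> keys T" for t
      using T that q_gt_1 unfolding mon_weight_old[OF k[OF that]] is_tail_def homogeneous_def by simp_all
    \<comment> \<open>Old relations persist: \<phi> is a ring homomorphism, and passing to the next
      rank multiplies the degrees and weights of old variables by \<open>q\<close>.\<close>
    have "is_tail (Suc m) s T"
      unfolding is_tail_def
    proof (intro conjI ballI)
      show "keys T \<subseteq> red (Suc m)" using T red_Suc unfolding is_tail_def by blast
      show "homogeneous (gdeg (Suc m)) (q * gdeg (Suc m) s) T"
        using w(1) s by (simp add: homogeneous_def)
      have "T \<in> poly_ring {..<nvars m}" using T unfolding is_tail_def by (intro red_poly_ring) blast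
      then show "poly_subst (gen (Suc m)) T = gen (Suc m) s ^ q"
        using T s unfolding is_tail_def by (simp add: subst_gen_Suc phi.hom_power del: gen.simps) (simp add: phi.hom_power)
      show "mon_weight (gweight (Suc m)) t < q * gweight (Suc m) s" if "t \<in> keys T" for t
        using w(2)[OF that] s by simp
    qed
    then show ?thesis by blast
  next
    case 2
    define i where "i = s - nvars m - 1"
    have i: "i \<ge> 1" "i \<le> 2 * m" using 2 by (auto simp: i_def)
    have gs: "gen (Suc m) s = \<xi> (Suc m) i" using 2 by (auto simp: i_def)
    have sN: "s < nvars (Suc m)" using 2 unfolding nvars_Suc by simp
    let ?D = "q * gdeg (Suc m) s"
    have D0: "?D > 0" using gdeg_pos[OF sN] q_gt_1 by simp
    have "gweight (Suc m) s = Suc m * gdeg (Suc m) s" using 2 by (auto simp del: mult_Suc gdeg.simps)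
    then have om: "q * gweight (Suc m) s = Suc m * ?D" by (simp only: mult.left_commute)
    have at0_diff: "at0 m (\<xi> (Suc m) i ^ q - \<phi> (Suc m) (\<xi> m i :: (int, 'k) mpoly)) = 0"
      by (simp only: at0.hom_minus at0.hom_power at0_phi[OF \<xi>_S] at0_\<xi>[OF i(1)] diff_self)
    have diff_inv: "\<xi> (Suc m) i ^ q - \<phi> (Suc m) (\<xi> m i :: (int, 'k) mpoly) \<in> invariants (Suc m)"
      by (intro invariants_diff invariants_power phi_invariants \<xi>_invariant i)
    obtain g where g: "g \<in> invariants (Suc m)" "\<xi> (Suc m) i ^ q - \<phi> (Suc m) (\<xi> m i :: (int, 'k) mpoly) = xM m * g"
      by (rule invariant_div_x[OF diff_inv at0_diff]) (rule that)
    obtain u where u: "g = poly_subst (gen (Suc m)) u" "keys u \<subseteq> red (Suc m)"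
      using invariants_span[OF g(1)] unfolding span_red_def by blast
    obtain v where v: "\<xi> m i = poly_subst (gen m) v" "keys v \<subseteq> red m"
      using invariants_span[OF \<xi>_invariant[OF i(1)]] unfolding span_red_def by blast
    \<comment> \<open>\<open>v\<close> expresses \<xi>_i of rank \<open>m\<close>, and at the old
      positions \<open>gen (Suc m)\<close> turns it into its image under \<phi>; \<open>u\<close>
      expresses the cofactor of x, which sits at position \<open>nvars m\<close>.\<close>
    define T0 where "T0 = v + Var (nvars m) * u"
    have kT0: "t \<in> keys v \<or> (\<exists>r\<in>keys u. t = single (nvars m) 1 + r)" if t: "t \<in> keys T0" for t
    proof -
      have "t \<in> keys v \<union> keys (Var (nvars m) * u)"
        using t unfolding T0_def by (rule rev_subsetD) (rule keys_add)
      moreover have "keys (Var (nvars m) * u) \<subseteq> (+) (single (nvars m) 1) ` keys u"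
        unfolding Var_def by (rule single_times_keys)
      ultimately show ?thesis by blast
    qed
    have red0: "keys T0 \<subseteq> red (Suc m)"
    proof
      fix t assume "t \<in> keys T0"
      from kT0[OF this] show "t \<in> red (Suc m)"
      proof (elim disjE bexE)
        assume "t \<in> keys v"
        then show ?thesis using v(2) red_Suc by blast
      next
        fix r assume r: "r \<in> keys u" "t = single (nvars m) 1 + r"
        then have "r \<in> red (Suc m)" using u(2) by blast
        then obtain t' j n a where c: "r = comb m t' j n a" "t' \<in> red m" "a \<in> red_exps m" by (elim red_comb) blast
        have "t = comb m t' (1 + j) n a" unfolding r(2) c(1) comb_def single_add by (simp only: ac_simps)
        then show ?thesis using comb_red[OF c(2,3)] by simp
      qed
    qed
    have sub0: "poly_subst (gen (Suc m)) T0 = gen (Suc m) s ^ q"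
    proof -
      have "poly_subst (gen (Suc m)) T0 = \<phi> (Suc m) (\<xi> m i) + xM m * g"
        unfolding T0_def subst.hom_add subst.hom_mult subst_Var u(1)[symmetric]
          subst_gen_Suc[OF red_poly_ring[OF v(2)]] v(1)[symmetric] by (simp del: of_nat_Suc)
      also have "\<dots> = gen (Suc m) s ^ q" unfolding g(2)[symmetric] gs by simp
      finally show ?thesis .
    qed
    have hom: "homogeneous (\<lambda>_. 1) ?D (gen (Suc m) s ^ q)"
      using homogeneous_power[OF homogeneous_gen[OF sN], of q] by (simp only: mult.commute)
    \<comment> \<open>The chosen expressions need not be homogeneous; the component of the right
      degree still represents the same power.\<close>
    define T where "T = hom_part (gdeg (Suc m)) ?D T0"
    have kT: "t \<in> keys T0" "mon_weight (gdeg (Suc m)) t = ?D" if "t \<in> keys T" for t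
      using that unfolding T_def keys_hom_part by blast+
    have "is_tail (Suc m) s T"
      unfolding is_tail_def
    proof (intro conjI ballI)
      show "keys T \<subseteq> red (Suc m)" using kT(1) red0 by blast
      show "homogeneous (gdeg (Suc m)) ?D T" unfolding homogeneous_def using kT(2) by blast
      show "poly_subst (gen (Suc m)) T = gen (Suc m) s ^ q"
        unfolding T_def
        by (rule subst_hom_part[OF homogeneous_gen red_poly_ring[OF red0] sub0 hom]) simp
      fix t assume t: "t \<in> keys T"
      have "mon_weight (gweight (Suc m)) t < Suc m * ?D"
        using kT0[OF kT(1)[OF t]]
      proof (elim disjE bexE)
        \<comment> \<open>Old variables have level at most \<open>m\<close>, so at equal degree the
          weight stays below that of level \<open>m + 1\<close>.\<close>
        assume "t \<in> keys v"
        then have k: "keys t \<subseteq> {..<nvars m}" using v(2) unfolding red_def by blast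
        have "mon_weight (gweight (Suc m)) t \<le> q * (m * mon_weight (gdeg m) t)"
          unfolding mon_weight_old(2)[OF k] using mon_weight_gweight_le by simp
        also have "\<dots> = m * ?D" using kT(2)[OF t] unfolding mon_weight_old(1)[OF k] by (simp add: mult_ac)
        also have "\<dots> < Suc m * ?D" using D0 by simp
        finally show ?thesis .
      next
        \<comment> \<open>x has degree 1 and weight 0: it uses up degree without adding weight,
          which makes the inequality strict.\<close>
        fix r assume r: "r \<in> keys u" "t = single (nvars m) 1 + r"
        have "?D = 1 + mon_weight (gdeg (Suc m)) r"
          using kT(2)[OF t] unfolding r(2) mon_weight_add by simp
        then have "mon_weight (gdeg (Suc m)) r < ?D" by simp
        have "mon_weight (gweight (Suc m)) t = mon_weight (gweight (Suc m)) r"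
          unfolding r(2) mon_weight_add by simp
        also have "\<dots> \<le> Suc m * mon_weight (gdeg (Suc m)) r" by (rule mon_weight_gweight_le)
        also have "\<dots> < Suc m * ?D" using \<open>mon_weight (gdeg (Suc m)) r < ?D\<close> by (rule mult_strict_left_mono) simp
        finally show ?thesis .
      qed
      then show "mon_weight (gweight (Suc m)) t < q * gweight (Suc m) s" unfolding om .
    qed
    then show ?thesis by blast
  qed
qed simp

section \<open>The complete intersection and the Khovanskii basis\<close>

lemma subalgebra_invariants: "subalgebra (invariants m :: (int, 'k) mpoly set)"
  unfolding subalgebra_def using invariants_Const invariants_add invariants_mult by blast

lemma alg_gen_gen: "alg_gen (gen m ` {..<nvars m}) = invariants m"
proof
  show "alg_gen (gen m ` {..<nvars m}) \<subseteq> invariants m"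
    using gen_invariant by (intro alg_gen_minimal subalgebra_invariants) auto
  show "invariants m \<subseteq> alg_gen (gen m ` {..<nvars m})"
  proof
    fix f :: "(int, 'k) mpoly" assume "f \<in> invariants m"
    then obtain u where u: "f = poly_subst (gen m) u" "keys u \<subseteq> red m"
      using invariants_span unfolding span_red_def by blast
    have "gen m i \<in> alg_gen (gen m ` {..<nvars m})" if "i < nvars m" for i
      using alg_gen_superset[of "gen m ` {..<nvars m}"] that by blast
    moreover have "i < nvars m" if "t \<in> keys u" "i \<in> keys t" for i t
      using that u(2) unfolding red_def by blast
    ultimately show "f \<in> alg_gen (gen m ` {..<nvars m})"
      unfolding u(1) subst_eq_sum
      by (intro subalgebra_sum subalgebra_mult subalgebra_Const subalgebra_mon_val subalgebra_alg_gen) blast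
  qed
qed

lemma complete_intersection_invariants: "complete_intersection (invariants m :: (int, 'k) mpoly set)"
proof -
  define T where "T s = (SOME T. is_tail m s T)" for s
  have T: "is_tail m s (T s)" if "s \<in> set (zvars m)" for s
    unfolding T_def using tail_exists[OF that] by (rule someI_ex)
  interpret triangular "nvars m" "zvars m" q T "gweight m"
  proof
    show "T s \<in> poly_ring {..<nvars m}" if "s \<in> set (zvars m)" for s
      using T[OF that] unfolding is_tail_def by (intro red_poly_ring) blast
    show "mon_weight (gweight m) t < q * gweight m s" if "s \<in> set (zvars m)" "t \<in> keys (T s)" for s t
      using T[OF that(1)] that(2) unfolding is_tail_def by blast
  qed (use q_gt_1 distinct_zvars zvars_less in auto)
  have hom: "homogeneous (gdeg m) (q * gdeg m s) (rel s)" if s: "s \<in> set (zvars m)" for s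
    unfolding rel_def using homogeneous_power[OF homogeneous_Var[of "gdeg m" s], of q] T[OF s]
    by (intro homogeneous_diff) (simp_all add: is_tail_def mult.commute)
  have ker: "{F \<in> R. poly_subst (gen m) F = 0} = ideal_in R (map rel (zvars m))"
  proof (rule kernel)
    show "poly_subst (gen m) (rel s) = 0" if "s \<in> set (zvars m)" for s
      using T[OF that] by (simp add: rel_def subst.hom_minus subst.hom_power is_tail_def)
    show "u = 0" if u: "u \<in> R" "\<And>t. t \<in> keys u \<Longrightarrow> reduced t" "poly_subst (gen m) u = 0" for u
    proof (rule ccontr)
      have "keys u \<subseteq> red m" using u(1,2) unfolding poly_ring_def reduced_def red_def by blast
      moreover assume "u \<noteq> 0"
      ultimately show False by (rule lead_term_reduced) (simp add: u(3))
    qed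
  qed
  show ?thesis
    unfolding complete_intersection_def
  proof (intro exI conjI)
    show "\<forall>i<nvars m. 0 < gdeg m i \<and> homogeneous (\<lambda>_. 1) (gdeg m i) (gen m i)"
      using gdeg_pos homogeneous_gen by blast
    show "\<forall>f\<in>set (map rel (zvars m)). \<exists>e. homogeneous (gdeg m) e f" using hom by auto
  qed (rule alg_gen_gen regular ker)+
qed

text \<open>The unrestricted exponents belong to x, N(y) and, through \<phi>, to older orbit
  products, all in \<open>H0\<close>; the exponents below \<open>q\<close> make up one element of
  \<open>M\<close>. A list is used because factors repeat.\<close>

lemma red_factorization:
  assumes "t \<in> red m"
  shows "\<exists>hs \<mu>. set hs \<subseteq> H0 m \<and> \<mu> \<in> M m \<and> mon_val (gen m) t = prod_list hs * \<mu>"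
  using assms
proof (induction m arbitrary: t)
  case 0
  then have "t = 0" by (simp add: red_def)
  then show ?case by (intro exI[of _ "[]"] exI[of _ 1]) simp
next
  case (Suc m)
  obtain t' j n a where t: "t = comb m t' j n a" "t' \<in> red m" "a \<in> red_exps m"
    by (rule red_comb[OF Suc.prems]) (rule that)
  obtain hs \<mu> where h: "set hs \<subseteq> H0 m" "\<mu> \<in> M m" "mon_val (gen m) t' = prod_list hs * \<mu>"
    using Suc.IH[OF t(2)] by blast
  have ka: "keys a \<subseteq> {1..2 * m}" using t(3) by (simp add: red_exps_def)
  let ?\<beta> = "mon_val (\<xi> (Suc m)) a :: (int, 'k) mpoly"
  have "?\<beta> = (\<Prod>i = 1..2 * Suc m - 2. \<xi> (Suc m) i ^ lookup a i)"
    using mon_val_superset[OF finite_atLeastAtMost ka] by simp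
  moreover have "\<forall>i\<in>{1..2 * Suc m - 2}. lookup a i \<le> CARD('k) - 1"
    unfolding card_field
  proof
    fix i
    have "lookup a i < q" using t(3) by (simp add: red_exps_def)
    then show "lookup a i \<le> q - 1" by arith
  qed
  ultimately have \<beta>: "?\<beta> \<in> BH (Suc m)" unfolding BH_def by blast
  let ?hs = "map (\<phi> (Suc m)) hs @ replicate j (xM m) @ replicate n (Ny m)"
  have "mon_val (gen (Suc m)) t = \<phi> (Suc m) (prod_list hs * \<mu>) * xM m ^ j * Ny m ^ n * ?\<beta>"
    unfolding t(1) using t(2) ka by (subst mon_val_gen_comb) (simp_all add: red_def gen_term_def h(3) del: of_nat_Suc)
  also have "\<dots> = prod_list ?hs * (?\<beta> * \<phi> (Suc m) \<mu>)"
    by (simp only: prod_list.append prod_list_replicate phi.hom_prod_list[symmetric] phi.hom_mult mult_ac)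
  finally have "mon_val (gen (Suc m)) t = prod_list ?hs * (?\<beta> * \<phi> (Suc m) \<mu>)" .
  moreover have "set ?hs \<subseteq> H0 (Suc m)" using h(1) unfolding H0_Suc by auto
  moreover have "?\<beta> * \<phi> (Suc m) \<mu> \<in> M (Suc m)" unfolding M_Suc using \<beta> h(2) by blast
  ultimately show ?case by blast
qed

lemma M_invariants: "(M m :: (int, 'k) mpoly set) \<subseteq> invariants m"
proof (induction m)
  case 0
  show ?case using invariants_1 by simp
next
  case (Suc m)
  have "BH (Suc m) \<subseteq> (invariants (Suc m) :: (int, 'k) mpoly set)"
    unfolding BH_def by (auto intro!: invariants_prod invariants_power \<xi>_invariant)
  then show ?case unfolding M_Suc using Suc phi_invariants by (auto intro!: invariants_mult)
qed

lemma H0_invariants: "(H0 m :: (int, 'k) mpoly set) \<subseteq> invariants m"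
  unfolding H0_def xv_def yv_def by (auto intro!: orbit_prod_invariant)

text \<open>The lead term of a nonzero invariant is a scalar times that of a single reduced
  monomial, hence by multiplicativity a scalar times a product of lead terms of elements of
  \<open>H0\<close> and \<open>M\<close>.\<close>

lemma khovanskii_basis_invariants: "khovanskii_basis (H0 m \<union> M m) (invariants m :: (int, 'k) mpoly set)"
proof -
  let ?B = "H0 m \<union> M m :: (int, 'k) mpoly set"
  let ?A = "alg_gen (lead_term ` ?B)"
  have sub: "?B \<subseteq> invariants m" using H0_invariants M_invariants by blast
  have B: "lead_term f \<in> ?A" if "f \<in> ?B" for f
    using that by (intro subsetD[OF alg_gen_superset]) (rule imageI)
  have "lead_term f \<in> ?A" if f: "f \<in> invariants m" for f
  proof (cases "f = 0")
    case True
    then show ?thesis using subalgebra_0[OF subalgebra_alg_gen] by (simp add: lead_term_def Let_def)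
  next
    case False
    obtain u where u: "f = poly_subst (gen m) u" "keys u \<subseteq> red m"
      using invariants_span[OF f] unfolding span_red_def by blast
    have "u \<noteq> 0" using False u(1) by auto
    then obtain t where t: "t \<in> keys u" "lead_term f = single (lmon m t) (lookup u t)"
      unfolding u(1) by (rule lead_term_reduced[OF u(2)])
    have tr: "t \<in> red m" using t(1) u(2) by blast
    obtain hs \<mu> where h: "set hs \<subseteq> H0 m" "\<mu> \<in> M m" "mon_val (gen m) t = prod_list hs * \<mu>"
      using red_factorization[OF tr] by blast
    have "lead_term f = Const (lookup u t) * lead_term (mon_val (gen m) t)"
      unfolding t(2) LM_lead_term[OF LM_lmon[OF tr]] by (simp add: Const_def mult_single)
    also have "lead_term (mon_val (gen m) t) = prod_list (map lead_term hs) * lead_term \<mu>"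
      unfolding h(3) by (simp only: lead_term_mult lead_term_prod_list)
    also have "Const (lookup u t) * \<dots> \<in> ?A"
    proof (intro subalgebra_mult subalgebra_Const subalgebra_prod_list subalgebra_alg_gen)
      show "set (map lead_term hs) \<subseteq> ?A" using h(1) B by auto
      show "lead_term \<mu> \<in> ?A" using h(2) B by blast
    qed
    finally show ?thesis .
  qed
  then have "lead_term_algebra (invariants m) \<subseteq> ?A"
    unfolding lead_term_algebra_def by (intro alg_gen_minimal subalgebra_alg_gen) blast
  moreover have "?A \<subseteq> lead_term_algebra (invariants m)"
    unfolding lead_term_algebra_def using sub by (intro alg_gen_mono image_mono)
  ultimately show ?thesis unfolding khovanskii_basis_def using sub by blast
qed

end

theorem theorem5p15:
  fixes p e m :: nat
  assumes "prime p" and "odd p" and "CARD('k::{field,finite}) = p ^ e" and "m \<ge> 1"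
  shows "khovanskii_basis (H0 m \<union> M m) (invariants m :: (int, 'k) mpoly set) \<and>
    complete_intersection (invariants m :: (int, 'k) mpoly set)"
proof -
  interpret finite_field_char p e "CARD('k)" "TYPE('k)"
    by standard (use assms in simp_all)
  show ?thesis
    by (intro conjI khovanskii_basis_invariants complete_intersection_invariants)
qed

end
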